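(* Let $k\in\mathbb C\setminus\mathbb Z_{\ge0}$ and $\lambda_1,\lambda_2\in\mathbb C$. Assume that $R$ is an irreducible $\mathbb Z_{\ge0}$-graded $\mathcal W_k$-module with top component $R_{top}$. Then $R\otimes\Pi_{-1,-1}(\lambda_1,\lambda_2)$ is an almost irreducible $L_k(\mathfrak{sl}_3)$-module, in the sense that any non-zero $L_k(\mathfrak{sl}_3)$-submodule $W$ of $R\otimes\Pi_{-1,-1}(\lambda_1,\lambda_2)$ intersects $R_{top}\otimes\Pi_{-1,-1}(\lambda_1,\lambda_2)_{top}$ non-trivially.
   Context: $V^k(\mathfrak{sl}_3)$ is the universal affine vertex algebra of level $k$, $L_k(\mathfrak{sl}_3)$ its simple (graded) quotient. Notation: $e_1=e_{1,2}$, $e_2=e_{2,3}$, $e_3=e_{1,3}$, $h_1=e_{1,1}-e_{2,2}$, $h_2=e_{2,2}-e_{3,3}$, $f_1=e_{2,1}$, $f_2=e_{3,2}$, $f_3=e_{3,1}=[f_2,f_1]$. Bershadsky-Polyakov algebra. For $k\neq-3$, $\mathcal W^k$ is freely and strongly generated by $J,G^\pm,L^{\rm BP}$: $L^{\rm BP}$ is a Virasoro field of central charge $-\frac{(2k+3)(3k+1)}{k+3}$; $J$, $G^\pm$ are primary of weights $1$, $\frac32$; $J(z)J(w)\sim\frac{2k+3}{3(z-w)^2}$; $J(z)G^\pm(w)\sim\frac{\pm G^\pm(w)}{z-w}$; $G^\pm(z)G^\pm(w)\sim0$; and $$G^+(z)G^-(w)\sim\frac{(k+1)(2k+3)}{(z-w)^3}+\frac{3(k+1)J(w)}{(z-w)^2}+\frac{1}{z-w}\Big(3{:}J(w)^2{:}+\tfrac{3(k+1)}2\partial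 J(w)-(k+3)L^{\rm BP}(w)\Big).$$ For $k=-3$, $L^{\rm BP}$ is replaced by a commutative field $T^{\rm BP}$ of weight 2 via $(k+3)L^{\rm BP}\mapsto T^{\rm BP}$. $\mathcal W^k$ is $\mathbb Z_{\ge0}$-graded with $J,G^+,G^-$ of weights $1,1,2$ (for $k\ne-3$: grading by the zero mode of $\widetilde L=L^{\rm BP}+\frac12\partial J$), and $\mathcal W_k$ is its simple (graded) quotient. A $\mathbb Z_{\ge0}$-graded $\mathcal W_k$-module is $R=\bigoplus_{n\ge0}R(n)$, $R(0)\neq0$, such that for $A$ of weight $\Delta$ (in this grading) the mode $A(m)$, $A(z)=\sum A(m)z^{-m-\Delta}$, maps $R(n)$ to $R(n-m)$; $R_{top}=R(0)$. $\Pi(0)^{\otimes2}$ is the vertex algebra generated by Heisenberg fields $c_1,c_2,d_1,d_2$ with $c_i(z)d_j(w)\sim\frac{2\delta_{i,j}}{(z-w)^2}$, $c_ic_j\sim0\sim d_id_j$, and $e^{\pm c_1},e^{\pm c_2}$ (so it is $M(1)\otimes\mathbb C[\mathbb Zc_1+\mathbb Zc_2]$). $\Pi_{-1,-1}(\lambda_1,\lambda_2)=\Pi(0)^{\otimes2}e^{-\frac{d_1}2-\frac{d_2}2+\lambda_1c_1+\lambda_2c_2}$, and $\Pi_{-1,-1}(\lambda_1,\lambda_2)_{top}$ is the span of all $e^{-\frac{d_1}2-\frac{d_2}2+(\lambda_1+n_1)c_1+(\lambda_2+n_2)c_2}$, $n_1,n_2\in\mathbb Z$. The action: let $\beta=e^{c_1}$,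 $\gamma=-\frac12{:}(c_1+d_1)e^{-c_1}{:}$ (generating a $\beta\gamma$ vertex algebra, $\beta(z)\gamma(w)\sim\frac1{z-w}$) and $c=c_2$, $d=d_2$. There is a homomorphism $V^k(\mathfrak{sl}_3)\to\mathcal W_k\otimes\Pi(0)^{\otimes2}$ given by $e_1\mapsto-\gamma e^{c}$, $e_2\mapsto\beta$, $e_3\mapsto e^c$, $h_1\mapsto-2J+{:}\gamma\beta{:}-\frac{2k+9}6c+\frac12d$, $h_2\mapsto J-2{:}\gamma\beta{:}+\frac{4k+9}6c+\frac12d$, $f_1\mapsto G^+-{:}(2J+\frac{8k+9}6c-\frac12d)\beta e^{-c}{:}+(k+1)(\partial\beta)e^{-c}$, $f_2\mapsto G^-e^{-c}+(J+\frac{4k+9}6c+\frac12d)\gamma+k\,\partial\gamma-{:}\gamma^2\beta{:}$ ($f_3$ determined by $f_3=[f_2,f_1]$), which for $k\notin\mathbb Z_{\ge0}$ factors through an embedding of $L_k(\mathfrak{sl}_3)$; in this way $R\otimes\Pi_{-1,-1}(\lambda_1,\lambda_2)$ is an $L_k(\mathfrak{sl}_3)$-module. *)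

theory Defs
  imports "HOL-Analysis.Determinants" "HOL-Library.Poly_Mapping" "HOL-Library.Multiset"
begin

section \<open>Complex vector spaces\<close>

class complex_vector = ab_group_add +
  fixes scaleC :: "complex \<Rightarrow> 'a \<Rightarrow> 'a"  (infixr "*\<^sub>C" 75)
  assumes scaleC_add_right: "c *\<^sub>C (x + y) = c *\<^sub>C x + c *\<^sub>C y"
    and scaleC_add_left: "(c + d) *\<^sub>C x = c *\<^sub>C x + d *\<^sub>C x"
    and scaleC_scaleC: "c *\<^sub>C d *\<^sub>C x = (c * d) *\<^sub>C x"
    and scaleC_one: "1 *\<^sub>C x = x"

global_interpretation cvec: vector_space "scaleC :: complex \<Rightarrow> 'a \<Rightarrow> 'a::complex_vector"
  by unfold_locales (simp_all add: scaleC_add_right scaleC_add_left scaleC_scaleC scaleC_one)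

instantiation complex :: complex_vector
begin

definition scaleC_complex :: "complex \<Rightarrow> complex \<Rightarrow> complex"
  where "scaleC_complex c x = c * x"

instance by standard (simp_all add: scaleC_complex_def algebra_simps)

end

instantiation poly_mapping :: (type, complex_vector) complex_vector
begin

definition scaleC_poly_mapping :: "complex \<Rightarrow> ('a \<Rightarrow>\<^sub>0 'b) \<Rightarrow> ('a \<Rightarrow>\<^sub>0 'b)"
  where "scaleC_poly_mapping c = Poly_Mapping.map (scaleC c)"

instance
proof
  have lk: "Poly_Mapping.lookup (c *\<^sub>C p) b = c *\<^sub>C Poly_Mapping.lookup p b"
    for c and p :: "'a \<Rightarrow>\<^sub>0 'b" and b
    by (simp add: scaleC_poly_mapping_def map.rep_eq when_def)
  fix c d :: complex and x y :: "'a \<Rightarrow>\<^sub>0 'b"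
  show "c *\<^sub>C (x + y) = c *\<^sub>C x + c *\<^sub>C y"
    by (rule poly_mapping_eqI) (simp add: lk lookup_add scaleC_add_right)
  show "(c + d) *\<^sub>C x = c *\<^sub>C x + d *\<^sub>C x"
    by (rule poly_mapping_eqI) (simp add: lk lookup_add scaleC_add_left)
  show "c *\<^sub>C d *\<^sub>C x = (c * d) *\<^sub>C x"
    by (rule poly_mapping_eqI) (simp add: lk)
  show "1 *\<^sub>C x = x"
    by (rule poly_mapping_eqI) (simp add: lk)
qed

end

definition linear_map :: "('a::complex_vector \<Rightarrow> 'b::complex_vector) \<Rightarrow> bool" where
  "linear_map f \<longleftrightarrow> (\<forall>x y. f (x + y) = f x + f y) \<and> (\<forall>c x. f (c *\<^sub>C x) = c *\<^sub>C f x)"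

definition lin_extend :: "('i \<Rightarrow> 'a::complex_vector) \<Rightarrow> ('i \<Rightarrow>\<^sub>0 complex) \<Rightarrow> 'a" where
  "lin_extend f p = (\<Sum>i\<in>Poly_Mapping.keys p. Poly_Mapping.lookup p i *\<^sub>C f i)"

definition direct_sum_decomp :: "(nat \<Rightarrow> 'a::complex_vector set) \<Rightarrow> bool" where
  "direct_sum_decomp gr \<longleftrightarrow> (\<forall>n. cvec.subspace (gr n)) \<and>
     (\<forall>v. \<exists>!f :: nat \<Rightarrow>\<^sub>0 'a. (\<forall>n. Poly_Mapping.lookup f n \<in> gr n) \<and>
        v = (\<Sum>n\<in>Poly_Mapping.keys f. Poly_Mapping.lookup f n))"

definition graded_subspace :: "(nat \<Rightarrow> 'a::complex_vector set) \<Rightarrow> 'a set \<Rightarrow> bool" where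
  "graded_subspace gr U \<longleftrightarrow> cvec.subspace U \<and> U \<subseteq> cvec.span (\<Union>n. gr n \<inter> U)"


section \<open>Vertex algebras and their modules\<close>

text \<open>
  Fields are encoded by their modes: \<open>nprod V a n b\<close> is \<open>a\<^sub>(\<^sub>n\<^sub>) b\<close>, where
  \<open>a(z) = \<Sum>n. a\<^sub>(\<^sub>n\<^sub>) z^(-n-1)\<close>, and likewise an action \<open>A\<close> has \<open>A a n w = a\<^sub>(\<^sub>n\<^sub>) w\<close>.
  The operator \<open>Sum_any\<close> is the sum over all indices with non-zero summand; all its uses below
  have finitely many such indices because of the truncation property.
\<close>

record 'v vertex_alg =
  vac :: 'v
  nprod :: "'v \<Rightarrow> int \<Rightarrow> 'v \<Rightarrow> 'v"

text \<open>Here \<open>V\<close> need not be assumed to be a vertex algebra; taking \<open>A = nprod V\<close>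
  yields the axioms of a vertex algebra itself, up to the creation property.\<close>

definition va_module ::
  "'v::complex_vector vertex_alg \<Rightarrow> ('v \<Rightarrow> int \<Rightarrow> 'm::complex_vector \<Rightarrow> 'm) \<Rightarrow> bool" where
  "va_module V A \<longleftrightarrow>
     (\<forall>a n. linear_map (A a n)) \<and>
     (\<forall>n w. linear_map (\<lambda>a. A a n w)) \<and>
     (\<forall>a w. \<exists>N. \<forall>n\<ge>N. A a n w = 0) \<and>
     (\<forall>n w. A (vac V) n w = (if n = -1 then w else 0)) \<and>
     (\<forall>a b w l m n.
        Sum_any (\<lambda>j::nat. (of_int m gchoose j) *\<^sub>C A (nprod V a (l + int j) b) (m + n - int j) w) =
        Sum_any (\<lambda>j::nat. ((-1) ^ j * (of_int l gchoose j)) *\<^sub>C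
           (A a (m + l - int j) (A b (n + int j) w)
            - (-1) powi l *\<^sub>C A b (n + l - int j) (A a (m + int j) w))))"

definition vertex_algebra :: "'v::complex_vector vertex_alg \<Rightarrow> bool" where
  "vertex_algebra V \<longleftrightarrow> va_module V (nprod V) \<and>
     (\<forall>a n. n \<ge> -1 \<longrightarrow> nprod V a n (vac V) = (if n = -1 then a else 0))"

definition va_hom ::
  "'v::complex_vector vertex_alg \<Rightarrow> 'w::complex_vector vertex_alg \<Rightarrow> ('v \<Rightarrow> 'w) \<Rightarrow> bool" where
  "va_hom V W f \<longleftrightarrow> linear_map f \<and> f (vac V) = vac W \<and>
     (\<forall>a n b. f (nprod V a n b) = nprod W (f a) n (f b))"

definition va_ideal :: "'v::complex_vector vertex_alg \<Rightarrow> 'v set \<Rightarrow> bool" where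
  "va_ideal V I \<longleftrightarrow> cvec.subspace I \<and>
     (\<forall>a n u. u \<in> I \<longrightarrow> nprod V a n u \<in> I \<and> nprod V u n a \<in> I)"

definition submodule :: "('v \<Rightarrow> int \<Rightarrow> 'm::complex_vector \<Rightarrow> 'm) \<Rightarrow> 'm set \<Rightarrow> bool" where
  "submodule A U \<longleftrightarrow> cvec.subspace U \<and> (\<forall>a n w. w \<in> U \<longrightarrow> A a n w \<in> U)"

definition normal_ordered :: "'v vertex_alg \<Rightarrow> 'v \<Rightarrow> 'v \<Rightarrow> 'v" where
  "normal_ordered V a b = nprod V a (-1) b"

definition deriv_field :: "'v vertex_alg \<Rightarrow> 'v \<Rightarrow> 'v" where
  "deriv_field V a = nprod V a (-2) (vac V)"

text \<open>\<open>a(z) b(w) \<sim> cs ! 0 / (z-w) + cs ! 1 / (z-w)\<^sup>2 + \<dots>\<close>\<close>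

definition ope :: "'v::complex_vector vertex_alg \<Rightarrow> 'v \<Rightarrow> 'v \<Rightarrow> 'v list \<Rightarrow> bool" where
  "ope V a b cs \<longleftrightarrow> (\<forall>n. nprod V a (int n) b = (if n < length cs then cs ! n else 0))"


subsection \<open>Free strong generation and simple graded quotients\<close>

text \<open>The word \<open>[(i\<^sub>1,n\<^sub>1),\<dots>,(i\<^sub>r,n\<^sub>r)]\<close> stands for
  \<open>g\<^sub>i\<^sub>1\<^sub>(\<^sub>-\<^sub>n\<^sub>1\<^sub>-\<^sub>1\<^sub>) \<dots> g\<^sub>i\<^sub>r\<^sub>(\<^sub>-\<^sub>n\<^sub>r\<^sub>-\<^sub>1\<^sub>) vac\<close>.\<close>

fun va_monomial :: "'v vertex_alg \<Rightarrow> 'v list \<Rightarrow> (nat \<times> nat) list \<Rightarrow> 'v" where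
  "va_monomial V gs [] = vac V"
| "va_monomial V gs ((i, n) # ps) = nprod V (gs ! i) (- int n - 1) (va_monomial V gs ps)"

definition pbw_words :: "nat \<Rightarrow> (nat \<times> nat) list set" where
  "pbw_words r = {ps. (\<forall>(i, n)\<in>set ps. i < r) \<and>
     sorted_wrt (\<lambda>(i, n) (j, m). i < j \<or> i = j \<and> m \<le> n) ps}"

definition freely_strongly_generated :: "'v::complex_vector vertex_alg \<Rightarrow> 'v list \<Rightarrow> bool" where
  "freely_strongly_generated V gs \<longleftrightarrow>
     inj_on (va_monomial V gs) (pbw_words (length gs)) \<and>
     cvec.independent (va_monomial V gs ` pbw_words (length gs)) \<and>
     cvec.span (va_monomial V gs ` pbw_words (length gs)) = UNIV"

text \<open>The grading of a freely strongly generated vertex algebra in which \<open>gs ! i\<close> has weight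
  \<open>ws ! i\<close>.\<close>

definition weight_grading ::
  "'v::complex_vector vertex_alg \<Rightarrow> 'v list \<Rightarrow> nat list \<Rightarrow> nat \<Rightarrow> 'v set" where
  "weight_grading V gs ws N = cvec.span (va_monomial V gs `
     {ps \<in> pbw_words (length gs). (\<Sum>(i, n)\<leftarrow>ps. ws ! i + n) = N})"

definition simple_graded_quotient ::
  "'v::complex_vector vertex_alg \<Rightarrow> (nat \<Rightarrow> 'v set) \<Rightarrow> ('v \<Rightarrow> 'w::complex_vector) \<Rightarrow>
   'w vertex_alg \<Rightarrow> bool" where
  "simple_graded_quotient V gr \<pi> Q \<longleftrightarrow>
     vertex_algebra Q \<and> va_hom V Q \<pi> \<and> surj \<pi> \<and>
     (let K = {v. \<pi> v = 0} in
        va_ideal V K \<and> graded_subspace gr K \<and> K \<noteq> UNIV \<and>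
        (\<forall>I. va_ideal V I \<and> graded_subspace gr I \<and> I \<noteq> UNIV \<longrightarrow> I \<subseteq> K))"


subsection \<open>Graded modules\<close>

text \<open>Here \<open>a(m) = a\<^sub>(\<^sub>m\<^sub>+\<^sub>\<Delta>\<^sub>-\<^sub>1\<^sub>)\<close> for \<open>a\<close> of weight \<open>\<Delta>\<close>.\<close>

definition graded_module ::
  "'v::complex_vector vertex_alg \<Rightarrow> (nat \<Rightarrow> 'v set) \<Rightarrow>
   ('v \<Rightarrow> int \<Rightarrow> 'm::complex_vector \<Rightarrow> 'm) \<Rightarrow> (nat \<Rightarrow> 'm set) \<Rightarrow> bool" where
  "graded_module V gr A R \<longleftrightarrow>
     va_module V A \<and> direct_sum_decomp R \<and> R 0 \<noteq> {0} \<and>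
     (\<forall>\<Delta> n. \<forall>a\<in>gr \<Delta>. \<forall>w\<in>R n. \<forall>m::int.
        A a (m + int \<Delta> - 1) w \<in> (if m \<le> int n then R (nat (int n - m)) else {0}))"

text \<open>Irreducibility in the category of graded modules; in particular it holds when there are no
  proper non-zero submodules at all.\<close>

definition irreducible_graded_module ::
  "'v::complex_vector vertex_alg \<Rightarrow> (nat \<Rightarrow> 'v set) \<Rightarrow>
   ('v \<Rightarrow> int \<Rightarrow> 'm::complex_vector \<Rightarrow> 'm) \<Rightarrow> (nat \<Rightarrow> 'm set) \<Rightarrow> bool" where
  "irreducible_graded_module V gr A R \<longleftrightarrow> graded_module V gr A R \<and>
     (\<forall>U. submodule A U \<and> graded_subspace R U \<longrightarrow> U = {0} \<or> U = UNIV)"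


section \<open>The universal affine vertex algebra of \<open>sl\<^sub>3\<close>\<close>

definition mat_unit :: "3 \<Rightarrow> 3 \<Rightarrow> complex^3^3" where
  "mat_unit i j = (\<chi> a b. if a = i \<and> b = j then 1 else 0)"

definition "sl3_e1 = mat_unit 1 2"
definition "sl3_e2 = mat_unit 2 3"
definition "sl3_e3 = mat_unit 1 3"
definition "sl3_h1 = mat_unit 1 1 - mat_unit 2 2"
definition "sl3_h2 = mat_unit 2 2 - mat_unit 3 3"
definition "sl3_f1 = mat_unit 2 1"
definition "sl3_f2 = mat_unit 3 2"
definition "sl3_f3 = mat_unit 3 1"

definition sl3_gens :: "(complex^3^3 \<Rightarrow> 'v) \<Rightarrow> 'v list" where
  "sl3_gens X = map X [sl3_e1, sl3_e2, sl3_e3, sl3_h1, sl3_h2, sl3_f1, sl3_f2, sl3_f3]"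

text \<open>\<open>X x\<close> is the generator \<open>x(-1)vac\<close>, for \<open>x\<close> a traceless matrix; the values of \<open>X\<close>
  on other matrices are irrelevant. The invariant form is the trace form.\<close>

definition universal_affine_sl3 ::
  "complex \<Rightarrow> 'v::complex_vector vertex_alg \<Rightarrow> (complex^3^3 \<Rightarrow> 'v) \<Rightarrow> bool" where
  "universal_affine_sl3 k V X \<longleftrightarrow>
     vertex_algebra V \<and>
     (\<forall>x y. trace x = 0 \<and> trace y = 0 \<longrightarrow> X (x + y) = X x + X y) \<and>
     (\<forall>c x. trace x = 0 \<longrightarrow> X (\<chi> i j. c * x $ i $ j) = c *\<^sub>C X x) \<and>
     (\<forall>x y. trace x = 0 \<and> trace y = 0 \<longrightarrow>
        ope V (X x) (X y) [X (x ** y - y ** x), (k * trace (x ** y)) *\<^sub>C vac V]) \<and>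
     freely_strongly_generated V (sl3_gens X)"

definition affine_grading ::
  "'v::complex_vector vertex_alg \<Rightarrow> (complex^3^3 \<Rightarrow> 'v) \<Rightarrow> nat \<Rightarrow> 'v set" where
  "affine_grading V X = weight_grading V (sl3_gens X) (replicate 8 1)"


section \<open>The universal Bershadsky-Polyakov algebra\<close>

text \<open>The argument \<open>L\<close> is \<open>L\<^sup>B\<^sup>P\<close> for \<open>k \<noteq> -3\<close> and the central field \<open>T\<^sup>B\<^sup>P\<close> for \<open>k = -3\<close>.\<close>

definition universal_BP ::
  "complex \<Rightarrow> 'v::complex_vector vertex_alg \<Rightarrow> 'v \<Rightarrow> 'v \<Rightarrow> 'v \<Rightarrow> 'v \<Rightarrow> bool" where
  "universal_BP k V J Gp Gm L \<longleftrightarrow>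
     vertex_algebra V \<and> freely_strongly_generated V [J, Gp, Gm, L] \<and>
     ope V J J [0, ((2 * k + 3) / 3) *\<^sub>C vac V] \<and>
     ope V J Gp [Gp] \<and> ope V J Gm [- Gm] \<and>
     ope V Gp Gp [] \<and> ope V Gm Gm [] \<and>
     ope V Gp Gm
       [3 *\<^sub>C normal_ordered V J J + (3 * (k + 1) / 2) *\<^sub>C deriv_field V J
          - (if k = -3 then L else (k + 3) *\<^sub>C L),
        (3 * (k + 1)) *\<^sub>C J,
        ((k + 1) * (2 * k + 3)) *\<^sub>C vac V] \<and>
     (if k = -3 then
        ope V L L [] \<and> ope V L J [] \<and> ope V L Gp [] \<and> ope V L Gm []
      else
        ope V L L [deriv_field V L, 2 *\<^sub>C L, 0,
                   (- ((2 * k + 3) * (3 * k + 1) / (k + 3)) / 2) *\<^sub>C vac V] \<and>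
        ope V L J [deriv_field V J, J] \<and>
        ope V L Gp [deriv_field V Gp, (3/2) *\<^sub>C Gp] \<and>
        ope V L Gm [deriv_field V Gm, (3/2) *\<^sub>C Gm])"

definition BP_grading ::
  "'v::complex_vector vertex_alg \<Rightarrow> 'v \<Rightarrow> 'v \<Rightarrow> 'v \<Rightarrow> 'v \<Rightarrow> nat \<Rightarrow> 'v set" where
  "BP_grading V J Gp Gm L = weight_grading V [J, Gp, Gm, L] [1, 1, 2, 2]"


section \<open>The vertex algebra \<open>\<Pi>(0)\<^sup>\<otimes>\<^sup>2\<close> and its modules\<close>

datatype heis = C1 | C2 | D1 | D2

text \<open>The partner under the form \<open>(c\<^sub>i, d\<^sub>j) = 2 \<delta>\<^sub>i\<^sub>j\<close>, \<open>(c\<^sub>i, c\<^sub>j) = (d\<^sub>i, d\<^sub>j) = 0\<close>.\<close>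

fun partner :: "heis \<Rightarrow> heis" where
  "partner C1 = D1" | "partner C2 = D2" | "partner D1 = C1" | "partner D2 = C2"

text \<open>
  The underlying space is \<open>M(1) \<otimes> \<complex>[\<int>\<^sup>2]\<close>, realised as the commutative algebra
  of polynomials in the variables \<open>osc a n\<close> (standing for \<open>a(-n-1)\<close>) tensored with
  the group algebra spanned by \<open>lat (n\<^sub>1, n\<^sub>2)\<close>. The same space carries all modules
  \<open>\<Pi>\<^sub>r\<^sub>1\<^sub>,\<^sub>r\<^sub>2(l\<^sub>1, l\<^sub>2)\<close>: for the parameter \<open>s = ((r\<^sub>1, r\<^sub>2), (l\<^sub>1, l\<^sub>2))\<close> the element
  \<open>lat (n\<^sub>1, n\<^sub>2)\<close> stands for \<open>exp (r\<^sub>1 d\<^sub>1/2 + r\<^sub>2 d\<^sub>2/2 + (l\<^sub>1 + n\<^sub>1) c\<^sub>1 + (l\<^sub>2 + n\<^sub>2) c\<^sub>2)\<close>.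
\<close>

type_synonym fock_index = "(heis \<times> nat) multiset \<times> (int \<times> int)"
type_synonym fock = "fock_index \<Rightarrow>\<^sub>0 complex"
type_synonym shift = "(int \<times> int) \<times> (complex \<times> complex)"

definition osc :: "heis \<Rightarrow> nat \<Rightarrow> fock" where
  "osc a n = Poly_Mapping.single ({#(a, n)#}, 0) 1"

definition lat :: "int \<times> int \<Rightarrow> fock" where
  "lat q = Poly_Mapping.single ({#}, q) 1"

fun zero_eigenvalue :: "shift \<Rightarrow> heis \<Rightarrow> int \<times> int \<Rightarrow> complex" where
  "zero_eigenvalue ((r1, r2), (l1, l2)) a (n1, n2) =
     (case a of C1 \<Rightarrow> of_int r1 | C2 \<Rightarrow> of_int r2
      | D1 \<Rightarrow> 2 * (l1 + of_int n1) | D2 \<Rightarrow> 2 * (l2 + of_int n2))"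

text \<open>For \<open>n > 0\<close> the mode \<open>a(n)\<close> is the derivation \<open>2 n \<partial>/\<partial>b(-n)\<close>, \<open>b\<close> the partner of \<open>a\<close>.\<close>

definition heis_mode :: "shift \<Rightarrow> heis \<Rightarrow> int \<Rightarrow> fock \<Rightarrow> fock" where
  "heis_mode s a n v =
     (if n < 0 then osc a (nat (- n - 1)) * v
      else if n = 0 then lin_extend (\<lambda>(M, q). zero_eigenvalue s a q *\<^sub>C Poly_Mapping.single (M, q) 1) v
      else lin_extend (\<lambda>(M, q).
        let x = (partner a, nat (n - 1)) in
          (2 * of_int n * of_nat (count M x)) *\<^sub>C Poly_Mapping.single (M - {#x#}, q) 1) v)"

definition lat_mode :: "shift \<Rightarrow> int \<times> int \<Rightarrow> int \<Rightarrow> fock \<Rightarrow> fock" where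
  "lat_mode s q n v =
     of_int (fst q) *\<^sub>C heis_mode s C1 n v + of_int (snd q) *\<^sub>C heis_mode s C2 n v"

text \<open>With \<open>\<alpha> = q\<^sub>1 c\<^sub>1 + q\<^sub>2 c\<^sub>2\<close>, \<open>vop_create s q m\<close> is the coefficient of \<open>z^m\<close> in
  \<open>exp (\<Sum>n\<ge>1. \<alpha>(-n) z^n / n)\<close> and \<open>vop_annih s q m\<close> the coefficient of \<open>z^(-m)\<close> in
  \<open>exp (- (\<Sum>n\<ge>1. \<alpha>(n) z^(-n) / n))\<close>; the recursions come from the logarithmic derivatives.\<close>

fun vop_create :: "shift \<Rightarrow> int \<times> int \<Rightarrow> nat \<Rightarrow> fock \<Rightarrow> fock" where
  "vop_create s q 0 v = v"
| "vop_create s q (Suc m) v =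
     (1 / of_nat (Suc m)) *\<^sub>C (\<Sum>i\<le>m. lat_mode s q (- int (Suc i)) (vop_create s q (m - i) v))"

fun vop_annih :: "shift \<Rightarrow> int \<times> int \<Rightarrow> nat \<Rightarrow> fock \<Rightarrow> fock" where
  "vop_annih s q 0 v = v"
| "vop_annih s q (Suc m) v =
     (- 1 / of_nat (Suc m)) *\<^sub>C (\<Sum>i\<le>m. lat_mode s q (int (Suc i)) (vop_annih s q (m - i) v))"

text \<open>The \<open>n\<close>-th mode of \<open>Y(e^\<alpha>, z) = exp (\<dots>) e^\<alpha> z^(\<alpha>(0)) exp (\<dots>)\<close>. Since
  \<open>(c\<^sub>i, c\<^sub>j) = 0\<close>, \<open>\<alpha>(0)\<close> is the constant \<open>q\<^sub>1 r\<^sub>1 + q\<^sub>2 r\<^sub>2\<close> and no cocycle is needed.\<close>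

definition lat_vop :: "shift \<Rightarrow> int \<times> int \<Rightarrow> int \<Rightarrow> fock \<Rightarrow> fock" where
  "lat_vop s q n v = Sum_any (\<lambda>l::nat.
     let j = int l - n - 1 - (fst q * fst (fst s) + snd q * snd (fst s)) in
       if 0 \<le> j then vop_create s q (nat j) (lat q * vop_annih s q l v) else 0)"

text \<open>The \<open>m\<close>-th mode of the \<open>l\<close>-th product of two fields.\<close>

definition field_nprod ::
  "(int \<Rightarrow> 'm::complex_vector \<Rightarrow> 'm) \<Rightarrow> int \<Rightarrow> (int \<Rightarrow> 'm \<Rightarrow> 'm) \<Rightarrow> int \<Rightarrow> 'm \<Rightarrow> 'm" where
  "field_nprod A l B m v = Sum_any (\<lambda>j::nat. ((-1) ^ j * (of_int l gchoose j)) *\<^sub>C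
     (A (l - int j) (B (m + int j) v) - (-1) powi l *\<^sub>C B (l + m - int j) (A (int j) v)))"

fun word_field :: "shift \<Rightarrow> int \<times> int \<Rightarrow> (heis \<times> nat) list \<Rightarrow> int \<Rightarrow> fock \<Rightarrow> fock" where
  "word_field s q [] = lat_vop s q"
| "word_field s q ((a, n) # xs) = field_nprod (heis_mode s a) (- int n - 1) (word_field s q xs)"

text \<open>\<open>Pi_act s u n v = u\<^sub>(\<^sub>n\<^sub>) v\<close> for \<open>u\<close> in \<open>\<Pi>(0)\<^sup>\<otimes>\<^sup>2\<close> and \<open>v\<close> in the module with parameter \<open>s\<close>.
  The order in which the creation operators of a monomial are listed is immaterial.\<close>

definition Pi_act :: "shift \<Rightarrow> fock \<Rightarrow> int \<Rightarrow> fock \<Rightarrow> fock" where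
  "Pi_act s u n v = lin_extend (\<lambda>(M, q). word_field s q (SOME xs. mset xs = M) n v) u"

definition Pi_va :: "fock vertex_alg" where
  "Pi_va = \<lparr>vac = lat (0, 0), nprod = Pi_act ((0, 0), (0, 0))\<rparr>"

definition Pi_minus_act :: "complex \<Rightarrow> complex \<Rightarrow> fock \<Rightarrow> int \<Rightarrow> fock \<Rightarrow> fock" where
  "Pi_minus_act l1 l2 = Pi_act ((-1, -1), (l1, l2))"

definition Pi_top :: "fock set" where
  "Pi_top = cvec.span (range lat)"


section \<open>Tensor products with the Fock space\<close>

text \<open>As \<open>fock\<close> has the basis \<open>fock_index\<close>, the space \<open>W \<otimes> fock\<close> is the space of finitely
  supported functions \<open>fock_index \<Rightarrow>\<^sub>0 W\<close>, with \<open>w \<otimes> p = tens w p\<close>.\<close>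

definition tens :: "'w::complex_vector \<Rightarrow> fock \<Rightarrow> (fock_index \<Rightarrow>\<^sub>0 'w)" where
  "tens w p = Poly_Mapping.map (\<lambda>c. c *\<^sub>C w) p"

definition tens_space :: "'w::complex_vector set \<Rightarrow> fock set \<Rightarrow> (fock_index \<Rightarrow>\<^sub>0 'w) set" where
  "tens_space S P = cvec.span {tens w p | w p. w \<in> S \<and> p \<in> P}"

text \<open>The bilinear extension of
  \<open>(a \<otimes> b)\<^sub>(\<^sub>n\<^sub>) (u \<otimes> v) = (\<Sum>i\<in>\<int>. a\<^sub>(\<^sub>i\<^sub>) u \<otimes> b\<^sub>(\<^sub>n\<^sub>-\<^sub>i\<^sub>-\<^sub>1\<^sub>) v)\<close>.\<close>

definition tens_act ::
  "('w::complex_vector \<Rightarrow> int \<Rightarrow> 'm::complex_vector \<Rightarrow> 'm) \<Rightarrow> (fock \<Rightarrow> int \<Rightarrow> fock \<Rightarrow> fock) \<Rightarrow>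
   (fock_index \<Rightarrow>\<^sub>0 'w) \<Rightarrow> int \<Rightarrow> (fock_index \<Rightarrow>\<^sub>0 'm) \<Rightarrow> (fock_index \<Rightarrow>\<^sub>0 'm)" where
  "tens_act A B t n s = (\<Sum>x\<in>Poly_Mapping.keys t. \<Sum>y\<in>Poly_Mapping.keys s. Sum_any (\<lambda>i::int.
     tens (A (Poly_Mapping.lookup t x) i (Poly_Mapping.lookup s y))
          (B (Poly_Mapping.single x 1) (n - i - 1) (Poly_Mapping.single y 1))))"

definition tens_va :: "'w::complex_vector vertex_alg \<Rightarrow> (fock_index \<Rightarrow>\<^sub>0 'w) vertex_alg" where
  "tens_va W = \<lparr>vac = tens (vac W) (vac Pi_va), nprod = tens_act (nprod W) (nprod Pi_va)\<rparr>"


section \<open>The realisation of \<open>L\<^sub>k(sl\<^sub>3)\<close> in \<open>W\<^sub>k \<otimes> \<Pi>(0)\<^sup>\<otimes>\<^sup>2\<close>\<close>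

text \<open>\<open>L\<close> is the quotient of the universal affine vertex algebra by \<open>\<pi>\<close>, and \<open>J\<close>, \<open>Gp\<close>, \<open>Gm\<close> are the
  generating fields of \<open>W\<close>. The image of \<open>f\<^sub>3\<close> is determined by \<open>f\<^sub>3 = [f\<^sub>2, f\<^sub>1]\<close>.\<close>

definition sl3_realisation ::
  "complex \<Rightarrow> (complex^3^3 \<Rightarrow> 'v) \<Rightarrow> ('v \<Rightarrow> 'l::complex_vector) \<Rightarrow> 'l vertex_alg \<Rightarrow>
   'w::complex_vector vertex_alg \<Rightarrow> 'w \<Rightarrow> 'w \<Rightarrow> 'w \<Rightarrow> ('l \<Rightarrow> (fock_index \<Rightarrow>\<^sub>0 'w)) \<Rightarrow> bool" where
  "sl3_realisation k X \<pi> L W J Gp Gm \<iota> \<longleftrightarrow>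
     va_hom L (tens_va W) \<iota> \<and> inj \<iota> \<and>
     (let
        no = normal_ordered (tens_va W);
        D = deriv_field (tens_va W);
        inW = (\<lambda>a. tens a (vac Pi_va));
        inPi = tens (vac W);
        J' = inW J; Gp' = inW Gp; Gm' = inW Gm;
        c1 = inPi (osc C1 0); d1 = inPi (osc D1 0);
        c = inPi (osc C2 0); d = inPi (osc D2 0);
        ec = inPi (lat (0, 1)); emc = inPi (lat (0, -1));
        \<beta> = inPi (lat (1, 0));
        \<gamma> = (- (1/2)) *\<^sub>C no (c1 + d1) (inPi (lat (-1, 0)));
        img = (\<lambda>x. \<iota> (\<pi> (X x)))
      in
        img sl3_e1 = - no \<gamma> ec \<and>
        img sl3_e2 = \<beta> \<and>
        img sl3_e3 = ec \<and>
        img sl3_h1 = (-2) *\<^sub>C J' + no \<gamma> \<beta> - ((2 * k + 9) / 6) *\<^sub>C c + (1/2) *\<^sub>C d \<and>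
        img sl3_h2 = J' - 2 *\<^sub>C no \<gamma> \<beta> + ((4 * k + 9) / 6) *\<^sub>C c + (1/2) *\<^sub>C d \<and>
        img sl3_f1 = Gp' - no (2 *\<^sub>C J' + ((8 * k + 9) / 6) *\<^sub>C c - (1/2) *\<^sub>C d) (no \<beta> emc)
                     + (k + 1) *\<^sub>C no (D \<beta>) emc \<and>
        img sl3_f2 = no Gm' emc + no (J' + ((4 * k + 9) / 6) *\<^sub>C c + (1/2) *\<^sub>C d) \<gamma>
                     + k *\<^sub>C D \<gamma> - no \<gamma> (no \<gamma> \<beta>))"


section \<open>Almost irreducible modules\<close>

definition almost_irreducible ::
  "('v \<Rightarrow> int \<Rightarrow> 'm::complex_vector \<Rightarrow> 'm) \<Rightarrow> 'm set \<Rightarrow> bool" where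
  "almost_irreducible A T \<longleftrightarrow> (\<forall>U. submodule A U \<and> U \<noteq> {0} \<longrightarrow> U \<inter> T \<noteq> {0})"

end

theory Submission
  imports Defs
begin

text \<open>
  All generators of \<open>sl\<^sub>3\<close> have weight one for the sum of the grading of \<open>R\<close> and the oscillator degree of
  the Fock space, so their modes \<open>x\<^sub>(\<^sub>n\<^sub>)\<close>, \<open>n > 0\<close>, strictly lower the filtration degree. A non-zero vector
  \<open>v\<close> of minimal filtration degree in a submodule is therefore killed by all of them, and so is \<open>(f\<^sub>2)\<^sub>(\<^sub>0\<^sub>) v\<close>,
  which has the same degree. The fields \<open>e\<^sub>2 = e^c\<^sub>1\<close>, \<open>e\<^sub>3 = e^c\<^sub>2\<close>, \<open>e\<^sub>1\<close> and \<open>h\<^sub>1 + 2 h\<^sub>2\<close> do not involve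
  the Bershadsky-Polyakov algebra; they successively exclude the oscillators \<open>d\<^sub>1, d\<^sub>2\<close>, then \<open>c\<^sub>1\<close>, then
  \<open>c\<^sub>2\<close> from \<open>v\<close>, so that \<open>v = \<Sum>q. w\<^sub>q \<otimes> e^q\<close>. On such vectors \<open>h\<^sub>2\<close>, \<open>f\<^sub>1\<close>, \<open>f\<^sub>2\<close> act essentially as \<open>J\<close>, \<open>G\<^sup>+\<close>,
  \<open>G\<^sup>-\<close>, whose positive modes hence kill every \<open>w\<^sub>q\<close>. For \<open>L\<close>, the mode \<open>L(1)\<close> is the delicate one: it comes
  from \<open>[G\<^sup>+(1), G\<^sup>-(0)]\<close>, and \<open>G\<^sup>+(1) G\<^sup>-(0) w\<^sub>q = 0\<close> is what the conditions on \<open>(f\<^sub>2)\<^sub>(\<^sub>0\<^sub>) v\<close> yield. Finally a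
  homogeneous vector of positive degree killed by all positive modes would generate a proper graded
  submodule of \<open>R\<close>, so every \<open>w\<^sub>q\<close> lies in the top component.
\<close>

abbreviation "lookup \<equiv> Poly_Mapping.lookup"
abbreviation "keys \<equiv> Poly_Mapping.keys"
abbreviation "single \<equiv> Poly_Mapping.single"

section \<open>Linear maps, functionals and elementary tensors over finitely supported
  functions\<close>

section \<open>Linear algebra\<close>

lemma lookup_scaleC [simp]: "lookup (c *\<^sub>C p) x = c *\<^sub>C lookup p x"
  by (simp add: scaleC_poly_mapping_def map.rep_eq when_def)

lemma lookup_tens [simp]: "lookup (tens w p) x = lookup p x *\<^sub>C w"
  by (simp add: tens_def map.rep_eq when_def)

lemma scaleC_single [simp]: "c *\<^sub>C single x a = single x (c *\<^sub>C a)"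
  by (rule poly_mapping_eqI) (simp add: lookup_single when_def)

lemma scaleC_complex [simp]: "c *\<^sub>C (x::complex) = c * x"
  by (simp add: scaleC_complex_def)

lemma linear_mapI:
  "(\<And>x y. f (x + y) = f x + f y) \<Longrightarrow> (\<And>c x. f (c *\<^sub>C x) = c *\<^sub>C f x) \<Longrightarrow> linear_map f"
  by (simp add: linear_map_def)

lemma linear_map_add: "linear_map f \<Longrightarrow> f (x + y) = f x + f y"
  and linear_map_scale: "linear_map f \<Longrightarrow> f (c *\<^sub>C x) = c *\<^sub>C f x"
  by (simp_all add: linear_map_def)

lemma linear_map_zero: "linear_map f \<Longrightarrow> f 0 = 0"
  using linear_map_scale[of f 0 0] by simp

lemma linear_map_neg: "linear_map f \<Longrightarrow> f (- x) = - f x"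
  using linear_map_scale[of f "-1" x] by (simp add: cvec.scale_minus_left)

lemma linear_map_diff: "linear_map f \<Longrightarrow> f (x - y) = f x - f y"
  by (metis diff_conv_add_uminus linear_map_add linear_map_neg)

lemma linear_map_sum: "linear_map f \<Longrightarrow> f (sum g I) = (\<Sum>i\<in>I. f (g i))"
  by (induction I rule: infinite_finite_induct) (simp_all add: linear_map_zero linear_map_add)

lemmas linear_map_simps = linear_map_add linear_map_scale linear_map_zero linear_map_neg
  linear_map_diff linear_map_sum

text \<open>\<open>Sum_any\<close> is 0 by convention when infinitely many terms are non-zero, so
  the exchange with \<open>f\<close> is made for finite support.\<close>

lemma linear_map_Sum_any:
  assumes "linear_map f" "finite {i. g i \<noteq> 0}"
  shows "f (Sum_any g) = Sum_any (\<lambda>i. f (g i))"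
proof -
  have "{i. f (g i) \<noteq> 0} \<subseteq> {i. g i \<noteq> 0}"
    using assms(1) by (auto simp: linear_map_zero)
  then show ?thesis
    using assms by (simp add: Sum_any.expand_superset[of "{i. g i \<noteq> 0}"] linear_map_sum)
qed

lemma Sum_any_single:
  assumes "\<And>i. i \<noteq> j \<Longrightarrow> f i = 0"
  shows "Sum_any f = f j"
  using assms by (subst Sum_any.expand_superset[of "{j}"]) auto

lemma Sum_any_zero: "(\<And>i. f i = 0) \<Longrightarrow> Sum_any f = 0"
  by simp

lemma linear_map_compose: "linear_map f \<Longrightarrow> linear_map g \<Longrightarrow> linear_map (\<lambda>x. f (g x))"
  by (simp add: linear_map_def)

lemma linear_map_plus: "linear_map f \<Longrightarrow> linear_map g \<Longrightarrow> linear_map (\<lambda>x. f x + g x)"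
  by (simp add: linear_map_def cvec.scale_right_distrib)

lemma linear_map_minus: "linear_map f \<Longrightarrow> linear_map g \<Longrightarrow> linear_map (\<lambda>x. f x - g x)"
  by (simp add: linear_map_def cvec.scale_right_diff_distrib)

lemma linear_map_scaleC: "linear_map f \<Longrightarrow> linear_map (\<lambda>x. c *\<^sub>C f x)"
  by (simp add: linear_map_def cvec.scale_right_distrib mult.commute)

lemma linear_map_const_zero: "linear_map (\<lambda>x. 0)"
  by (simp add: linear_map_def)

lemma linear_map_id: "linear_map (\<lambda>x. x)"
  by (simp add: linear_map_def)

lemma linear_map_sum_fun:
  "(\<And>i. i \<in> I \<Longrightarrow> linear_map (f i)) \<Longrightarrow> linear_map (\<lambda>x. \<Sum>i\<in>I. f i x)"
  by (induction I rule: infinite_finite_induct) (simp_all add: linear_map_const_zero linear_map_plus)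

lemma linear_map_Sum_any_fun:
  assumes lin: "\<And>i. linear_map (f i)" and fin: "\<And>x. finite {i. f i x \<noteq> 0}"
  shows "linear_map (\<lambda>x. Sum_any (\<lambda>i. f i x))"
proof (rule linear_mapI)
  show "Sum_any (\<lambda>i. f i (x + y)) = Sum_any (\<lambda>i. f i x) + Sum_any (\<lambda>i. f i y)" for x y
    using fin by (simp add: linear_map_add[OF lin] Sum_any.distrib)
  show "Sum_any (\<lambda>i. f i (c *\<^sub>C x)) = c *\<^sub>C Sum_any (\<lambda>i. f i x)" for c x
    using linear_map_Sum_any[OF linear_map_scaleC[OF linear_map_id] fin]
    by (simp add: linear_map_scale[OF lin])
qed

lemma linear_map_subspace_vimage:
  assumes "linear_map f" "cvec.subspace S"
  shows "cvec.subspace {x. f x \<in> S}"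
  using assms by (simp add: cvec.subspace_def linear_map_simps)

lemma linear_map_span:
  assumes "linear_map f" "cvec.subspace S" "\<And>x. x \<in> B \<Longrightarrow> f x \<in> S" "x \<in> cvec.span B"
  shows "f x \<in> S"
proof -
  have "cvec.span B \<subseteq> {x. f x \<in> S}"
    by (rule cvec.span_minimal) (use assms linear_map_subspace_vimage in auto)
  then show ?thesis using assms(4) by auto
qed

lemma Sum_any_in_subspace:
  assumes "cvec.subspace S" "\<And>i. f i \<in> S"
  shows "Sum_any f \<in> S"
  using assms by (simp add: Sum_any.expand_set cvec.subspace_sum)

text \<open>Extend the vector to a basis and take the coordinate along it. Such functionals contract
  the factor \<open>R\<close> of the tensor product, which reduces statements about fields acting on
  the Fock factor alone to statements about single Fock vectors.\<close>

lemma separating_functional: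
  fixes x :: "'a::complex_vector"
  assumes "x \<noteq> 0"
  obtains \<phi> :: "'a \<Rightarrow> complex" where "linear_map \<phi>" "\<phi> x \<noteq> 0"
proof -
  have ind: "cvec.independent {x}"
    using assms by simp
  define B where "B = cvec.extend_basis {x}"
  have B: "cvec.independent B" "cvec.span B = UNIV" "x \<in> B"
    using cvec.independent_extend_basis[OF ind] cvec.span_extend_basis[OF ind]
      cvec.extend_basis_superset[OF ind] by (auto simp: B_def)
  show ?thesis
  proof
    show "linear_map (\<lambda>v. cvec.representation B v x)"
      using B by (intro linear_mapI) (simp_all add: cvec.representation_add cvec.representation_scale)
    show "cvec.representation B x x \<noteq> 0"
      using B by (simp add: cvec.representation_basis)
  qed
qed

lemma sum_single_lookup: "(\<Sum>x\<in>keys p. single x (lookup p x)) = p"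
proof (rule poly_mapping_eqI)
  fix y
  have "lookup (\<Sum>x\<in>keys p. single x (lookup p x)) y = (\<Sum>x\<in>keys p. if x = y then lookup p x else 0)"
    by (simp add: lookup_sum lookup_single when_def)
  also have "\<dots> = lookup p y"
    by (auto simp: in_keys_iff)
  finally show "lookup (\<Sum>x\<in>keys p. single x (lookup p x)) y = lookup p y" .
qed

lemma sum_keys_superset:
  assumes "finite S" "keys p \<subseteq> S" "\<And>x. f x 0 = 0"
  shows "(\<Sum>x\<in>keys p. f x (lookup p x)) = (\<Sum>x\<in>S. f x (lookup p x))"
  by (rule sum.mono_neutral_left) (use assms in \<open>auto simp: in_keys_iff\<close>)

text \<open>The support varies with the argument, so the sums for \<open>p\<close>, \<open>q\<close>
  and \<open>p + q\<close> are first taken over a common finite set; the additional terms vanish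
  because each \<open>f x\<close> maps 0 to 0.\<close>

lemma sum_keys_linear:
  assumes "\<And>x. linear_map (f x)"
  shows "linear_map (\<lambda>p. \<Sum>x\<in>keys p. f x (lookup p x))"
proof (rule linear_mapI)
  have f0: "f x 0 = 0" for x
    by (rule linear_map_zero[OF assms])
  show "(\<Sum>x\<in>keys (p + q). f x (lookup (p + q) x))
      = (\<Sum>x\<in>keys p. f x (lookup p x)) + (\<Sum>x\<in>keys q. f x (lookup q x))" for p q
  proof -
    let ?S = "keys p \<union> keys q"
    have "(\<Sum>x\<in>keys (p + q). f x (lookup (p + q) x)) = (\<Sum>x\<in>?S. f x (lookup (p + q) x))"
      by (rule sum_keys_superset) (simp_all add: keys_add f0)
    also have "\<dots> = (\<Sum>x\<in>?S. f x (lookup p x)) + (\<Sum>x\<in>?S. f x (lookup q x))"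
      by (simp add: lookup_add linear_map_add[OF assms] sum.distrib)
    also have "(\<Sum>x\<in>?S. f x (lookup p x)) = (\<Sum>x\<in>keys p. f x (lookup p x))"
      by (rule sum_keys_superset[symmetric]) (simp_all add: f0)
    also have "(\<Sum>x\<in>?S. f x (lookup q x)) = (\<Sum>x\<in>keys q. f x (lookup q x))"
      by (rule sum_keys_superset[symmetric]) (simp_all add: f0)
    finally show ?thesis .
  qed
  show "(\<Sum>x\<in>keys (c *\<^sub>C p). f x (lookup (c *\<^sub>C p) x)) = c *\<^sub>C (\<Sum>x\<in>keys p. f x (lookup p x))" for c p
  proof -
    have "(\<Sum>x\<in>keys (c *\<^sub>C p). f x (lookup (c *\<^sub>C p) x)) = (\<Sum>x\<in>keys p. f x (lookup (c *\<^sub>C p) x))"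
      by (rule sum_keys_superset) (auto simp: f0 in_keys_iff)
    then show ?thesis
      by (simp add: linear_map_scale[OF assms] cvec.scale_sum_right)
  qed
qed

lemma linear_map_lin_extend: "linear_map (lin_extend f)"
  unfolding lin_extend_def
  by (rule sum_keys_linear) (simp add: linear_map_def scaleC_add_left)

lemma lin_extend_single [simp]: "lin_extend f (single x c) = c *\<^sub>C f x"
  by (simp add: lin_extend_def)

lemma linear_map_eqI:
  fixes f g :: "('i \<Rightarrow>\<^sub>0 complex) \<Rightarrow> 'a::complex_vector"
  assumes "linear_map f" "linear_map g" "\<And>x. f (single x 1) = g (single x 1)"
  shows "f p = g p"
proof -
  have *: "h p = (\<Sum>x\<in>keys p. lookup p x *\<^sub>C h (single x 1))"
    if "linear_map h" for h :: "('i \<Rightarrow>\<^sub>0 complex) \<Rightarrow> 'a"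
  proof -
    have "h p = h (\<Sum>x\<in>keys p. lookup p x *\<^sub>C single x 1)"
      by (simp add: sum_single_lookup)
    then show ?thesis by (simp only: linear_map_sum[OF that] linear_map_scale[OF that])
  qed
  show ?thesis using assms by (simp add: *)
qed

lemma linear_map_tens_right: "linear_map (tens w)"
  by (intro linear_mapI poly_mapping_eqI) (simp_all add: lookup_add scaleC_add_left scaleC_scaleC)

lemma linear_map_tens_left: "linear_map (\<lambda>w. tens w p)"
  by (intro linear_mapI poly_mapping_eqI) (simp_all add: lookup_add scaleC_add_right scaleC_scaleC mult.commute)

lemma tens_single [simp]: "tens w (single x c) = single x (c *\<^sub>C w)"
  by (rule poly_mapping_eqI) (simp add: lookup_single when_def)

lemma tens_zero_left [simp]: "tens 0 p = 0"
  by (rule poly_mapping_eqI) simp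

lemma tens_zero_right [simp]: "tens w 0 = 0"
  by (rule poly_mapping_eqI) simp

section \<open>Oscillator degree and momentum on the Fock space\<close>

section \<open>The Fock space\<close>

text \<open>The variable \<open>osc a n\<close> stands for \<open>a(-n-1)\<close> and therefore
  counts n + 1. The lattice part does not contribute to this oscillator degree.\<close>

definition fdeg :: "(heis \<times> nat) multiset \<Rightarrow> nat" where
  "fdeg M = (\<Sum>x\<in>#M. Suc (snd x))"

text \<open>The degree is an integer, so that operators may formally lower it below 0, where the
  space is zero. The index \<open>q\<close> is the lattice momentum.\<close>

definition homog :: "int \<Rightarrow> int \<times> int \<Rightarrow> fock set" where
  "homog t q = {p. \<forall>x\<in>keys p. int (fdeg (fst x)) = t \<and> snd x = q}"

lemma fdeg_simps [simp]: "fdeg {#} = 0" "fdeg (add_mset x M) = Suc (snd x) + fdeg M"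
  by (simp_all add: fdeg_def)

lemma fdeg_remove: "x \<in># M \<Longrightarrow> int (fdeg (M - {#x#})) = int (fdeg M) - int (Suc (snd x))"
  by (metis add_diff_cancel_left' fdeg_simps(2) insert_DiffM of_nat_add)

lemma subspace_homog: "cvec.subspace (homog t q)"
proof (rule cvec.subspaceI)
  show "0 \<in> homog t q" by (simp add: homog_def)
  show "x + y \<in> homog t q" if "x \<in> homog t q" "y \<in> homog t q" for x y
    using that keys_add[of x y] unfolding homog_def by blast
  show "c *\<^sub>C x \<in> homog t q" if "x \<in> homog t q" for c x
    using that by (auto simp: homog_def in_keys_iff)
qed

lemma zero_in_homog [simp]: "0 \<in> homog t q"
  by (simp add: homog_def)

lemma single_in_homog: "c = 0 \<or> (int (fdeg M) = t \<and> q = q') \<Longrightarrow> single (M, q) c \<in> homog t q'"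
  by (auto simp: homog_def)

lemma homog_negative: "p \<in> homog t q \<Longrightarrow> t < 0 \<Longrightarrow> p = 0"
  by (rule ccontr) (auto simp: homog_def simp flip: keys_eq_empty)

lemma homog_eq_span: "homog t q = cvec.span {single (M, q) 1 |M. int (fdeg M) = t}"
proof
  show "homog t q \<subseteq> cvec.span {single (M, q) 1 |M. int (fdeg M) = t}"
  proof
    fix p assume p: "p \<in> homog t q"
    have "(\<Sum>x\<in>keys p. lookup p x *\<^sub>C single x 1 :: fock) \<in> cvec.span {single (M, q) 1 |M. int (fdeg M) = t}"
    proof (rule cvec.span_sum, rule cvec.span_scale, rule cvec.span_base)
      fix x assume "x \<in> keys p"
      then show "single x 1 \<in> {single (M, q) 1 |M. int (fdeg M) = t}"
        using p by (cases x) (fastforce simp: homog_def)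
    qed
    then show "p \<in> cvec.span {single (M, q) 1 |M. int (fdeg M) = t}"
      by (simp add: sum_single_lookup)
  qed
  show "cvec.span {single (M, q) 1 |M. int (fdeg M) = t} \<subseteq> homog t q"
    by (rule cvec.span_minimal[OF _ subspace_homog]) (auto intro: single_in_homog)
qed

lemma linear_map_homog:
  assumes "linear_map f" "cvec.subspace S" "\<And>M. int (fdeg M) = t \<Longrightarrow> f (single (M, q) 1) \<in> S"
    and "p \<in> homog t q"
  shows "f p \<in> S"
  by (rule linear_map_span[OF assms(1,2)]) (use assms(3,4) in \<open>auto simp: homog_eq_span\<close>)

text \<open>The support of a vector is finite, so its degrees are bounded. As soon as
  \<open>d i\<close> exceeds this bound plus \<open>c\<close>, the image has negative degree and is
  zero. This is the source of all truncation properties on the Fock space.\<close>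

lemma homog_bounded_below:
  fixes T :: "'i \<Rightarrow> fock \<Rightarrow> fock" and d :: "'i \<Rightarrow> int"
  assumes lin: "\<And>i. linear_map (T i)"
    and hom: "\<And>i t p v. v \<in> homog t p \<Longrightarrow> T i v \<in> homog (t + c - d i) (p + q)"
  shows "\<exists>N\<ge>0. \<forall>i. d i \<ge> N \<longrightarrow> T i v = 0"
proof (intro exI conjI allI impI)
  let ?N = "\<bar>c\<bar> + 1 + (\<Sum>x\<in>keys v. int (fdeg (fst x)))"
  have "(\<Sum>x\<in>keys v. int (fdeg (fst x))) \<ge> 0"
    by (rule sum_nonneg) simp
  then show "?N \<ge> 0" by simp
  fix i assume i: "d i \<ge> ?N"
  have "T i (single x 1) = 0" if "x \<in> keys v" for x
  proof (rule homog_negative)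
    show "T i (single x 1) \<in> homog (int (fdeg (fst x)) + c - d i) (snd x + q)"
      by (rule hom) (cases x, auto intro: single_in_homog)
    have "int (fdeg (fst x)) \<le> (\<Sum>x\<in>keys v. int (fdeg (fst x)))"
      by (rule member_le_sum) (use that in auto)
    with i show "int (fdeg (fst x)) + c - d i < 0" by simp
  qed
  then have "T i (\<Sum>x\<in>keys v. lookup v x *\<^sub>C single x 1) = 0"
    by (simp only: linear_map_sum[OF lin] linear_map_scale[OF lin]) simp
  then show "T i v = 0" by (simp add: sum_single_lookup)
qed

lemma scaleC_fock: "c *\<^sub>C (p::fock) = single 0 c * p"
proof -
  have "scaleC c = (*) (c::complex)" by (rule ext) simp
  then show ?thesis
    by (simp add: scaleC_poly_mapping_def mult_map_scale_conv_mult)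
qed

lemma linear_map_mult: "linear_map ((*) (u::fock))"
  by (rule linear_mapI) (simp_all add: algebra_simps scaleC_fock)

lemma osc_mult_single: "osc a n * single (M, q) c = single (add_mset (a, n) M, q) c"
  using mult_single[of "({#(a, n)#}, 0 :: int \<times> int)" 1 "(M, q)" c]
  by (simp add: osc_def)

lemma lat_mult_single: "lat q * single (M, p) c = single (M, q + p) c"
  by (simp add: lat_def mult_single)

lemma lat_mult_lat: "lat p * lat q = lat (p + q)"
  by (simp add: lat_def mult_single)

lemma lat_zero_mult [simp]: "lat (0, 0) * v = v"
  by (rule linear_map_eqI[OF linear_map_mult linear_map_id]) (metis add_0 lat_mult_single surj_pair zero_prod_def)

lemma lat_in_homog: "t = 0 \<Longrightarrow> p = q \<Longrightarrow> lat q \<in> homog t p"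
  by (auto simp: lat_def intro: single_in_homog)

lemma osc_in_homog: "t = 1 + int n \<Longrightarrow> p = 0 \<Longrightarrow> osc a n \<in> homog t p"
  unfolding osc_def by (rule single_in_homog) simp

lemma lat_mult_homog: "v \<in> homog t p \<Longrightarrow> lat q * v \<in> homog t (p + q)"
  by (rule linear_map_homog[OF linear_map_mult subspace_homog])
     (auto simp: lat_mult_single add.commute intro: single_in_homog)

lemma osc_mult_homog: "v \<in> homog t p \<Longrightarrow> osc a n * v \<in> homog (t + int n + 1) p"
  by (rule linear_map_homog[OF linear_map_mult subspace_homog])
     (auto simp: osc_mult_single intro: single_in_homog)

lemma heis_mode_neg: "n < 0 \<Longrightarrow> heis_mode s a n v = osc a (nat (- n - 1)) * v"
  by (simp add: heis_mode_def)

lemma heis_mode_zero_single: "heis_mode s a 0 (single (M, q) c) = zero_eigenvalue s a q *\<^sub>C single (M, q) c"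
  by (simp add: heis_mode_def mult.commute)

lemma heis_mode_pos_single:
  "n > 0 \<Longrightarrow> heis_mode s a n (single (M, q) c) =
     (2 * of_int n * of_nat (count M (partner a, nat (n - 1)))) *\<^sub>C single (M - {#(partner a, nat (n - 1))#}, q) c"
  by (simp add: heis_mode_def Let_def mult.commute)

lemma linear_map_heis_mode: "linear_map (heis_mode s a n)"
proof -
  consider "n < 0" | "n = 0" | "n > 0" by linarith
  then show ?thesis
    unfolding heis_mode_def by cases (simp_all add: linear_map_lin_extend linear_map_mult)
qed

lemma heis_mode_homog:
  assumes "v \<in> homog t p"
  shows "heis_mode s a n v \<in> homog (t - n) p"
proof -
  consider "n < 0" | "n = 0" | "n > 0" by linarith
  then show ?thesis
  proof cases
    case 1
    have "osc a (nat (- n - 1)) * v \<in> homog (t + int (nat (- n - 1)) + 1) p"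
      by (rule osc_mult_homog[OF assms])
    with 1 show ?thesis by (simp add: heis_mode_neg)
  next
    case 2
    show ?thesis unfolding 2
      by (rule linear_map_homog[OF linear_map_heis_mode subspace_homog _ assms])
        (simp add: heis_mode_zero_single single_in_homog)
  next
    case 3
    show ?thesis
    proof (rule linear_map_homog[OF linear_map_heis_mode subspace_homog _ assms])
      fix M assume M: "int (fdeg M) = t"
      let ?x = "(partner a, nat (n - 1))"
      show "heis_mode s a n (single (M, p) 1) \<in> homog (t - n) p"
      proof (cases "?x \<in># M")
        case True
        then show ?thesis using 3 M
          by (simp add: heis_mode_pos_single single_in_homog fdeg_remove)
      next
        case False
        then show ?thesis using 3
          by (simp add: heis_mode_pos_single not_in_iff single_in_homog)
      qed
    qed
  qed
qed

lemma linear_map_lat_mode: "linear_map (lat_mode s q n)"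
  unfolding lat_mode_def by (intro linear_map_plus linear_map_scaleC linear_map_heis_mode)

lemma lat_mode_homog: "v \<in> homog t p \<Longrightarrow> lat_mode s q n v \<in> homog (t - n) p"
  unfolding lat_mode_def
  by (intro cvec.subspace_add cvec.subspace_scale subspace_homog heis_mode_homog)

lemma linear_map_vop_create: "linear_map (vop_create s q m)"
proof (induction m rule: less_induct)
  case (less m)
  show ?case
  proof (cases m)
    case 0
    then show ?thesis by (simp add: linear_map_def)
  next
    case (Suc m')
    have "linear_map (\<lambda>v. (1 / of_nat (Suc m')) *\<^sub>C
        (\<Sum>i\<le>m'. lat_mode s q (- int (Suc i)) (vop_create s q (m' - i) v)))"
      by (intro linear_map_scaleC linear_map_sum_fun linear_map_compose[OF linear_map_lat_mode] less)
        (use Suc in auto)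
    then show ?thesis using Suc by (simp add: linear_map_def)
  qed
qed

lemma linear_map_vop_annih: "linear_map (vop_annih s q m)"
proof (induction m rule: less_induct)
  case (less m)
  show ?case
  proof (cases m)
    case 0
    then show ?thesis by (simp add: linear_map_def)
  next
    case (Suc m')
    have "linear_map (\<lambda>v. (- 1 / of_nat (Suc m')) *\<^sub>C
        (\<Sum>i\<le>m'. lat_mode s q (int (Suc i)) (vop_annih s q (m' - i) v)))"
      by (intro linear_map_scaleC linear_map_sum_fun linear_map_compose[OF linear_map_lat_mode] less)
        (use Suc in auto)
    then show ?thesis using Suc by (simp add: linear_map_def)
  qed
qed

lemma vop_create_homog: "v \<in> homog t p \<Longrightarrow> vop_create s q m v \<in> homog (t + int m) p"
proof (induction m rule: less_induct)
  case (less m)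
  show ?case
  proof (cases m)
    case 0
    then show ?thesis using less.prems by simp
  next
    case (Suc m')
    have "lat_mode s q (- int (Suc i)) (vop_create s q (m' - i) v) \<in> homog (t + int m) p" if "i \<le> m'" for i
    proof -
      have "vop_create s q (m' - i) v \<in> homog (t + int (m' - i)) p"
        by (rule less.IH) (use Suc less.prems in auto)
      from lat_mode_homog[OF this, of s q "- int (Suc i)"] show ?thesis
        using that Suc by (simp add: of_nat_diff algebra_simps)
    qed
    then show ?thesis unfolding Suc vop_create.simps
      by (intro cvec.subspace_scale cvec.subspace_sum subspace_homog) (use Suc in auto)
  qed
qed

lemma vop_annih_homog: "v \<in> homog t p \<Longrightarrow> vop_annih s q m v \<in> homog (t - int m) p"
proof (induction m rule: less_induct)
  case (less m)
  show ?case
  proof (cases m)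
    case 0
    then show ?thesis using less.prems by simp
  next
    case (Suc m')
    have "lat_mode s q (int (Suc i)) (vop_annih s q (m' - i) v) \<in> homog (t - int m) p" if "i \<le> m'" for i
    proof -
      have "vop_annih s q (m' - i) v \<in> homog (t - int (m' - i)) p"
        by (rule less.IH) (use Suc less.prems in auto)
      from lat_mode_homog[OF this, of s q "int (Suc i)"] show ?thesis
        using that Suc by (simp add: of_nat_diff algebra_simps)
    qed
    then show ?thesis unfolding Suc vop_annih.simps
      by (intro cvec.subspace_scale cvec.subspace_sum subspace_homog) (use Suc in auto)
  qed
qed

lemma vop_annih_bounded: "\<exists>N. \<forall>l\<ge>N. vop_annih s q l v = 0"
proof -
  have "\<exists>N\<ge>0. \<forall>l. int l \<ge> N \<longrightarrow> vop_annih s q l v = 0"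
    by (rule homog_bounded_below[of "vop_annih s q" 0 int 0])
      (simp_all add: linear_map_vop_annih vop_annih_homog)
  then show ?thesis by (metis nat_le_iff)
qed

section \<open>Weights of the fields acting on the Fock modules\<close>

subsection \<open>Homogeneous fields\<close>

text \<open>Here \<open>w\<close> is the weight of the field relative to the module it acts on, and
  \<open>q\<close> is the momentum that it adds.\<close>

definition homog_field :: "int \<Rightarrow> int \<times> int \<Rightarrow> (int \<Rightarrow> fock \<Rightarrow> fock) \<Rightarrow> bool" where
  "homog_field w q B \<longleftrightarrow> (\<forall>m. linear_map (B m)) \<and>
     (\<forall>t p v m. v \<in> homog t p \<longrightarrow> B m v \<in> homog (t + w - m - 1) (p + q))"

lemma homog_field_linear: "homog_field w q B \<Longrightarrow> linear_map (B m)"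
  and homog_field_homog: "homog_field w q B \<Longrightarrow> v \<in> homog t p \<Longrightarrow> B m v \<in> homog (t + w - m - 1) (p + q)"
  unfolding homog_field_def by blast+

lemma homog_field_bounded:
  assumes "homog_field w q B"
  shows "\<exists>N\<ge>0. \<forall>m\<ge>N. B m v = 0"
  by (rule homog_bounded_below[of B "w - 1" "\<lambda>m. m" q])
    (use homog_field_linear[OF assms] homog_field_homog[OF assms] in \<open>auto simp: algebra_simps\<close>)

lemma homog_field_heis_mode: "homog_field 1 0 (heis_mode s a)"
  using heis_mode_homog[of _ _ _ s a] by (simp add: homog_field_def linear_map_heis_mode)

text \<open>This is the constant by which alpha(0) acts for alpha = q1 c1 + q2 c2. Because of the
  factor z^(alpha(0)), the field of e^alpha has weight \<open>- rpair s q\<close>; on the modules of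
  the theorem this is q1 + q2.\<close>

definition rpair :: "shift \<Rightarrow> int \<times> int \<Rightarrow> int" where
  "rpair s q = fst q * fst (fst s) + snd q * snd (fst s)"

lemma lat_vop_term:
  "(let j = int l - n - 1 - (fst q * fst (fst s) + snd q * snd (fst s)) in
       if 0 \<le> j then vop_create s q (nat j) (lat q * vop_annih s q l v) else 0) =
   (if 0 \<le> int l - n - 1 - rpair s q
    then vop_create s q (nat (int l - n - 1 - rpair s q)) (lat q * vop_annih s q l v) else 0)"
  by (simp add: Let_def rpair_def)

lemma lat_vop_eq:
  "lat_vop s q n v = Sum_any (\<lambda>l. if 0 \<le> int l - n - 1 - rpair s q
    then vop_create s q (nat (int l - n - 1 - rpair s q)) (lat q * vop_annih s q l v) else 0)"
  unfolding lat_vop_def lat_vop_term ..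

lemma homog_field_lat_vop: "homog_field (- rpair s q) q (lat_vop s q)"
  unfolding homog_field_def
proof (intro conjI allI impI)
  let ?j = "\<lambda>l n. int l - n - 1 - rpair s q"
  let ?f = "\<lambda>n l v. if 0 \<le> ?j l n then vop_create s q (nat (?j l n)) (lat q * vop_annih s q l v) else 0"
  show "linear_map (lat_vop s q n)" for n
    unfolding lat_vop_eq
  proof (rule linear_map_Sum_any_fun)
    show "linear_map (?f n l)" for l
      by (cases "0 \<le> ?j l n") (auto intro!: linear_map_const_zero
          linear_map_compose[OF linear_map_vop_create] linear_map_compose[OF linear_map_mult] linear_map_vop_annih)
    show "finite {l. ?f n l v \<noteq> 0}" for v
    proof -
      obtain N where N: "\<forall>l\<ge>N. vop_annih s q l v = 0" using vop_annih_bounded by blast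
      have "{l. ?f n l v \<noteq> 0} \<subseteq> {..<N}"
      proof
        fix l assume "l \<in> {l. ?f n l v \<noteq> 0}"
        then have "vop_annih s q l v \<noteq> 0"
          by (auto simp: linear_map_zero[OF linear_map_vop_create] split: if_splits)
        then show "l \<in> {..<N}" using N by (auto simp: not_le[symmetric])
      qed
      then show ?thesis by (rule finite_subset) simp
    qed
  qed
  fix t p v n assume v: "v \<in> homog t p"
  show "lat_vop s q n v \<in> homog (t + (- rpair s q) - n - 1) (p + q)"
    unfolding lat_vop_eq
  proof (rule Sum_any_in_subspace[OF subspace_homog])
    fix l
    show "?f n l v \<in> homog (t + (- rpair s q) - n - 1) (p + q)"
    proof (cases "0 \<le> ?j l n")
      case True
      have "vop_create s q (nat (?j l n)) (lat q * vop_annih s q l v)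
          \<in> homog (t - int l + int (nat (?j l n))) (p + q)"
        by (intro vop_create_homog lat_mult_homog vop_annih_homog v)
      then show ?thesis using True by (simp add: algebra_simps)
    next
      case False
      then show ?thesis by (simp only: if_False zero_in_homog)
    qed
  qed
qed

lemma field_nprod_finite:
  assumes A: "homog_field w q A" and B: "homog_field w' q' B"
  shows "finite {j::nat. A (l - int j) (B (m + int j) v) \<noteq> 0}"
    and "finite {j::nat. B (l + m - int j) (A (int j) v) \<noteq> 0}"
proof -
  obtain N where N: "\<forall>m\<ge>N. B m v = 0" using homog_field_bounded[OF B] by blast
  have "{j::nat. A (l - int j) (B (m + int j) v) \<noteq> 0} \<subseteq> {..nat (N - m)}"
  proof
    fix j assume "j \<in> {j::nat. A (l - int j) (B (m + int j) v) \<noteq> 0}"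
    then have "B (m + int j) v \<noteq> 0" by (auto simp: linear_map_zero[OF homog_field_linear[OF A]])
    then have "\<not> m + int j \<ge> N" using N by blast
    then show "j \<in> {..nat (N - m)}" by simp
  qed
  then show "finite {j::nat. A (l - int j) (B (m + int j) v) \<noteq> 0}"
    by (rule finite_subset) simp
  obtain N where N: "\<forall>m\<ge>N. A m v = 0" using homog_field_bounded[OF A] by blast
  have "{j::nat. B (l + m - int j) (A (int j) v) \<noteq> 0} \<subseteq> {..nat N}"
  proof
    fix j assume "j \<in> {j::nat. B (l + m - int j) (A (int j) v) \<noteq> 0}"
    then have "A (int j) v \<noteq> 0" by (auto simp: linear_map_zero[OF homog_field_linear[OF B]])
    then have "\<not> int j \<ge> N" using N by blast
    then show "j \<in> {..nat N}" by simp
  qed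
  then show "finite {j::nat. B (l + m - int j) (A (int j) v) \<noteq> 0}"
    by (rule finite_subset) simp
qed

lemma homog_field_field_nprod:
  assumes A: "homog_field w q A" and B: "homog_field w' q' B"
  shows "homog_field (w + w' - l - 1) (q + q') (field_nprod A l B)"
  unfolding homog_field_def
proof (intro conjI allI impI)
  show "linear_map (field_nprod A l B m)" for m
    unfolding field_nprod_def
  proof (rule linear_map_Sum_any_fun)
    show "linear_map (\<lambda>v. ((-1) ^ j * (of_int l gchoose j)) *\<^sub>C
        (A (l - int j) (B (m + int j) v) - (-1) powi l *\<^sub>C B (l + m - int j) (A (int j) v)))" for j
      by (intro linear_map_scaleC linear_map_minus linear_map_compose[OF homog_field_linear[OF A]]
         linear_map_compose[OF homog_field_linear[OF B]] homog_field_linear[OF A] homog_field_linear[OF B])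
    show "finite {j. ((-1) ^ j * (of_int l gchoose j)) *\<^sub>C
        (A (l - int j) (B (m + int j) v) - (-1) powi l *\<^sub>C B (l + m - int j) (A (int j) v)) \<noteq> 0}" for v
      by (rule finite_subset[OF _ finite_UnI[OF field_nprod_finite[OF A B, of l m v]]]) auto
  qed
  fix t p v m assume v: "v \<in> homog t p"
  show "field_nprod A l B m v \<in> homog (t + (w + w' - l - 1) - m - 1) (p + (q + q'))"
    unfolding field_nprod_def
  proof (intro Sum_any_in_subspace cvec.subspace_scale cvec.subspace_diff subspace_homog)
    fix j :: nat
    show "A (l - int j) (B (m + int j) v) \<in> homog (t + (w + w' - l - 1) - m - 1) (p + (q + q'))"
      using homog_field_homog[OF A homog_field_homog[OF B v], of "l - int j" "m + int j"]
      by (simp add: algebra_simps)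
    show "B (l + m - int j) (A (int j) v) \<in> homog (t + (w + w' - l - 1) - m - 1) (p + (q + q'))"
      using homog_field_homog[OF B homog_field_homog[OF A v], of "l + m - int j" "int j"]
      by (simp add: algebra_simps)
  qed
qed

lemma homog_field_word_field:
  "homog_field (int (fdeg (mset xs)) - rpair s q) q (word_field s q xs)"
proof (induction xs)
  case Nil
  then show ?case using homog_field_lat_vop by simp
next
  case (Cons x xs)
  obtain a n where x: "x = (a, n)" by (cases x)
  show ?case
    using homog_field_field_nprod[OF homog_field_heis_mode Cons, of "- int n - 1" s a]
    by (simp add: x algebra_simps)
qed

lemma Pi_act_linear_left: "linear_map (\<lambda>u. Pi_act s u n v)"
  unfolding Pi_act_def by (rule linear_map_lin_extend)

lemma Pi_act_single:
  "Pi_act s (single (M, q) c) n v = c *\<^sub>C word_field s q (SOME xs. mset xs = M) n v"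
  by (simp add: Pi_act_def)

lemma Pi_act_linear: "linear_map (Pi_act s u n)"
proof -
  have "linear_map (\<lambda>v. \<Sum>x\<in>keys u. lookup u x *\<^sub>C (case x of (M, q) \<Rightarrow> word_field s q (SOME xs. mset xs = M) n v))"
    by (intro linear_map_sum_fun linear_map_scaleC) (auto intro: homog_field_linear[OF homog_field_word_field])
  then show ?thesis by (simp add: Pi_act_def lin_extend_def linear_map_def)
qed

lemma Pi_act_homog:
  assumes "u \<in> homog w q" "v \<in> homog t p"
  shows "Pi_act s u n v \<in> homog (t + w - rpair s q - n - 1) (p + q)"
proof (rule linear_map_homog[OF Pi_act_linear_left subspace_homog _ assms(1)])
  fix M assume M: "int (fdeg M) = w"
  obtain xs where xs: "(SOME xs. mset xs = M) = xs" "mset xs = M"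
    by (metis (mono_tags) ex_mset someI_ex)
  show "Pi_act s (single (M, q) 1) n v \<in> homog (t + w - rpair s q - n - 1) (p + q)"
    using homog_field_homog[OF homog_field_word_field[of xs s q] assms(2), of n] M
    by (simp add: Pi_act_single xs algebra_simps)
qed

lemma homog_field_Pi_act: "u \<in> homog w q \<Longrightarrow> homog_field (w - rpair s q) q (Pi_act s u)"
  unfolding homog_field_def using Pi_act_linear Pi_act_homog[of u w q] by (simp add: algebra_simps)

section \<open>Annihilation operators and the exclusion of oscillators\<close>

subsection \<open>Positive Heisenberg modes\<close>

text \<open>A positive mode is a multiple of the derivative in the partner variable, so the
  coefficient at \<open>M\<close> comes from the monomial with one more such factor. The
  multiplicity in that larger monomial explains the summand 1.\<close>

lemma lookup_heis_mode_pos: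
  assumes "n > 0"
  shows "lookup (heis_mode s a n p) (M, q) =
    2 * of_int n * (of_nat (count M (partner a, nat (n - 1))) + 1) *
      lookup p (add_mset (partner a, nat (n - 1)) M, q)"
proof (rule linear_map_eqI)
  let ?x = "(partner a, nat (n - 1))"
  show "linear_map (\<lambda>p. lookup (heis_mode s a n p) (M, q))"
    by (rule linear_mapI) (simp_all add: linear_map_simps[OF linear_map_heis_mode] lookup_add)
  show "linear_map (\<lambda>p::fock. 2 * of_int n * (of_nat (count M ?x) + 1) * lookup p (add_mset ?x M, q))"
    by (rule linear_mapI) (simp_all add: lookup_add algebra_simps)
  fix y :: fock_index
  obtain M' q' where y: "y = (M', q')" by (cases y)
  show "lookup (heis_mode s a n (single y 1)) (M, q) =
    2 * of_int n * (of_nat (count M ?x) + 1) * lookup (single y 1) (add_mset ?x M, q)"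
  proof (cases "?x \<in># M'")
    case True
    then obtain M'' where M'': "M' = add_mset ?x M''" by (metis insert_DiffM)
    show ?thesis using assms
      by (auto simp: y M'' heis_mode_pos_single lookup_single when_def)
  next
    case False
    then have "M' \<noteq> add_mset ?x M" by auto
    then show ?thesis using assms False
      by (simp add: y heis_mode_pos_single lookup_single when_def not_in_iff)
  qed
qed

text \<open>The numerical factor of the derivative never vanishes, hence a vector is killed by the
  mode exactly if it does not contain the partner variable.\<close>

lemma heis_mode_eq_0_iff:
  assumes "n > 0"
  shows "heis_mode s a n p = 0 \<longleftrightarrow> (\<forall>M q. lookup p (add_mset (partner a, nat (n - 1)) M, q) = 0)"
    (is "?L \<longleftrightarrow> ?R")
proof
  have ne: "2 * of_int n * (of_nat (count M y) + 1) \<noteq> (0::complex)" for M :: "(heis \<times> nat) multiset" and y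
    using assms by (metis mult_eq_0_iff of_int_eq_0_iff of_nat_Suc of_nat_eq_0_iff add.commute
        less_irrefl nat.distinct(1) zero_neq_numeral)
  show ?R if ?L
    using that ne lookup_heis_mode_pos[OF assms, of s a p] by auto
  show ?L if ?R
  proof (rule poly_mapping_eqI)
    fix x show "lookup (heis_mode s a n p) x = lookup 0 x"
      using that by (cases x) (simp add: lookup_heis_mode_pos[OF assms])
  qed
qed

lemma lookup_heis_mode_zero: "lookup (heis_mode s a 0 p) (M, q) = zero_eigenvalue s a q * lookup p (M, q)"
proof (rule linear_map_eqI)
  show "linear_map (\<lambda>p. lookup (heis_mode s a 0 p) (M, q))"
    by (rule linear_mapI) (simp_all add: linear_map_simps[OF linear_map_heis_mode] lookup_add)
  show "linear_map (\<lambda>p::fock. zero_eigenvalue s a q * lookup p (M, q))"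
    by (rule linear_mapI) (simp_all add: lookup_add algebra_simps)
  fix y :: fock_index
  obtain M' q' where y: "y = (M', q')" by (cases y)
  show "lookup (heis_mode s a 0 (single y 1)) (M, q) = zero_eigenvalue s a q * lookup (single y 1) (M, q)"
    by (auto simp: y heis_mode_zero_single lookup_single when_def)
qed

text \<open>The absence of a variable is preserved by every derivative and by the zero modes, which
  are diagonal on monomials.\<close>

lemma heis_mode_nonneg_preserves_kernel:
  assumes "n > 0" "j \<ge> 0" "heis_mode s a n p = 0"
  shows "heis_mode s a n (heis_mode s b j p) = 0"
proof (cases "j = 0")
  case True
  then show ?thesis using assms by (simp add: heis_mode_eq_0_iff lookup_heis_mode_zero)
next
  case False
  then have "j > 0" using assms by simp
  then show ?thesis using assms
    by (simp add: heis_mode_eq_0_iff lookup_heis_mode_pos add_mset_commute)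
qed

text \<open>As \<open>C1\<close> and \<open>C2\<close> are the partners of \<open>D1\<close> and
  \<open>D2\<close>, the condition says that \<open>v\<close> contains no oscillators of d1 and
  d2.\<close>

definition cfree :: "shift \<Rightarrow> fock \<Rightarrow> bool" where
  "cfree s v \<longleftrightarrow> (\<forall>n>0. heis_mode s C1 n v = 0 \<and> heis_mode s C2 n v = 0)"

lemma cfree_heis_mode: "cfree s v \<Longrightarrow> j \<ge> 0 \<Longrightarrow> cfree s (heis_mode s a j v)"
  by (simp add: cfree_def heis_mode_nonneg_preserves_kernel)

lemma cfree_lat: "cfree s (lat q)"
  by (simp add: cfree_def lat_def heis_mode_pos_single)

lemma vop_annih_cfree:
  assumes "cfree s v" "l > 0"
  shows "vop_annih s q l v = 0"
  using assms(2)
proof (induction l rule: less_induct)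
  case (less l)
  then obtain m where m: "l = Suc m" by (cases l) auto
  have "lat_mode s q (int (Suc i)) (vop_annih s q (m - i) v) = 0" if "i \<le> m" for i
  proof (cases "i = m")
    case True
    then show ?thesis using assms(1) by (simp add: lat_mode_def cfree_def)
  next
    case False
    then have "vop_annih s q (m - i) v = 0" using that m by (intro less.IH) auto
    then show ?thesis by (simp add: linear_map_zero[OF linear_map_lat_mode])
  qed
  then show ?case by (simp add: m)
qed

text \<open>The annihilation exponential involves only positive modes of c1 and c2, so on such
  vectors only its constant term 1 remains.\<close>

lemma lat_vop_cfree:
  assumes "cfree s v"
  shows "lat_vop s q n v =
    (if 0 \<le> - n - 1 - rpair s q then vop_create s q (nat (- n - 1 - rpair s q)) (lat q * v) else 0)"
  unfolding lat_vop_eq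
  by (subst Sum_any_single[of 0])
    (use vop_annih_cfree[OF assms, of _ q] in \<open>auto simp: linear_map_zero[OF linear_map_vop_create]\<close>)

lemma lat_mode_zero [simp]: "lat_mode s (0, 0) n v = 0"
  by (simp add: lat_mode_def)

lemma vop_create_zero: "vop_create s (0, 0) m v = (if m = 0 then v else 0)"
  by (cases m) simp_all

lemma vop_annih_zero: "vop_annih s (0, 0) m v = (if m = 0 then v else 0)"
  by (cases m) simp_all

lemma lat_vop_zero: "lat_vop s (0, 0) n v = (if n = -1 then v else 0)"
  unfolding lat_vop_eq
  by (subst Sum_any_single[of 0]) (auto simp: vop_create_zero vop_annih_zero rpair_def)

lemma SOME_mset_single: "(SOME xs. mset xs = {#x#}) = [x]"
  by (rule some_equality) auto

lemma SOME_mset_empty: "(SOME xs. mset xs = {#}) = []"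
  by (rule some_equality) auto

lemma Pi_act_lat: "Pi_act s (lat q) n v = lat_vop s q n v"
  by (simp add: lat_def Pi_act_single SOME_mset_empty)

lemma minus_one_gbinomial: "(- 1) ^ j * ((- 1 :: complex) gchoose j) = 1"
proof -
  have "(- 1 :: complex) gchoose j = (-1) ^ j * (of_nat j gchoose j)"
    using gbinomial_minus[of "1::complex" j] by simp
  also have "(of_nat j gchoose j) = (1::complex)"
    by (metis binomial_gbinomial binomial_n_n of_nat_1)
  finally show ?thesis by (simp flip: power_mult_distrib)
qed

text \<open>For \<open>l = -1\<close> all binomial signs cancel. What remains is the usual normally
  ordered product, split into the creation and the annihilation modes of \<open>A\<close>.\<close>

lemma field_nprod_minus_one:
  "field_nprod A (-1) B m v = Sum_any (\<lambda>j::nat. A (- 1 - int j) (B (m + int j) v) + B (m - 1 - int j) (A (int j) v))"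
proof -
  have "- 1 + m - int j = m - 1 - int j" for j by simp
  then show ?thesis unfolding field_nprod_def by (simp add: minus_one_gbinomial)
qed

lemma Pi_act_osc_lat:
  "Pi_act s (osc a 0 * lat q) n v = Sum_any (\<lambda>j::nat. heis_mode s a (- 1 - int j) (lat_vop s q (n + int j) v)
     + lat_vop s q (n - 1 - int j) (heis_mode s a (int j) v))"
proof -
  have "osc a 0 * lat q = single ({#(a, 0)#}, q) 1"
    by (simp add: lat_def osc_mult_single)
  then show ?thesis
    by (simp add: Pi_act_single SOME_mset_single field_nprod_minus_one)
qed

lemma osc_mult_lat_zero: "osc a n * lat (0, 0) = osc a n"
  by (metis lat_zero_mult mult.commute)

lemma Pi_act_osc: "Pi_act s (osc a 0) n v = heis_mode s a n v"
proof -
  have "Pi_act s (osc a 0) n v = Sum_any (\<lambda>j::nat. heis_mode s a (- 1 - int j) (lat_vop s (0, 0) (n + int j) v)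
     + lat_vop s (0, 0) (n - 1 - int j) (heis_mode s a (int j) v))"
    using Pi_act_osc_lat[of s a "(0, 0)" n v] by (simp add: osc_mult_lat_zero)
  also have "\<dots> = heis_mode s a n v"
    by (subst Sum_any_single[of "nat (if n < 0 then - 1 - n else n)"])
      (auto simp: lat_vop_zero linear_map_zero[OF linear_map_heis_mode])
  finally show ?thesis .
qed

lemma lat_mult_eq_0: "lat q * v = 0 \<Longrightarrow> v = 0"
proof -
  assume "lat q * v = 0"
  then have "lat (- q) * (lat q * v) = 0" by simp
  then have "lat (0, 0) * v = 0"
    by (simp add: lat_mult_lat flip: mult.assoc) (simp add: zero_prod_def)
  then show "v = 0" by simp
qed

text \<open>If alpha(0) = -1, mode \<open>n\<close> of e^alpha is a sum over
  \<open>l \<ge> n\<close> whose leading term is e^alpha times the annihilation coefficient of index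
  \<open>n\<close>. The system is triangular and e^alpha is invertible, so the coefficients vanish
  one after the other, starting from the truncation bound.\<close>

lemma vop_annih_eq_0:
  assumes r: "rpair s q = -1" and v: "\<And>n. n \<ge> 1 \<Longrightarrow> lat_vop s q n v = 0" and m: "m \<ge> 1"
  shows "vop_annih s q m v = 0"
proof -
  obtain N where N: "\<forall>l\<ge>N. vop_annih s q l v = 0" using vop_annih_bounded by blast
  \<comment> \<open>Downward induction on \<open>l\<close>, phrased as an induction on the distance
    \<open>i\<close> from the bound \<open>N\<close>.\<close>
  have "\<forall>l\<ge>N - i. l \<ge> 1 \<longrightarrow> vop_annih s q l v = 0" for i
  proof (induction i)
    case 0
    then show ?case using N by simp
  next
    case (Suc i)
    show ?case
    proof (intro allI impI)
      fix l assume l: "N - Suc i \<le> l" "1 \<le> l"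
      show "vop_annih s q l v = 0"
      proof (cases "N - i \<le> l")
        case True
        then show ?thesis using Suc l by blast
      next
        case False
        then have above: "vop_annih s q l' v = 0" if "l' > l" for l'
          using Suc that l by auto
        have "lat_vop s q (int l) v = lat q * vop_annih s q l v"
        proof -
          have "lat_vop s q (int l) v = (if 0 \<le> int l - int l - 1 - rpair s q
              then vop_create s q (nat (int l - int l - 1 - rpair s q)) (lat q * vop_annih s q l v) else 0)"
            unfolding lat_vop_eq
          proof (rule Sum_any_single)
            fix i assume "i \<noteq> l"
            then consider "i < l" | "i > l" by linarith
            then show "(if 0 \<le> int i - int l - 1 - rpair s q
              then vop_create s q (nat (int i - int l - 1 - rpair s q)) (lat q * vop_annih s q i v) else 0) = 0"
            proof cases
              case 1
              then have "\<not> 0 \<le> int i - int l - 1 - rpair s q" by (simp add: r)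
              then show ?thesis by (rule if_not_P)
            next
              case 2
              then show ?thesis by (simp add: above linear_map_zero[OF linear_map_vop_create])
            qed
          qed
          then show ?thesis by (simp add: r)
        qed
        then have "lat q * vop_annih s q l v = 0" using v[of "int l"] l by simp
        then show ?thesis by (rule lat_mult_eq_0)
      qed
    qed
  qed
  from this[of N] m show ?thesis by simp
qed

text \<open>In the recursion for the annihilation coefficient of index \<open>n\<close>, every
  summand except alpha(n) itself contains a lower coefficient of positive index, and these
  vanish.\<close>

lemma lat_mode_eq_0:
  assumes "rpair s q = -1" "\<And>n. n \<ge> 1 \<Longrightarrow> lat_vop s q n v = 0" "n \<ge> 1"
  shows "lat_mode s q n v = 0"
proof -
  define m where "m = nat (n - 1)"
  have n: "n = int (Suc m)" using assms(3) by (simp add: m_def)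
  note 0 = vop_annih_eq_0[OF assms(1,2)]
  have "(- 1 / of_nat (Suc m)) *\<^sub>C (\<Sum>i\<le>m. lat_mode s q (int (Suc i)) (vop_annih s q (m - i) v)) = 0"
    using 0[of "Suc m"] by simp
  moreover have "(- 1 / of_nat (Suc m) :: complex) \<noteq> 0"
    by (simp del: of_nat_Suc)
  ultimately have "(\<Sum>i\<le>m. lat_mode s q (int (Suc i)) (vop_annih s q (m - i) v)) = 0"
    by (simp only: cvec.scale_eq_0_iff) blast
  moreover have "(\<Sum>i\<le>m. lat_mode s q (int (Suc i)) (vop_annih s q (m - i) v))
      = lat_mode s q (int (Suc m)) (vop_annih s q 0 v)"
  proof -
    have "lat_mode s q (int (Suc i)) (vop_annih s q (m - i) v) = 0" if "i \<in> {..m} - {m}" for i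
    proof -
      have "vop_annih s q (m - i) v = 0" using that by (intro 0) auto
      then show ?thesis by (simp add: linear_map_zero[OF linear_map_lat_mode])
    qed
    then show ?thesis by (subst sum.remove[of _ m]) simp_all
  qed
  ultimately show ?thesis using n by simp
qed

text \<open>For pairing 0 the non-negative modes of e^alpha kill vectors without oscillators of d1
  and d2. Only the products of mode n - 1 - j of e^alpha with a(j), \<open>j \<ge> n\<close>,
  survive, and \<open>top\<close> removes those with \<open>j > n\<close>.\<close>

lemma Pi_act_osc_lat_cfree:
  assumes v: "cfree s v" and n: "n \<ge> 1" and r: "rpair s q = 0"
    and top: "\<And>j. j > n \<Longrightarrow> heis_mode s a j v = 0"
  shows "Pi_act s (osc a 0 * lat q) n v = lat q * heis_mode s a n v"
proof -
  have e: "lat_vop s q m (heis_mode s a (int j) v) = 0" if "m \<ge> 0" for m j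
    using that r by (simp add: lat_vop_cfree[OF cfree_heis_mode[OF v]])
  have e': "lat_vop s q (n + int j) v = 0" for j
    using n r by (simp add: lat_vop_cfree[OF v])
  have "Pi_act s (osc a 0 * lat q) n v = lat_vop s q (n - 1 - int (nat n)) (heis_mode s a (int (nat n)) v)"
    unfolding Pi_act_osc_lat e' linear_map_zero[OF linear_map_heis_mode] add_0
  proof (rule Sum_any_single)
    fix j assume "j \<noteq> nat n"
    then consider "int j < n" | "int j > n" by linarith
    then show "lat_vop s q (n - 1 - int j) (heis_mode s a (int j) v) = 0"
      by cases (simp_all add: e top linear_map_zero[OF homog_field_linear[OF homog_field_lat_vop]])
  qed
  also have "\<dots> = lat q * heis_mode s a n v"
    using n r by (simp add: lat_vop_cfree[OF cfree_heis_mode[OF v]])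
  finally show ?thesis .
qed

text \<open>The hypotheses are used one after the other. \<open>e2\<close> and \<open>e3\<close>
  exclude the oscillators of d1 and d2; on the remaining vectors the modes of \<open>e1\<close> are
  triangular in d1(n), which excludes c1; then \<open>h\<close> reduces to \<open>x4\<close> times
  d2(n), which excludes c2.\<close>

lemma fock_top:
  assumes r: "fst s = (-1, -1)"
    and e2: "\<And>n. n \<ge> 1 \<Longrightarrow> lat_vop s (1, 0) n p = 0"
    and e3: "\<And>n. n \<ge> 1 \<Longrightarrow> lat_vop s (0, 1) n p = 0"
    and e1: "\<And>n. n \<ge> 1 \<Longrightarrow> Pi_act s (osc C1 0 * lat (-1, 1)) n p + Pi_act s (osc D1 0 * lat (-1, 1)) n p = 0"
    and h: "\<And>n. n \<ge> 1 \<Longrightarrow> x1 *\<^sub>C heis_mode s C1 n p + x2 *\<^sub>C heis_mode s D1 n p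
              + x3 *\<^sub>C heis_mode s C2 n p + x4 *\<^sub>C heis_mode s D2 n p = 0"
    and x4: "x4 \<noteq> 0"
    and M: "M \<noteq> {#}"
  shows "lookup p (M, q) = 0"
proof -
  have c1: "heis_mode s C1 n p = 0" if "n \<ge> 1" for n
    using lat_mode_eq_0[OF _ e2 that] r by (simp add: rpair_def lat_mode_def)
  have c2: "heis_mode s C2 n p = 0" if "n \<ge> 1" for n
    using lat_mode_eq_0[OF _ e3 that] r by (simp add: rpair_def lat_mode_def)
  have cf: "cfree s p" using c1 c2 by (simp add: cfree_def)
  obtain N where N: "N \<ge> 0" "\<forall>m\<ge>N. heis_mode s D1 m p = 0"
    using homog_field_bounded[OF homog_field_heis_mode] by blast
  \<comment> \<open>Downward induction on \<open>n\<close>: once d1(j) kills \<open>p\<close> for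
    all \<open>j > n\<close>, mode \<open>n\<close> in \<open>e1\<close> is multiplication by e^(c2
    - c1) after d1(n), since the c1 part vanishes.\<close>
  have "\<forall>n\<ge>N - int i. n \<ge> 1 \<longrightarrow> heis_mode s D1 n p = 0" for i
  proof (induction i)
    case 0
    then show ?case using N by simp
  next
    case (Suc i)
    show ?case
    proof (intro allI impI)
      fix n assume n: "N - int (Suc i) \<le> n" "1 \<le> n"
      have top: "heis_mode s D1 j p = 0" if "j > n" for j using Suc n that by auto
      have "Pi_act s (osc D1 0 * lat (-1, 1)) n p = lat (-1, 1) * heis_mode s D1 n p"
        by (rule Pi_act_osc_lat_cfree[OF cf n(2) _ top]) (simp_all add: rpair_def r)
      moreover have "Pi_act s (osc C1 0 * lat (-1, 1)) n p = lat (-1, 1) * heis_mode s C1 n p"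
        by (rule Pi_act_osc_lat_cfree[OF cf n(2)]) (use n in \<open>simp_all add: rpair_def r c1\<close>)
      ultimately have "lat (-1, 1) * heis_mode s D1 n p = 0"
        using e1[OF n(2)] c1[OF n(2)] by simp
      then show "heis_mode s D1 n p = 0" by (rule lat_mult_eq_0)
    qed
  qed
  from this[of "nat N"] have d1: "heis_mode s D1 n p = 0" if "n \<ge> 1" for n using N that by simp
  have d2: "heis_mode s D2 n p = 0" if "n \<ge> 1" for n
    using h[OF that] x4 by (simp add: c1 c2 d1 that)
  obtain y M' where M': "M = add_mset y M'" using M by (cases M) auto
  obtain b m where y: "y = (b, m)" by (cases y)
  \<comment> \<open>An oscillator of type \<open>b\<close> is detected by the positive modes of its
    partner.\<close>
  have "heis_mode s (partner b) (int m + 1) p = 0"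
    using c1 c2 d1 d2 by (cases b) simp_all
  moreover have "partner (partner b) = b" by (cases b) simp_all
  ultimately show ?thesis
    by (cases q) (simp add: heis_mode_eq_0_iff M' y)
qed

section \<open>Explicit products needed for the field gamma\<close>

subsection \<open>Products in \<open>\<Pi>(0)\<^sup>\<otimes>\<^sup>2\<close>\<close>

abbreviation Pi0 :: "fock \<Rightarrow> int \<Rightarrow> fock \<Rightarrow> fock" where
  "Pi0 \<equiv> Pi_act ((0, 0), (0, 0))"

lemma rpair_zero [simp]: "rpair ((0, 0), l) q = 0"
  by (simp add: rpair_def)

lemma Pi0_lat_lat: "Pi0 (lat p) (-1) (lat q) = lat (p + q)"
  by (simp add: Pi_act_lat lat_vop_cfree[OF cfree_lat] lat_mult_lat)

lemma Pi0_osc_lat: "Pi0 (osc a 0) (-1) (lat q) = osc a 0 * lat q"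
  by (simp add: Pi_act_osc heis_mode_neg)

text \<open>The correction term combines the eigenvalue of a(0) on e^q with the first coefficient p1
  c1(-1) + p2 c2(-1) of the creation exponential of e^p.\<close>

lemma Pi0_osc_lat_lat:
  "Pi0 (osc a 0 * lat p) (-1) (lat q) = osc a 0 * lat (p + q) + zero_eigenvalue ((0, 0), (0, 0)) a q *\<^sub>C
     (of_int (fst p) *\<^sub>C osc C1 0 + of_int (snd p) *\<^sub>C osc C2 0) * lat (p + q)"
proof -
  let ?s = "((0, 0), (0, 0)) :: shift"
  have zero: "heis_mode ?s a (int j) (lat q) = 0" if "j \<noteq> 0" for j
    using that by (simp add: lat_def heis_mode_pos_single)
  have "Pi0 (osc a 0 * lat p) (-1) (lat q) = heis_mode ?s a (- 1) (lat_vop ?s p (- 1) (lat q))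
     + lat_vop ?s p (- 2) (heis_mode ?s a 0 (lat q))"
    unfolding Pi_act_osc_lat
    by (subst Sum_any_single[of 0])
      (auto simp: zero lat_vop_cfree[OF cfree_lat] linear_map_zero[OF linear_map_heis_mode]
         linear_map_zero[OF homog_field_linear[OF homog_field_lat_vop]])
  also have "heis_mode ?s a 0 (lat q) = zero_eigenvalue ?s a q *\<^sub>C lat q"
    unfolding lat_def by (rule heis_mode_zero_single)
  finally show ?thesis
    by (simp add: linear_map_scale[OF homog_field_linear[OF homog_field_lat_vop]]
      lat_vop_cfree[OF cfree_lat] lat_mult_lat lat_mode_def heis_mode_neg algebra_simps
      numeral_2_eq_2) (simp add: scaleC_fock algebra_simps)
qed

section \<open>Action on tensor products: contraction, leading coefficients, filtration\<close>

section \<open>Tensor products with the Fock space\<close>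

lemma homog_lookup_eq_0:
  assumes "p \<in> homog t q" "int (fdeg M) \<noteq> t \<or> q' \<noteq> q"
  shows "lookup p (M, q') = 0"
proof (rule ccontr)
  assume "lookup p (M, q') \<noteq> 0"
  then have "(M, q') \<in> keys p" by (simp only: in_keys_iff not_False_eq_True)
  then have "int (fdeg (fst (M, q'))) = t \<and> snd (M, q') = q"
    using assms(1) unfolding homog_def by blast
  then show False using assms(2) by simp
qed

lemma va_module_linear: "va_module V A \<Longrightarrow> linear_map (A a n)"
  and va_module_linear_left: "va_module V A \<Longrightarrow> linear_map (\<lambda>a. A a n w)"
  and va_module_truncated: "va_module V A \<Longrightarrow> \<exists>N. \<forall>n\<ge>N. A a n w = 0"
  and va_module_vac: "va_module V A \<Longrightarrow> A (vac V) n w = (if n = -1 then w else 0)"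
  unfolding va_module_def by blast+

lemma Pi_act_bounded: "\<exists>N. \<forall>m\<ge>N. Pi_act s u m p = 0"
proof -
  have "\<exists>N\<ge>0. \<forall>m\<ge>N. Pi_act s (single x 1) m p = 0" for x
  proof (rule homog_field_bounded)
    show "homog_field (int (fdeg (fst x)) - rpair s (snd x)) (snd x) (Pi_act s (single x 1))"
      by (rule homog_field_Pi_act) (cases x, auto intro: single_in_homog)
  qed
  then obtain N where N: "\<And>x. N x \<ge> (0::int)" "\<And>x m. m \<ge> N x \<Longrightarrow> Pi_act s (single x 1) m p = 0"
    by metis
  show ?thesis
  proof (intro exI allI impI)
    fix m assume m: "m \<ge> (\<Sum>x\<in>keys u. N x)"
    have "Pi_act s (single x 1) m p = 0" if "x \<in> keys u" for x
      using m member_le_sum[OF that, of N] N(1) by (intro N(2)) auto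
    then have "Pi_act s (\<Sum>x\<in>keys u. lookup u x *\<^sub>C single x 1) m p = 0"
      by (simp only: linear_map_sum[OF Pi_act_linear_left] linear_map_scale[OF Pi_act_linear_left]) simp
    then show "Pi_act s u m p = 0" by (simp add: sum_single_lookup)
  qed
qed

text \<open>Total degree at most \<open>N\<close>, the sum of the oscillator degree and the degree
  in the module factor. It is applied with \<open>F = Rle R\<close>.\<close>

definition filt :: "(int \<Rightarrow> 'm::complex_vector set) \<Rightarrow> int \<Rightarrow> (fock_index \<Rightarrow>\<^sub>0 'm) set" where
  "filt F N = {v. \<forall>x. lookup v x \<in> F (N - int (fdeg (fst x)))}"

lemma subspace_filt: "(\<And>t. cvec.subspace (F t)) \<Longrightarrow> cvec.subspace (filt F N)"
  unfolding filt_def cvec.subspace_def by (simp add: lookup_add)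

lemma tens_in_filt:
  assumes F: "\<And>t. cvec.subspace (F t)" and "w \<in> F t" "p \<in> homog d q" "t + d = N"
  shows "tens w p \<in> filt F N"
  unfolding filt_def
proof (intro CollectI allI)
  fix x show "lookup (tens w p) x \<in> F (N - int (fdeg (fst x)))"
  proof (cases "x \<in> keys p")
    case True
    then have "int (fdeg (fst x)) = d" using assms(3) by (auto simp: homog_def)
    then show ?thesis using assms by (auto intro: cvec.subspace_scale)
  next
    case False
    then show ?thesis using F by (simp add: in_keys_iff cvec.subspace_0)
  qed
qed

lemma tens_decomp: "(\<Sum>y\<in>keys v. tens (lookup v y) (single y 1)) = v"
  by (simp add: sum_single_lookup)

context
  fixes V :: "'w::complex_vector vertex_alg" and A :: "'w \<Rightarrow> int \<Rightarrow> 'm::complex_vector \<Rightarrow> 'm"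
    and s :: shift
  assumes mod: "va_module V A"
begin

text \<open>\<open>tens_act\<close> is defined through the basis of \<open>fock\<close>. This is the
  same formula for arbitrary elementary tensors, where it can be shown to be linear in all four
  entries.\<close>

definition pure_act :: "'w \<Rightarrow> fock \<Rightarrow> int \<Rightarrow> 'm \<Rightarrow> fock \<Rightarrow> (fock_index \<Rightarrow>\<^sub>0 'm)" where
  "pure_act a u n w p = Sum_any (\<lambda>i::int. tens (A a i w) (Pi_act s u (n - i - 1) p))"

lemma pure_act_finite: "finite {i. tens (A a i w) (Pi_act s u (n - i - 1) p) \<noteq> 0}"
proof -
  obtain N1 where N1: "\<forall>n\<ge>N1. A a n w = 0" using va_module_truncated[OF mod] by blast
  obtain N2 where N2: "\<forall>m\<ge>N2. Pi_act s u m p = 0" using Pi_act_bounded by blast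
  have "{i. tens (A a i w) (Pi_act s u (n - i - 1) p) \<noteq> 0} \<subseteq> {n - 1 - N2..N1}"
  proof
    fix i assume "i \<in> {i. tens (A a i w) (Pi_act s u (n - i - 1) p) \<noteq> 0}"
    then have "A a i w \<noteq> 0" "Pi_act s u (n - i - 1) p \<noteq> 0" by auto
    then have "\<not> i \<ge> N1" "\<not> n - i - 1 \<ge> N2" using N1 N2 by blast+
    then show "i \<in> {n - 1 - N2..N1}" by simp
  qed
  then show ?thesis by (rule finite_subset) simp
qed

lemma pure_act_linear1: "linear_map (\<lambda>a. pure_act a u n w p)"
  unfolding pure_act_def
  by (intro linear_map_Sum_any_fun pure_act_finite
      linear_map_compose[OF linear_map_tens_left va_module_linear_left[OF mod]])

lemma pure_act_linear2: "linear_map (\<lambda>u. pure_act a u n w p)"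
  unfolding pure_act_def
  by (intro linear_map_Sum_any_fun pure_act_finite
      linear_map_compose[OF linear_map_tens_right Pi_act_linear_left])

lemma pure_act_linear3: "linear_map (\<lambda>w. pure_act a u n w p)"
  unfolding pure_act_def
  by (intro linear_map_Sum_any_fun pure_act_finite
      linear_map_compose[OF linear_map_tens_left va_module_linear[OF mod]])

lemma pure_act_linear4: "linear_map (\<lambda>p. pure_act a u n w p)"
  unfolding pure_act_def
  by (intro linear_map_Sum_any_fun pure_act_finite
      linear_map_compose[OF linear_map_tens_right Pi_act_linear])

lemma tens_act_eq:
  "tens_act A (Pi_act s) t n v =
    (\<Sum>x\<in>keys t. \<Sum>y\<in>keys v. pure_act (lookup t x) (single x 1) n (lookup v y) (single y 1))"
  by (simp add: tens_act_def pure_act_def)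

lemma tens_act_linear_left: "linear_map (\<lambda>t. tens_act A (Pi_act s) t n v)"
  unfolding tens_act_eq
  by (rule sum_keys_linear[where f = "\<lambda>x a. \<Sum>y\<in>keys v. pure_act a (single x 1) n (lookup v y) (single y 1)"])
    (intro linear_map_sum_fun pure_act_linear1)

lemma tens_act_linear: "linear_map (tens_act A (Pi_act s) t n)"
proof -
  have "linear_map (\<lambda>v. \<Sum>x\<in>keys t. \<Sum>y\<in>keys v. pure_act (lookup t x) (single x 1) n (lookup v y) (single y 1))"
    by (rule linear_map_sum_fun,
        rule sum_keys_linear[where f = "\<lambda>y w. pure_act (lookup t x) (single x 1) n w (single y 1)" for x])
      (rule pure_act_linear3)
  then show ?thesis by (simp add: tens_act_eq[abs_def] linear_map_def)
qed

text \<open>By multilinearity it suffices to expand \<open>u\<close> and \<open>p\<close> in the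
  basis of \<open>fock\<close>.\<close>

lemma tens_act_pure: "tens_act A (Pi_act s) (tens a u) n (tens w p) = pure_act a u n w p"
proof -
  have keys: "keys (tens b q) \<subseteq> keys q" for b :: "'z::complex_vector" and q
    by (auto simp: in_keys_iff)
  have eq: "(\<Sum>x\<in>keys (tens b q). f x (lookup (tens b q) x)) = (\<Sum>x\<in>keys q. lookup q x *\<^sub>C f x b)"
    if f: "\<And>x. linear_map (f x)" for b :: "'z::complex_vector" and q and f :: "fock_index \<Rightarrow> 'z \<Rightarrow> fock_index \<Rightarrow>\<^sub>0 'm"
  proof -
    have "(\<Sum>x\<in>keys (tens b q). f x (lookup (tens b q) x)) = (\<Sum>x\<in>keys q. f x (lookup (tens b q) x))"
      by (rule sum_keys_superset) (simp_all add: keys linear_map_zero[OF f])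
    then show ?thesis by (simp add: linear_map_scale[OF f])
  qed
  have expand: "(\<Sum>x\<in>keys q. lookup q x *\<^sub>C g (single x 1)) = g q"
    if g: "linear_map g" for g :: "fock \<Rightarrow> fock_index \<Rightarrow>\<^sub>0 'm" and q
  proof -
    have "g (\<Sum>x\<in>keys q. lookup q x *\<^sub>C single x 1) = (\<Sum>x\<in>keys q. lookup q x *\<^sub>C g (single x 1))"
      by (simp only: linear_map_sum[OF g] linear_map_scale[OF g])
    then show ?thesis by (simp add: sum_single_lookup)
  qed
  have "tens_act A (Pi_act s) (tens a u) n (tens w p)
      = (\<Sum>x\<in>keys (tens a u). pure_act (lookup (tens a u) x) (single x 1) n w p)"
    unfolding tens_act_eq
    by (intro sum.cong refl) (simp only: eq[OF pure_act_linear3] expand[OF pure_act_linear4])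
  also have "\<dots> = pure_act a u n w p"
    by (simp only: eq[OF pure_act_linear1] expand[OF pure_act_linear2])
  finally show ?thesis .
qed

lemma tens_act_vac: "tens_act A (Pi_act s) (tens (vac V) u) n (tens w p) = tens w (Pi_act s u n p)"
  unfolding tens_act_pure pure_act_def
  by (subst Sum_any_single[of "-1"]) (simp_all add: va_module_vac[OF mod])

lemma tens_act_lat_zero: "tens_act A (Pi_act s) (tens a (lat (0, 0))) n (tens w p) = tens (A a n w) p"
  unfolding tens_act_pure pure_act_def
  by (subst Sum_any_single[of n]) (simp_all add: Pi_act_lat lat_vop_zero)

text \<open>The vacuum acts as the identity in its only non-zero mode, so such a field leaves the
  module factor untouched and commutes with contraction by a functional.\<close>

lemma map_functional_tens_act_vac:
  fixes \<phi> :: "'m \<Rightarrow> complex"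
  assumes \<phi>: "linear_map \<phi>"
  shows "Poly_Mapping.map \<phi> (tens_act A (Pi_act s) (tens (vac V) u) n v)
    = Pi_act s u n (Poly_Mapping.map \<phi> v)"
proof -
  have lk: "lookup (Poly_Mapping.map \<phi> v) x = \<phi> (lookup v x)" for v :: "fock_index \<Rightarrow>\<^sub>0 'm" and x
    by (simp add: map.rep_eq when_def linear_map_zero[OF \<phi>])
  have lin: "linear_map (Poly_Mapping.map \<phi> :: (fock_index \<Rightarrow>\<^sub>0 'm) \<Rightarrow> fock)"
    by (intro linear_mapI poly_mapping_eqI)
      (simp_all add: lk lookup_add linear_map_simps[OF \<phi>])
  have \<phi>t: "Poly_Mapping.map \<phi> (tens w p) = \<phi> w *\<^sub>C p" for w p
    by (rule poly_mapping_eqI) (simp add: lk linear_map_scale[OF \<phi>] mult.commute)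
  have "Poly_Mapping.map \<phi> (tens_act A (Pi_act s) (tens (vac V) u) n (\<Sum>y\<in>keys v. tens (lookup v y) (single y 1)))
    = Pi_act s u n (Poly_Mapping.map \<phi> (\<Sum>y\<in>keys v. tens (lookup v y) (single y 1)))"
    by (simp only: linear_map_sum[OF lin] linear_map_sum[OF Pi_act_linear]
        linear_map_sum[OF tens_act_linear] tens_act_vac \<phi>t linear_map_scale[OF Pi_act_linear])
  then show ?thesis by (simp only: tens_decomp)
qed

text \<open>The field of \<open>u\<close> keeps the oscillator degree at 0 only in the one mode
  \<open>m\<close>. This also fixes the mode of \<open>a\<close>, so a single coefficient of the
  result isolates a single mode of \<open>a\<close>.\<close>

lemma tens_act_lookup_top:
  assumes v: "\<And>x. x \<in> keys v \<Longrightarrow> fst x = {#}"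
    and u: "u \<in> homog wu p"
    and m: "m = wu - rpair s p - 1"
  shows "lookup (tens_act A (Pi_act s) (tens a u) n v) ({#}, q) =
    lookup (Pi_act s u m (lat (q - p))) ({#}, q) *\<^sub>C A a (n - 1 - m) (lookup v ({#}, q - p))"
proof -
  define f where "f v = lookup (tens_act A (Pi_act s) (tens a u) n v) ({#}, q)" for v
  define g where "g v = lookup (Pi_act s u m (lat (q - p))) ({#}, q) *\<^sub>C A a (n - 1 - m) (lookup v ({#}, q - p))" for v :: "fock_index \<Rightarrow>\<^sub>0 'm"
  have lin_lookup: "linear_map (\<lambda>v :: fock_index \<Rightarrow>\<^sub>0 'm. lookup v x)" for x
    by (simp add: linear_map_def lookup_add)
  have f: "linear_map f" unfolding f_def
    by (rule linear_map_compose[OF lin_lookup tens_act_linear])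
  have g: "linear_map g" unfolding g_def
    by (intro linear_map_scaleC linear_map_compose[OF va_module_linear[OF mod]] lin_lookup)
  have fg: "f (tens w (lat q')) = g (tens w (lat q'))" for w q'
  proof -
    have "f (tens w (lat q')) = Sum_any (\<lambda>i. lookup (tens (A a i w) (Pi_act s u (n - i - 1) (lat q'))) ({#}, q))"
      unfolding f_def tens_act_pure pure_act_def
      by (rule linear_map_Sum_any[OF lin_lookup pure_act_finite])
    also have "\<dots> = lookup (Pi_act s u m (lat q')) ({#}, q) *\<^sub>C A a (n - 1 - m) w"
    proof (subst Sum_any_single[of "n - 1 - m"])
      fix i assume i: "i \<noteq> n - 1 - m"
      have "Pi_act s u (n - i - 1) (lat q') \<in> homog (0 + wu - rpair s p - (n - i - 1) - 1) (q' + p)"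
        by (rule Pi_act_homog[OF u lat_in_homog]) simp_all
      then have "lookup (Pi_act s u (n - i - 1) (lat q')) ({#}, q) = 0"
        by (rule homog_lookup_eq_0) (use i m in simp)
      then show "lookup (tens (A a i w) (Pi_act s u (n - i - 1) (lat q'))) ({#}, q) = 0" by simp
    qed simp
    also have "\<dots> = g (tens w (lat q'))"
    proof (cases "q' = q - p")
      case True
      then show ?thesis by (simp add: g_def lat_def)
    next
      case False
      have "Pi_act s u m (lat q') \<in> homog (0 + wu - rpair s p - m - 1) (q' + p)"
        by (rule Pi_act_homog[OF u lat_in_homog]) simp_all
      then have "lookup (Pi_act s u m (lat q')) ({#}, q) = 0"
        by (rule homog_lookup_eq_0) (use False in auto)
      then show ?thesis using False
        by (simp add: g_def lat_def lookup_single linear_map_zero[OF va_module_linear[OF mod]])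
    qed
    finally show ?thesis .
  qed
  have "f (tens (lookup v y) (single y 1)) = g (tens (lookup v y) (single y 1))" if "y \<in> keys v" for y
    using fg[of "lookup v y" "snd y"] v[OF that] by (cases y) (simp add: lat_def)
  then have "f (\<Sum>y\<in>keys v. tens (lookup v y) (single y 1)) = g (\<Sum>y\<in>keys v. tens (lookup v y) (single y 1))"
    unfolding linear_map_sum[OF f] linear_map_sum[OF g] by (rule sum.cong[OF refl])
  then show ?thesis by (simp only: tens_decomp f_def g_def)
qed

text \<open>The changes of degree in the two factors add up to w - 1 - n, where w is the total
  weight of the field; \<open>one\<close> states that w = 1.\<close>

lemma tens_act_filt:
  assumes F: "\<And>t. cvec.subspace (F t)"
    and a: "\<And>i t w. w \<in> F t \<Longrightarrow> A a i w \<in> F (t - (i - \<Delta> + 1))"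
    and u: "u \<in> homog d q" and one: "\<Delta> + d - rpair s q = 1" and v: "v \<in> filt F N"
  shows "tens_act A (Pi_act s) (tens a u) n v \<in> filt F (N - n)"
proof -
  have "tens_act A (Pi_act s) (tens a u) n (\<Sum>y\<in>keys v. tens (lookup v y) (single y 1)) \<in> filt F (N - n)"
    unfolding linear_map_sum[OF tens_act_linear] tens_act_pure pure_act_def
  proof (intro cvec.subspace_sum Sum_any_in_subspace subspace_filt F)
    fix y i
    show "tens (A a i (lookup v y)) (Pi_act s u (n - i - 1) (single y 1)) \<in> filt F (N - n)"
    proof (rule tens_in_filt[OF F])
      show "A a i (lookup v y) \<in> F ((N - int (fdeg (fst y))) - (i - \<Delta> + 1))"
        by (rule a) (cases y, use v in \<open>simp add: filt_def\<close>)
      show "Pi_act s u (n - i - 1) (single y 1)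
          \<in> homog (int (fdeg (fst y)) + d - rpair s q - (n - i - 1) - 1) (snd y + q)"
        by (rule Pi_act_homog[OF u]) (cases y, auto intro: single_in_homog)
      show "N - int (fdeg (fst y)) - (i - \<Delta> + 1) + (int (fdeg (fst y)) + d - rpair s q - (n - i - 1) - 1) = N - n"
        using one by simp
    qed
  qed
  then show ?thesis by (simp only: tens_decomp)
qed

end

section \<open>Weights and momenta of the realisation\<close>

section \<open>The images of the generators\<close>

lemma nprod_tens_va: "nprod (tens_va W) = tens_act (nprod W) Pi0"
  by (simp add: tens_va_def Pi_va_def)

lemma vac_Pi_va: "vac Pi_va = lat (0, 0)"
  by (simp add: Pi_va_def)

lemma vac_tens_va: "vac (tens_va W) = tens (vac W) (lat (0, 0))"
  by (simp add: tens_va_def Pi_va_def)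

lemma osc_lat_homog: "osc a 0 * lat q \<in> homog 1 q"
  using osc_mult_homog[OF lat_in_homog[OF refl refl], of a 0 q] by simp

lemma Pi0_homog:
  assumes "u \<in> homog w q" "v \<in> homog t p" "t' = t + w - n - 1" "q' = p + q"
  shows "Pi0 u n v \<in> homog t' q'"
  using Pi_act_homog[OF assms(1,2), of "((0, 0), (0, 0))" n] assms(3,4) by simp

context
  fixes W :: "'w::complex_vector vertex_alg"
  assumes va: "vertex_algebra W"
begin

lemma va_module_self: "va_module W (nprod W)"
  using va by (simp add: vertex_algebra_def)

abbreviation (input) "no \<equiv> normal_ordered (tens_va W)"
abbreviation (input) "inPi \<equiv> tens (vac W)"

lemma no_linear_left: "linear_map (\<lambda>t. no t v)"
  unfolding normal_ordered_def nprod_tens_va by (rule tens_act_linear_left[OF va_module_self])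

lemma no_inPi: "no (inPi u) (tens b v) = tens b (Pi0 u (-1) v)"
  unfolding normal_ordered_def nprod_tens_va by (rule tens_act_vac[OF va_module_self])

lemma no_inW: "no (tens a (lat (0, 0))) (inPi v) = tens a v"
  using va by (simp add: normal_ordered_def nprod_tens_va tens_act_lat_zero[OF va_module_self] vertex_algebra_def)

lemma deriv_inPi: "deriv_field (tens_va W) (inPi u) = inPi (Pi0 u (-2) (lat (0, 0)))"
  unfolding deriv_field_def nprod_tens_va vac_tens_va by (rule tens_act_vac[OF va_module_self])

lemmas inPi_linear = linear_map_tens_right[of "vac W"]

definition gamma0 :: fock where
  "gamma0 = (- (1/2)) *\<^sub>C (osc C1 0 * lat (-1, 0) + osc D1 0 * lat (-1, 0))"

lemma gamma0_homog: "gamma0 \<in> homog 1 (-1, 0)"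
  unfolding gamma0_def by (intro cvec.subspace_scale cvec.subspace_add subspace_homog osc_lat_homog)

lemma Pi0_gamma0: "Pi0 gamma0 (-1) v =
   (- (1/2)) *\<^sub>C (Pi0 (osc C1 0 * lat (-1, 0)) (-1) v + Pi0 (osc D1 0 * lat (-1, 0)) (-1) v)"
  unfolding gamma0_def by (simp only: linear_map_simps[OF Pi_act_linear_left])

lemma gamma_image:
  "(- (1/2)) *\<^sub>C no (inPi (osc C1 0) + inPi (osc D1 0)) (inPi (lat (-1, 0))) = inPi gamma0"
  by (simp only: linear_map_add[OF no_linear_left] no_inPi Pi0_osc_lat gamma0_def
      linear_map_add[OF inPi_linear] linear_map_scale[OF inPi_linear])

text \<open>Normal ordering adds -2 c1 to c1 + d1, because d1(0) has eigenvalue 2 on e^(c1). This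
  reverses the sign of c1.\<close>

lemma gamma_beta: "Pi0 gamma0 (-1) (lat (1, 0)) = (1/2) *\<^sub>C (osc C1 0 - osc D1 0)"
proof -
  have C: "Pi0 (osc C1 0 * lat (-1, 0)) (-1) (lat (1, 0)) = osc C1 0"
    by (simp add: Pi0_osc_lat_lat osc_mult_lat_zero)
  have "Pi0 (osc D1 0 * lat (-1, 0)) (-1) (lat (1, 0))
      = osc D1 0 * lat (0, 0) + 2 *\<^sub>C ((-1) *\<^sub>C osc C1 0 + 0 *\<^sub>C osc C2 0) * lat (0, 0)"
    by (simp add: Pi0_osc_lat_lat)
  also have "\<dots> = osc D1 0 - 2 *\<^sub>C osc C1 0"
    by (simp only: mult.commute[of _ "lat (0, 0)"] lat_zero_mult)
      (simp add: cvec.scale_minus_left cvec.scale_minus_right)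
  finally have D: "Pi0 (osc D1 0 * lat (-1, 0)) (-1) (lat (1, 0)) = osc D1 0 - 2 *\<^sub>C osc C1 0" .
  show ?thesis
    unfolding Pi0_gamma0 C D by (rule poly_mapping_eqI) (simp add: lookup_add lookup_minus field_simps)
qed

text \<open>No correction arises here, since c1(0) and d1(0) kill e^(c2).\<close>

lemma e1_image:
  "- Pi0 gamma0 (-1) (lat (0, 1)) = (1/2) *\<^sub>C (osc C1 0 * lat (-1, 1) + osc D1 0 * lat (-1, 1))"
  by (simp add: Pi0_gamma0 Pi0_osc_lat_lat cvec.scale_minus_left)

text \<open>The images are sorted by their component in the Bershadsky-Polyakov algebra. The Fock
  parts for e1, e2, e3, h1, h2 are needed explicitly, whereas for f1 and f2 degree and momentum of
  the extra Fock parts suffice, hence the existential form.\<close>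

lemma sl3_images:
  assumes r: "sl3_realisation k X \<pi> Lk W J Gp Gm \<iota>"
  shows "\<iota> (\<pi> (X sl3_e1)) = inPi ((1/2) *\<^sub>C (osc C1 0 * lat (-1, 1) + osc D1 0 * lat (-1, 1)))"
    and "\<iota> (\<pi> (X sl3_e2)) = inPi (lat (1, 0))"
    and "\<iota> (\<pi> (X sl3_e3)) = inPi (lat (0, 1))"
    and "\<iota> (\<pi> (X sl3_h1)) = (-2) *\<^sub>C tens J (lat (0, 0)) + inPi ((1/2) *\<^sub>C osc C1 0 - (1/2) *\<^sub>C osc D1 0
           - ((2 * k + 9) / 6) *\<^sub>C osc C2 0 + (1/2) *\<^sub>C osc D2 0)"
    and "\<iota> (\<pi> (X sl3_h2)) = tens J (lat (0, 0)) + inPi (osc D1 0 - osc C1 0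
           + ((4 * k + 9) / 6) *\<^sub>C osc C2 0 + (1/2) *\<^sub>C osc D2 0)"
    and "\<exists>F\<in>homog 1 (1, -1). \<iota> (\<pi> (X sl3_f1)) = tens Gp (lat (0, 0)) + (-2) *\<^sub>C tens J (lat (1, -1)) + inPi F"
    and "\<exists>F\<in>homog 2 (-1, 0). \<exists>g\<in>homog 1 (-1, 0).
           \<iota> (\<pi> (X sl3_f2)) = tens Gm (lat (0, -1)) + tens J g + inPi F"
proof -
  note r' = r[unfolded sl3_realisation_def Let_def vac_Pi_va gamma_image]
  note lin = linear_map_simps[OF inPi_linear]
  have gb: "no (inPi gamma0) (inPi (lat (1, 0))) = inPi ((1/2) *\<^sub>C osc C1 0 - (1/2) *\<^sub>C osc D1 0)"
    by (simp only: no_inPi gamma_beta cvec.scale_right_diff_distrib)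
  show "\<iota> (\<pi> (X sl3_e1)) = inPi ((1/2) *\<^sub>C (osc C1 0 * lat (-1, 1) + osc D1 0 * lat (-1, 1)))"
    using r' by (simp only: no_inPi e1_image flip: linear_map_neg[OF inPi_linear])
  show "\<iota> (\<pi> (X sl3_e2)) = inPi (lat (1, 0))" "\<iota> (\<pi> (X sl3_e3)) = inPi (lat (0, 1))"
    using r' by simp_all
  have "\<iota> (\<pi> (X sl3_h1)) = (-2) *\<^sub>C tens J (lat (0, 0)) + no (inPi gamma0) (inPi (lat (1, 0)))
     - ((2 * k + 9) / 6) *\<^sub>C inPi (osc C2 0) + (1/2) *\<^sub>C inPi (osc D2 0)"
    using r' by blast
  then show "\<iota> (\<pi> (X sl3_h1)) = (-2) *\<^sub>C tens J (lat (0, 0)) + inPi ((1/2) *\<^sub>C osc C1 0 - (1/2) *\<^sub>C osc D1 0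
           - ((2 * k + 9) / 6) *\<^sub>C osc C2 0 + (1/2) *\<^sub>C osc D2 0)"
    by (simp only: gb lin algebra_simps)
  have "\<iota> (\<pi> (X sl3_h2)) = tens J (lat (0, 0)) - 2 *\<^sub>C no (inPi gamma0) (inPi (lat (1, 0)))
     + ((4 * k + 9) / 6) *\<^sub>C inPi (osc C2 0) + (1/2) *\<^sub>C inPi (osc D2 0)"
    using r' by blast
  moreover have "2 *\<^sub>C ((1/2) *\<^sub>C osc C1 0 - (1/2) *\<^sub>C osc D1 0) = osc C1 0 - osc D1 0"
    by (simp add: cvec.scale_right_diff_distrib scaleC_one)
  ultimately show "\<iota> (\<pi> (X sl3_h2)) = tens J (lat (0, 0)) + inPi (osc D1 0 - osc C1 0
           + ((4 * k + 9) / 6) *\<^sub>C osc C2 0 + (1/2) *\<^sub>C osc D2 0)"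
    by (simp only: gb flip: linear_map_scale[OF inPi_linear]) (simp only: lin algebra_simps)
  have be: "Pi0 (lat (1, 0)) (-1) (lat (0, -1)) = lat (1, -1)"
    by (simp add: Pi0_lat_lat)
  show "\<exists>F\<in>homog 1 (1, -1). \<iota> (\<pi> (X sl3_f1)) = tens Gp (lat (0, 0)) + (-2) *\<^sub>C tens J (lat (1, -1)) + inPi F"
  proof
    let ?D = "Pi0 (Pi0 (lat (1, 0)) (-2) (lat (0, 0))) (-1) (lat (0, -1))"
    let ?F = "(k + 1) *\<^sub>C ?D - (((8 * k + 9) / 6) *\<^sub>C (osc C2 0 * lat (1, -1)) - (1/2) *\<^sub>C (osc D2 0 * lat (1, -1)))"
    have "Pi0 (lat (1, 0)) (-2) (lat (0, 0)) \<in> homog 1 (1, 0)"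
      by (rule Pi0_homog[OF lat_in_homog[OF refl refl] lat_in_homog[OF refl refl]]) simp_all
    then have "?D \<in> homog 1 (1, -1)"
      by (rule Pi0_homog[OF _ lat_in_homog[OF refl refl]]) simp_all
    then show "?F \<in> homog 1 (1, -1)"
      by (intro cvec.subspace_scale cvec.subspace_diff subspace_homog osc_lat_homog)
    have "\<iota> (\<pi> (X sl3_f1)) = tens Gp (lat (0, 0)) - no (2 *\<^sub>C tens J (lat (0, 0)) + ((8 * k + 9) / 6) *\<^sub>C inPi (osc C2 0)
        - (1/2) *\<^sub>C inPi (osc D2 0)) (no (inPi (lat (1, 0))) (inPi (lat (0, -1))))
        + (k + 1) *\<^sub>C no (deriv_field (tens_va W) (inPi (lat (1, 0)))) (inPi (lat (0, -1)))"
      using r' by blast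
    then show "\<iota> (\<pi> (X sl3_f1)) = tens Gp (lat (0, 0)) + (-2) *\<^sub>C tens J (lat (1, -1)) + inPi ?F"
      by (simp only: be deriv_inPi no_inPi no_inW linear_map_simps[OF no_linear_left] Pi0_osc_lat lin)
        (simp add: cvec.scale_minus_left)
  qed
  show "\<exists>F\<in>homog 2 (-1, 0). \<exists>g\<in>homog 1 (-1, 0).
           \<iota> (\<pi> (X sl3_f2)) = tens Gm (lat (0, -1)) + tens J g + inPi F"
  proof (intro bexI)
    let ?F = "Pi0 (((4 * k + 9) / 6) *\<^sub>C osc C2 0 + (1/2) *\<^sub>C osc D2 0) (-1) gamma0
       + k *\<^sub>C Pi0 gamma0 (-2) (lat (0, 0)) - Pi0 gamma0 (-1) (Pi0 gamma0 (-1) (lat (1, 0)))"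
    show "gamma0 \<in> homog 1 (-1, 0)" by (rule gamma0_homog)
    have o: "osc a 0 \<in> homog 1 0" for a by (rule osc_in_homog) simp_all
    have "((4 * k + 9) / 6) *\<^sub>C osc C2 0 + (1/2) *\<^sub>C osc D2 0 \<in> homog 1 0"
      by (intro cvec.subspace_scale cvec.subspace_add subspace_homog o)
    then have "Pi0 (((4 * k + 9) / 6) *\<^sub>C osc C2 0 + (1/2) *\<^sub>C osc D2 0) (-1) gamma0 \<in> homog 2 (-1, 0)"
      by (rule Pi0_homog[OF _ gamma0_homog]) simp_all
    moreover have "Pi0 gamma0 (-2) (lat (0, 0)) \<in> homog 2 (-1, 0)"
      by (rule Pi0_homog[OF gamma0_homog lat_in_homog[OF refl refl]]) simp_all
    moreover have "Pi0 gamma0 (-1) (Pi0 gamma0 (-1) (lat (1, 0))) \<in> homog 2 (-1, 0)"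
      by (rule Pi0_homog[OF gamma0_homog Pi0_homog[OF gamma0_homog lat_in_homog[OF refl refl] refl refl]]) simp_all
    ultimately show "?F \<in> homog 2 (-1, 0)"
      by (intro cvec.subspace_add cvec.subspace_diff cvec.subspace_scale subspace_homog)
    have "\<iota> (\<pi> (X sl3_f2)) = no (tens Gm (lat (0, 0))) (inPi (lat (0, -1)))
      + no (tens J (lat (0, 0)) + ((4 * k + 9) / 6) *\<^sub>C inPi (osc C2 0) + (1/2) *\<^sub>C inPi (osc D2 0)) (inPi gamma0)
      + k *\<^sub>C deriv_field (tens_va W) (inPi gamma0)
      - no (inPi gamma0) (no (inPi gamma0) (inPi (lat (1, 0))))"
      using r' by blast
    then show "\<iota> (\<pi> (X sl3_f2)) = tens Gm (lat (0, -1)) + tens J gamma0 + inPi ?F"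
      by (simp only: deriv_inPi no_inPi no_inW linear_map_simps[OF no_linear_left]
           linear_map_simps[OF Pi_act_linear_left] lin) simp
  qed
qed

end

section \<open>Homogeneous components and the degree filtration of \<open>R\<close>\<close>

section \<open>Graded modules\<close>

definition decomp :: "(nat \<Rightarrow> 'm::complex_vector set) \<Rightarrow> 'm \<Rightarrow> nat \<Rightarrow>\<^sub>0 'm" where
  "decomp R v = (THE f. (\<forall>n. lookup f n \<in> R n) \<and> v = (\<Sum>n\<in>keys f. lookup f n))"

text \<open>The submodules of the theorem are not assumed to be graded, so vectors are measured by
  their largest degree. The space is zero for negative \<open>t\<close>.\<close>

definition Rle :: "(nat \<Rightarrow> 'm::complex_vector set) \<Rightarrow> int \<Rightarrow> 'm set" where
  "Rle R t = {w. \<forall>n. int n > t \<longrightarrow> lookup (decomp R w) n = 0}"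

text \<open>The grading is extended by zero to negative degrees, so that shifts by an integer need
  no case distinction.\<close>

definition Rg :: "(nat \<Rightarrow> 'm::complex_vector set) \<Rightarrow> int \<Rightarrow> 'm set" where
  "Rg R t = (if t \<ge> 0 then R (nat t) else {0})"

context
  fixes R :: "nat \<Rightarrow> 'm::complex_vector set"
  assumes dec: "direct_sum_decomp R"
begin

abbreviation (input) cmp :: "nat \<Rightarrow> 'm \<Rightarrow> 'm" where
  "cmp n v \<equiv> lookup (decomp R v) n"

lemma subspace_R: "cvec.subspace (R n)"
  using dec by (simp add: direct_sum_decomp_def)

lemma decomp: "cmp n v \<in> R n" "(\<Sum>n\<in>keys (decomp R v). cmp n v) = v"
proof -
  have "\<exists>!f. (\<forall>n. lookup f n \<in> R n) \<and> v = (\<Sum>n\<in>keys f. lookup f n)"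
    using dec by (simp add: direct_sum_decomp_def)
  then have "(\<forall>n. lookup (decomp R v) n \<in> R n) \<and> v = (\<Sum>n\<in>keys (decomp R v). lookup (decomp R v) n)"
    unfolding decomp_def by (rule theI')
  then show "cmp n v \<in> R n" "(\<Sum>n\<in>keys (decomp R v). cmp n v) = v" by auto
qed

lemma decomp_unique: "(\<And>n. lookup f n \<in> R n) \<Longrightarrow> v = (\<Sum>n\<in>keys f. lookup f n) \<Longrightarrow> decomp R v = f"
  unfolding decomp_def
  by (rule the1_equality) (use dec in \<open>simp_all add: direct_sum_decomp_def\<close>)

lemma linear_map_decomp: "linear_map (decomp R)"
proof (rule linear_mapI)
  have lin: "linear_map (\<lambda>f :: nat \<Rightarrow>\<^sub>0 'm. \<Sum>n\<in>keys f. lookup f n)"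
    by (rule sum_keys_linear) (rule linear_map_id)
  show "decomp R (x + y) = decomp R x + decomp R y" for x y
  proof (rule decomp_unique)
    show "lookup (decomp R x + decomp R y) n \<in> R n" for n
      by (simp add: lookup_add cvec.subspace_add subspace_R decomp(1))
    show "x + y = (\<Sum>n\<in>keys (decomp R x + decomp R y). lookup (decomp R x + decomp R y) n)"
      using linear_map_add[OF lin, of "decomp R x" "decomp R y"] by (simp only: decomp(2))
  qed
  show "decomp R (c *\<^sub>C x) = c *\<^sub>C decomp R x" for c x
  proof (rule decomp_unique)
    show "lookup (c *\<^sub>C decomp R x) n \<in> R n" for n
      by (simp add: cvec.subspace_scale subspace_R decomp(1))
    show "c *\<^sub>C x = (\<Sum>n\<in>keys (c *\<^sub>C decomp R x). lookup (c *\<^sub>C decomp R x) n)"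
      using linear_map_scale[OF lin, of c "decomp R x"] by (simp only: decomp(2))
  qed
qed

lemma linear_map_cmp: "linear_map (cmp n)"
  using linear_map_decomp by (simp add: linear_map_def lookup_add)

lemma cmp_R: "v \<in> R m \<Longrightarrow> cmp n v = (if n = m then v else 0)"
proof -
  assume v: "v \<in> R m"
  have "decomp R v = single m v"
    by (rule decomp_unique) (use v in \<open>auto simp: lookup_single when_def cvec.subspace_0 subspace_R\<close>)
  then show ?thesis by (simp add: lookup_single when_def)
qed

lemma subspace_Rle: "cvec.subspace (Rle R t)"
  by (simp add: Rle_def cvec.subspace_def linear_map_simps[OF linear_map_cmp])

lemma Rle_mono: "s \<le> t \<Longrightarrow> Rle R s \<subseteq> Rle R t"
  by (auto simp: Rle_def)

lemma Rle_neg: "w \<in> Rle R t \<Longrightarrow> t < 0 \<Longrightarrow> w = 0"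
proof -
  assume "w \<in> Rle R t" "t < 0"
  then have "cmp n w = 0" for n by (simp add: Rle_def)
  then show "w = 0" using decomp(2)[of w] by simp
qed

lemma Rle_exists: "\<exists>N. w \<in> Rle R (int N)"
proof -
  have "w \<in> Rle R (int (\<Sum>n\<in>keys (decomp R w). n))"
    unfolding Rle_def
  proof (intro CollectI allI impI, rule ccontr)
    fix n assume n: "int n > int (\<Sum>n\<in>keys (decomp R w). n)" "cmp n w \<noteq> 0"
    then have "n \<le> (\<Sum>n\<in>keys (decomp R w). n)"
      using member_le_sum[of n "keys (decomp R w)" "\<lambda>n. n"] by (simp add: in_keys_iff)
    with n(1) show False by linarith
  qed
  then show ?thesis by blast
qed

lemma subspace_Rg: "cvec.subspace (Rg R t)"
  by (simp add: Rg_def subspace_R cvec.subspace_single_0)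

lemma cmp_Rg: "v \<in> Rg R t \<Longrightarrow> cmp n v = (if int n = t then v else 0)"
  by (auto simp: Rg_def cmp_R linear_map_zero[OF linear_map_cmp] split: if_splits)

text \<open>Homogeneity gives the formula on each \<open>R m\<close>, and linearity extends it to
  sums. The condition on \<open>int n + d\<close> accounts for source degrees that would be
  negative.\<close>

lemma cmp_shift:
  assumes f: "linear_map f" and sh: "\<And>m w. w \<in> R m \<Longrightarrow> f w \<in> Rg R (int m - d)"
  shows "cmp n (f w) = (if int n + d \<ge> 0 then f (cmp (nat (int n + d)) w) else 0)"
proof -
  define g where "g w = (if int n + d \<ge> 0 then f (cmp (nat (int n + d)) w) else 0)" for w
  have g: "linear_map g"
    unfolding g_def[abs_def]
    by (cases "int n + d \<ge> 0") (simp_all add: linear_map_const_zero linear_map_compose[OF f linear_map_cmp])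
  have "cmp n (f v) = g v" if v: "v \<in> R m" for v m
  proof -
    have "cmp n (f v) = (if int n = int m - d then f v else 0)"
      by (rule cmp_Rg[OF sh[OF v]])
    then show ?thesis by (auto simp: g_def cmp_R[OF v] linear_map_zero[OF f])
  qed
  then have "cmp n (f (\<Sum>i\<in>keys (decomp R w). cmp i w)) = g (\<Sum>i\<in>keys (decomp R w). cmp i w)"
    unfolding linear_map_sum[OF f] linear_map_sum[OF linear_map_cmp] linear_map_sum[OF g]
    by (intro sum.cong refl) (use decomp(1) in blast)
  then show ?thesis by (simp only: decomp(2) g_def)
qed

lemma Rle_shift:
  assumes f: "linear_map f" and sh: "\<And>m w. w \<in> R m \<Longrightarrow> f w \<in> Rg R (int m - d)" and w: "w \<in> Rle R t"
  shows "f w \<in> Rle R (t - d)"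
  using w by (auto simp: Rle_def cmp_shift[OF f sh] linear_map_zero[OF f])

text \<open>The kernel of a homogeneous map is graded: the images of the components lie in different
  degrees and vanish separately. If the target degree is negative, \<open>f\<close> already vanishes
  on \<open>R m\<close>.\<close>

lemma kernel_cmp:
  assumes f: "linear_map f" and sh: "\<And>m w. w \<in> R m \<Longrightarrow> f w \<in> Rg R (int m - d)" and w: "f w = 0"
  shows "f (cmp m w) = 0"
proof (cases "int m - d \<ge> 0")
  case True
  then show ?thesis
    using cmp_shift[OF f sh, where n = "nat (int m - d)" and w = w] w by (simp add: linear_map_zero[OF linear_map_cmp])
next
  case False
  then show ?thesis using sh[OF decomp(1)[of w m]] by (simp add: Rg_def)
qed

end

section \<open>Reordering of words in modes\<close>

section \<open>Words in the modes of generators\<close>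

text \<open>The Borcherds identity with m = 0 gives the iterate formula and with l = 0 the
  commutator formula; each time one side collapses to its term \<open>j = 0\<close>.\<close>

lemma borcherds:
  assumes "va_module V A"
  shows "A (nprod V a l b) n w = Sum_any (\<lambda>j::nat. ((-1) ^ j * (of_int l gchoose j)) *\<^sub>C
           (A a (l - int j) (A b (n + int j) w) - (-1) powi l *\<^sub>C A b (n + l - int j) (A a (int j) w)))"
    and "A a m (A b n w) - A b n (A a m w) =
           Sum_any (\<lambda>j::nat. (of_int m gchoose j) *\<^sub>C A (nprod V a (int j) b) (m + n - int j) w)"
proof -
  have B: "Sum_any (\<lambda>j::nat. (of_int m gchoose j) *\<^sub>C A (nprod V a (l + int j) b) (m + n - int j) w) =
        Sum_any (\<lambda>j::nat. ((-1) ^ j * (of_int l gchoose j)) *\<^sub>C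
           (A a (m + l - int j) (A b (n + int j) w)
            - (-1) powi l *\<^sub>C A b (n + l - int j) (A a (m + int j) w)))" for l m n
    using assms unfolding va_module_def by blast
  have z: "((0::complex) gchoose j) = 0" if "j \<noteq> 0" for j
    using that by (cases j) simp_all
  have "A (nprod V a l b) n w = Sum_any (\<lambda>j::nat. (of_int 0 gchoose j) *\<^sub>C A (nprod V a (l + int j) b) (0 + n - int j) w)"
    by (subst Sum_any_single[of 0]) (simp_all add: z scaleC_one)
  then show "A (nprod V a l b) n w = Sum_any (\<lambda>j::nat. ((-1) ^ j * (of_int l gchoose j)) *\<^sub>C
           (A a (l - int j) (A b (n + int j) w) - (-1) powi l *\<^sub>C A b (n + l - int j) (A a (int j) w)))"
    unfolding B by simp
  have "A a m (A b n w) - A b n (A a m w) = Sum_any (\<lambda>j::nat. ((-1) ^ j * (of_int 0 gchoose j)) *\<^sub>C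
           (A a (m + 0 - int j) (A b (n + int j) w) - (-1) powi 0 *\<^sub>C A b (n + 0 - int j) (A a (m + int j) w)))"
    by (subst Sum_any_single[of 0]) (simp_all add: z scaleC_one)
  then show "A a m (A b n w) - A b n (A a m w) =
           Sum_any (\<lambda>j::nat. (of_int m gchoose j) *\<^sub>C A (nprod V a (int j) b) (m + n - int j) w)"
    unfolding B[symmetric] by simp
qed

text \<open>Besides the conformal weight \<open>wt\<close>, generators carry an auxiliary length
  \<open>len\<close>. It will be chosen so that commutators are shorter than products, although the
  operator product expansions are not linear in the generators.\<close>

locale mode_words =
  fixes V :: "'w::complex_vector vertex_alg" and A :: "'w \<Rightarrow> int \<Rightarrow> 'm::complex_vector \<Rightarrow> 'm"
    and r :: nat and g :: "nat \<Rightarrow> 'w" and len :: "nat \<Rightarrow> nat" and wt :: "nat \<Rightarrow> int" and p :: 'm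
  assumes mod: "va_module V A" and len_pos: "\<And>i. i < r \<Longrightarrow> len i \<ge> 1"
begin

definition apply_word :: "(nat \<times> int) list \<Rightarrow> 'm \<Rightarrow> 'm" where
  "apply_word ws = foldr (\<lambda>(i, n). A (g i) n) ws"

definition wlen :: "(nat \<times> int) list \<Rightarrow> nat" where
  "wlen ws = (\<Sum>(i, n)\<leftarrow>ws. len i)"

text \<open>The total amount by which the modes of the word lower the degree.\<close>

definition wdrop :: "(nat \<times> int) list \<Rightarrow> int" where
  "wdrop ws = (\<Sum>(i, n)\<leftarrow>ws. n - wt i + 1)"

abbreviation valid_word :: "(nat \<times> int) list \<Rightarrow> bool" where
  "valid_word ws \<equiv> \<forall>(i, n)\<in>set ws. i < r"

definition words :: "nat \<Rightarrow> int \<Rightarrow> 'm set" where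
  "words l t = cvec.span {apply_word ws p |ws. valid_word ws \<and> wlen ws \<le> l \<and> wdrop ws = t}"

lemma word_simps [simp]:
  "apply_word [] u = u" "apply_word ((i, n) # ws) u = A (g i) n (apply_word ws u)"
  "apply_word (xs @ ys) u = apply_word xs (apply_word ys u)"
  "wlen [] = 0" "wlen ((i, n) # ws) = len i + wlen ws" "wlen (xs @ ys) = wlen xs + wlen ys"
  "wdrop [] = 0" "wdrop ((i, n) # ws) = n - wt i + 1 + wdrop ws" "wdrop (xs @ ys) = wdrop xs + wdrop ys"
  by (simp_all add: apply_word_def wlen_def wdrop_def)

lemma linear_A: "linear_map (A a n)"
  and linear_A_left: "linear_map (\<lambda>a. A a n w)"
  using mod unfolding va_module_def by blast+

lemma linear_apply_word: "linear_map (apply_word ws)"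
proof (induction ws)
  case Nil
  then show ?case by (simp add: linear_map_def)
next
  case (Cons x ws)
  obtain i n where "x = (i, n)" by (cases x)
  then show ?case using linear_map_compose[OF linear_A Cons, of "g i" n] by (simp add: linear_map_def)
qed

lemma subspace_words: "cvec.subspace (words l t)"
  by (simp add: words_def)

lemma word_in_words: "valid_word ws \<Longrightarrow> wlen ws \<le> l \<Longrightarrow> wdrop ws = t \<Longrightarrow> apply_word ws p \<in> words l t"
  unfolding words_def by (rule cvec.span_base) blast

lemma words_mono: "l \<le> l' \<Longrightarrow> words l t \<subseteq> words l' t"
  unfolding words_def by (rule cvec.span_mono) (use le_trans in blast)

lemma linear_words:
  assumes "linear_map f" "cvec.subspace S"
    and "\<And>ws. valid_word ws \<Longrightarrow> wlen ws \<le> l \<Longrightarrow> wdrop ws = t \<Longrightarrow> f (apply_word ws p) \<in> S"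
    and "u \<in> words l t"
  shows "f u \<in> S"
  by (rule linear_map_span[OF assms(1,2) _ assms(4)[unfolded words_def]]) (use assms(3) in blast)

lemma apply_word_words:
  assumes "valid_word xs" "u \<in> words l t"
  shows "apply_word xs u \<in> words (wlen xs + l) (wdrop xs + t)"
proof (rule linear_words[OF linear_apply_word subspace_words _ assms(2)])
  fix ws assume "valid_word ws" "wlen ws \<le> l" "wdrop ws = t"
  then show "apply_word xs (apply_word ws p) \<in> words (wlen xs + l) (wdrop xs + t)"
    using word_in_words[of "xs @ ws" "wlen xs + l" "wdrop xs + t"] assms(1) by auto
qed

text \<open>On words, the field of \<open>a\<close> behaves like a generator of length
  \<open>la\<close> and weight \<open>da\<close>. The notion is closed under products, so it covers
  composite fields such as :JJ: and derivatives.\<close>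

definition good :: "'w \<Rightarrow> nat \<Rightarrow> int \<Rightarrow> bool" where
  "good a la da \<longleftrightarrow> (\<forall>l t n u. u \<in> words l t \<longrightarrow> A a n u \<in> words (la + l) (t + n - da + 1))"

lemma goodD: "good a la da \<Longrightarrow> u \<in> words l t \<Longrightarrow> A a n u \<in> words (la + l) (t + n - da + 1)"
  unfolding good_def by blast

lemma good_gen: "i < r \<Longrightarrow> good (g i) (len i) (wt i)"
  unfolding good_def
proof (intro allI impI)
  fix l t n u assume "i < r" "u \<in> words l t"
  then show "A (g i) n u \<in> words (len i + l) (t + n - wt i + 1)"
    using apply_word_words[of "[(i, n)]" u l t] by (simp add: algebra_simps)
qed

lemma good_vac: "good (vac V) la 0"
  unfolding good_def
proof (intro allI impI)
  fix l t n u assume u: "u \<in> words l t"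
  have "A (vac V) n u = (if n = -1 then u else 0)" using mod unfolding va_module_def by blast
  then show "A (vac V) n u \<in> words (la + l) (t + n - 0 + 1)"
    using u words_mono[of l "la + l" t] subspace_words by (auto simp: cvec.subspace_0)
qed

lemma good_mono: "good a la da \<Longrightarrow> la \<le> la' \<Longrightarrow> da = da' \<Longrightarrow> good a la' da'"
  unfolding good_def using words_mono by (meson add_le_mono1 subsetD)

lemma good_zero: "good 0 la da"
  unfolding good_def by (simp add: linear_map_zero[OF linear_A_left] cvec.subspace_0 subspace_words)

lemma good_add: "good a la da \<Longrightarrow> good b la da \<Longrightarrow> good (a + b) la da"
  unfolding good_def by (simp add: linear_map_add[OF linear_A_left] cvec.subspace_add subspace_words)

lemma good_diff: "good a la da \<Longrightarrow> good b la da \<Longrightarrow> good (a - b) la da"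
  unfolding good_def by (simp add: linear_map_diff[OF linear_A_left] cvec.subspace_diff subspace_words)

lemma good_scale: "good a la da \<Longrightarrow> good (c *\<^sub>C a) la da"
  unfolding good_def by (simp add: linear_map_scale[OF linear_A_left] cvec.subspace_scale subspace_words)

lemma good_minus: "good a la da \<Longrightarrow> good (- a) la da"
  unfolding good_def by (simp add: linear_map_neg[OF linear_A_left] cvec.subspace_neg subspace_words)

text \<open>In every term of the iterate formula the mode indices of \<open>a\<close> and
  \<open>b\<close> add up to l + n, so all terms have the same drop.\<close>

lemma good_nprod:
  assumes a: "good a la da" and b: "good b lb db" and d: "d = da + db - l - 1"
  shows "good (nprod V a l b) (la + lb) d"
  unfolding good_def
proof (intro allI impI)
  fix L t n u assume u: "u \<in> words L t"
  show "A (nprod V a l b) n u \<in> words (la + lb + L) (t + n - d + 1)"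
    unfolding borcherds(1)[OF mod]
  proof (intro Sum_any_in_subspace cvec.subspace_scale cvec.subspace_diff subspace_words)
    fix j :: nat
    show "A a (l - int j) (A b (n + int j) u) \<in> words (la + lb + L) (t + n - d + 1)"
      using goodD[OF a goodD[OF b u], of "l - int j" "n + int j"] by (simp add: d algebra_simps)
    show "A b (n + l - int j) (A a (int j) u) \<in> words (la + lb + L) (t + n - d + 1)"
      using goodD[OF b goodD[OF a u], of "n + l - int j" "int j"] by (simp add: d algebra_simps)
  qed
qed

lemma good_ope:
  assumes "ope V a b cs" "\<And>n. n < length cs \<Longrightarrow> good (cs ! n) l (d - int n)"
  shows "good (nprod V a (int j) b) l (d - int j)"
  using assms good_zero by (simp add: ope_def)

text \<open>The subtracted 1 is the loss of length that makes the induction in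
  \<open>words_positive\<close> work.\<close>

definition comm_bound :: "nat \<Rightarrow> nat \<Rightarrow> bool" where
  "comm_bound i i' \<longleftrightarrow> (\<forall>j. good (nprod V (g i) (int j) (g i')) (len i + len i' - 1) (wt i + wt i' - 1 - int j))"

lemma comm_bound_words:
  assumes "comm_bound i i'" "u \<in> words l t"
  shows "A (g i) m (A (g i') n u) - A (g i') n (A (g i) m u)
    \<in> words (len i + len i' - 1 + l) (m - wt i + 1 + (n - wt i' + 1 + t))"
  unfolding borcherds(2)[OF mod]
proof (intro Sum_any_in_subspace cvec.subspace_scale subspace_words)
  fix j :: nat
  have "good (nprod V (g i) (int j) (g i')) (len i + len i' - 1) (wt i + wt i' - 1 - int j)"
    using assms(1) by (simp add: comm_bound_def)
  from goodD[OF this assms(2), of "m + n - int j"]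
  show "A (nprod V (g i) (int j) (g i')) (m + n - int j) u
      \<in> words (len i + len i' - 1 + l) (m - wt i + 1 + (n - wt i' + 1 + t))"
    by (simp add: algebra_simps)
qed

text \<open>Moving a lowering mode to the right terminates because commutators have smaller length.\<close>

lemma words_positive:
  assumes comm: "\<And>i i'. i < r \<Longrightarrow> i' < r \<Longrightarrow> comm_bound i i' \<or> comm_bound i' i"
    and p: "\<And>i n. i < r \<Longrightarrow> n - wt i + 1 > 0 \<Longrightarrow> A (g i) n p = 0"
    and t: "t > 0" and u: "u \<in> words l t"
  shows "u = 0"
  using u
proof (induction l arbitrary: u rule: less_induct)
  case (less l)
  have move: "apply_word (xs @ (i, m) # ys) p = 0"
    if "valid_word (xs @ (i, m) # ys)" "wlen (xs @ (i, m) # ys) \<le> l"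
      "wdrop (xs @ (i, m) # ys) = t" "m - wt i + 1 > 0" for xs ys i m
    using that
  proof (induction ys arbitrary: xs)
    case Nil
    then show ?case using p[of i m] by (simp add: linear_map_zero[OF linear_apply_word])
  next
    case (Cons y ys)
    obtain i' n where y: "y = (i', n)" by (cases y)
    let ?u = "apply_word ys p"
    define c where "c = A (g i) m (A (g i') n ?u) - A (g i') n (A (g i) m ?u)"
    have i: "i < r" "i' < r" "valid_word ys" "valid_word xs" using Cons.prems y by auto
    have u: "?u \<in> words (wlen ys) (wdrop ys)" by (rule word_in_words) (use i in auto)
    let ?E = "words (len i + len i' - 1 + wlen ys) (m - wt i + 1 + (n - wt i' + 1 + wdrop ys))"
    have "c \<in> ?E"
    proof (cases "comm_bound i i'")
      case True
      then show ?thesis unfolding c_def by (rule comm_bound_words[OF _ u])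
    next
      \<comment> \<open>Operator product expansions are given in one order of the generators only;
        the other commutator is its negative.\<close>
      case False
      then have "comm_bound i' i" using comm i by blast
      then have "A (g i') n (A (g i) m ?u) - A (g i) m (A (g i') n ?u)
          \<in> words (len i' + len i - 1 + wlen ys) (n - wt i' + 1 + (m - wt i + 1 + wdrop ys))"
        by (rule comm_bound_words[OF _ u])
      then have "- (A (g i') n (A (g i) m ?u) - A (g i) m (A (g i') n ?u)) \<in> ?E"
        by (intro cvec.subspace_neg subspace_words) (simp add: algebra_simps)
      then show ?thesis by (simp add: c_def)
    qed
    then have "apply_word xs c \<in> words (wlen xs + (len i + len i' - 1 + wlen ys))
        (wdrop xs + (m - wt i + 1 + (n - wt i' + 1 + wdrop ys)))"
      by (rule apply_word_words[OF i(4)])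
    moreover have "wlen xs + (len i + len i' - 1 + wlen ys) < l"
      using Cons.prems(2) len_pos[OF i(1)] by (simp add: y)
    moreover have "wdrop xs + (m - wt i + 1 + (n - wt i' + 1 + wdrop ys)) = t"
      using Cons.prems(3) by (simp add: y)
    ultimately have "apply_word xs c = 0" using less.IH by metis
    moreover have "apply_word ((xs @ [(i', n)]) @ (i, m) # ys) p = 0"
      by (rule Cons.IH) (use Cons.prems in \<open>auto simp: y\<close>)
    ultimately show ?case
      by (simp add: y c_def linear_map_diff[OF linear_apply_word])
  qed
  have "apply_word ws p = 0" if ws: "valid_word ws" "wlen ws \<le> l" "wdrop ws = t" for ws
  proof -
    \<comment> \<open>A positive total drop forces a letter of positive drop, and this is the letter
      to be moved to the right.\<close>
    have "\<exists>(i, m)\<in>set ws. m - wt i + 1 > 0"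
    proof (rule ccontr)
      assume "\<not> ?thesis"
      then have "\<forall>(i, m)\<in>set ws. m - wt i + 1 \<le> 0" by fastforce
      then have "wdrop ws \<le> 0" by (induction ws) auto
      then show False using ws t by simp
    qed
    then obtain i m xs ys where "ws = xs @ (i, m) # ys" "m - wt i + 1 > 0"
      by (auto dest!: split_list)
    then show ?thesis using move[of xs i m ys] ws by simp
  qed
  then have "u \<in> {0}"
    using linear_words[OF linear_map_id cvec.subspace_single_0 _ less.prems] by simp
  then show ?case by simp
qed

definition all_words :: "'m set" where
  "all_words = cvec.span (\<Union>l t. words l t)"

lemma words_subset_all_words: "words l t \<subseteq> all_words"
  unfolding all_words_def by (rule subset_trans[OF _ cvec.span_superset]) blast

lemma good_all_words:
  assumes "good a la da" "u \<in> all_words"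
  shows "A a n u \<in> all_words"
proof (rule linear_map_span[OF linear_A])
  show "cvec.subspace all_words" by (simp add: all_words_def)
  show "u \<in> cvec.span (\<Union>l t. words l t)" using assms(2) by (simp add: all_words_def)
  fix x assume "x \<in> (\<Union>l t. words l t)"
  then show "A a n x \<in> all_words"
    using goodD[OF assms(1)] words_subset_all_words by blast
qed

lemma submodule_all_words:
  assumes "cvec.span B = UNIV" "\<And>b. b \<in> B \<Longrightarrow> \<exists>la da. good b la da"
  shows "submodule A all_words"
  unfolding submodule_def
proof (intro conjI allI impI)
  show sub: "cvec.subspace all_words" by (simp add: all_words_def)
  fix a n w assume w: "w \<in> all_words"
  show "A a n w \<in> all_words"
  proof (rule linear_map_span[OF linear_A_left sub])
    show "a \<in> cvec.span B" by (simp add: assms(1))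
    show "A b n w \<in> all_words" if "b \<in> B" for b
      using assms(2)[OF that] good_all_words[OF _ w] by blast
  qed
qed

lemma p_in_all_words: "p \<in> all_words"
  using word_in_words[of "[]" 0 0] words_subset_all_words[of 0 0] by auto

end

section \<open>Singular vectors of irreducible Bershadsky-Polyakov modules\<close>

section \<open>Lowest weight vectors of Bershadsky-Polyakov modules\<close>

lemma va_hom_ope:
  assumes f: "va_hom V W f" and ope: "ope V a b cs"
  shows "ope W (f a) (f b) (map f cs)"
  unfolding ope_def
proof
  fix n
  have "nprod W (f a) (int n) (f b) = f (nprod V a (int n) b)"
    using f by (simp add: va_hom_def)
  also have "\<dots> = f (if n < length cs then cs ! n else 0)"
    using ope by (simp add: ope_def)
  also have "\<dots> = (if n < length (map f cs) then map f cs ! n else 0)"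
    using f by (simp add: va_hom_def linear_map_zero)
  finally show "nprod W (f a) (int n) (f b) = (if n < length (map f cs) then map f cs ! n else 0)" .
qed

lemma va_hom_normal_ordered: "va_hom V W f \<Longrightarrow> f (normal_ordered V a b) = normal_ordered W (f a) (f b)"
  by (simp add: va_hom_def normal_ordered_def)

lemma va_hom_deriv_field: "va_hom V W f \<Longrightarrow> f (deriv_field V a) = deriv_field W (f a)"
  by (simp add: va_hom_def deriv_field_def)

lemma va_hom_vac: "va_hom V W f \<Longrightarrow> f (vac V) = vac W"
  and va_hom_linear: "va_hom V W f \<Longrightarrow> linear_map f"
  by (simp_all add: va_hom_def)

lemma va_hom_monomial:
  assumes "va_hom V W f" "ps \<in> pbw_words (length gs)"
  shows "f (va_monomial V gs ps) = va_monomial W (map f gs) ps"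
  using assms(2)
proof (induction ps)
  case Nil
  then show ?case using assms(1) by (simp add: va_hom_def)
next
  case (Cons x ps)
  obtain i n where x: "x = (i, n)" by (cases x)
  have "i < length gs" "ps \<in> pbw_words (length gs)" using Cons.prems by (auto simp: x pbw_words_def)
  then show ?case using Cons.IH assms(1) by (simp add: x va_hom_def)
qed

text \<open>By the creation property a generator is the monomial of a one-letter word.\<close>

lemma generator_in_weight_grading:
  assumes "vertex_algebra V" "i < length gs"
  shows "gs ! i \<in> weight_grading V gs ws (ws ! i)"
proof -
  have "gs ! i = va_monomial V gs [(i, 0)]"
    using assms(1) by (simp add: vertex_algebra_def)
  moreover have "[(i, 0)] \<in> {ps \<in> pbw_words (length gs). (\<Sum>(i, n)\<leftarrow>ps. ws ! i + n) = ws ! i}"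
    using assms(2) by (simp add: pbw_words_def)
  ultimately show ?thesis
    unfolding weight_grading_def by (intro cvec.span_base image_eqI)
qed

lemma graded_module_shift:
  assumes "graded_module V gr A R" "a \<in> gr \<Delta>" "w \<in> R m"
  shows "A a n w \<in> Rg R (int m - (n - int \<Delta> + 1))"
proof -
  have "A a ((n - int \<Delta> + 1) + int \<Delta> - 1) w \<in>
      (if n - int \<Delta> + 1 \<le> int m then R (nat (int m - (n - int \<Delta> + 1))) else {0})"
    using assms unfolding graded_module_def by blast
  then show ?thesis by (simp add: Rg_def split: if_splits)
qed

context
  fixes k :: complex and W :: "'u::complex_vector vertex_alg" and J Gp Gm L :: 'u
    and Wk :: "'w::complex_vector vertex_alg" and \<pi> :: "'u \<Rightarrow> 'w"
    and A :: "'w \<Rightarrow> int \<Rightarrow> 'r::complex_vector \<Rightarrow> 'r" and R :: "nat \<Rightarrow> 'r set"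
  assumes BP: "universal_BP k W J Gp Gm L"
    and Wk: "simple_graded_quotient W (BP_grading W J Gp Gm L) \<pi> Wk"
    and irr: "irreducible_graded_module Wk (\<lambda>n. \<pi> ` BP_grading W J Gp Gm L n) A R"
begin

definition bp_gen :: "nat \<Rightarrow> 'w" where "bp_gen i = map \<pi> [J, Gp, Gm, L] ! i"
text \<open>Equal lengths 1 would not do, because the expansion of G+ with G- contains :JJ:. With
  these values every commutator is shorter than the product by at least 1.\<close>

definition bp_len :: "nat \<Rightarrow> nat" where "bp_len i = [1, 2, 2, 2] ! i"
definition bp_wt :: "nat \<Rightarrow> nat" where "bp_wt i = [1, 1, 2, 2] ! i"

lemma bp_simps [simp]:
  "bp_gen 0 = \<pi> J" "bp_gen (Suc 0) = \<pi> Gp" "bp_gen 2 = \<pi> Gm" "bp_gen 3 = \<pi> L"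
  "bp_len 0 = 1" "bp_len (Suc 0) = 2" "bp_len 2 = 2" "bp_len 3 = 2"
  "bp_wt 0 = 1" "bp_wt (Suc 0) = 1" "bp_wt 2 = 2" "bp_wt 3 = 2"
  by (simp_all add: bp_gen_def bp_len_def bp_wt_def numeral_2_eq_2 numeral_3_eq_3)

lemma bp_graded: "graded_module Wk (\<lambda>n. \<pi> ` BP_grading W J Gp Gm L n) A R"
  using irr by (simp add: irreducible_graded_module_def)

lemma bp_module: "va_module Wk A"
  and bp_decomp: "direct_sum_decomp R"
  using bp_graded by (simp_all add: graded_module_def)

lemma bp_hom: "va_hom W Wk \<pi>"
  and bp_quotient_va: "vertex_algebra Wk"
  and bp_surj: "surj \<pi>"
  using Wk by (simp_all add: simple_graded_quotient_def)

lemma less_4_cases: "i < 4 \<longleftrightarrow> i = 0 \<or> i = Suc 0 \<or> i = 2 \<or> i = (3::nat)"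
  by auto

lemma bp_gen_shift:
  assumes "i < 4" "w \<in> R m"
  shows "A (bp_gen i) n w \<in> Rg R (int m - (n - int (bp_wt i) + 1))"
proof (rule graded_module_shift[OF bp_graded _ assms(2)])
  have "vertex_algebra W" using BP by (simp add: universal_BP_def)
  then have "[J, Gp, Gm, L] ! i \<in> BP_grading W J Gp Gm L ([1, 1, 2, 2] ! i)"
    unfolding BP_grading_def by (rule generator_in_weight_grading) (use assms(1) in simp)
  then show "bp_gen i \<in> \<pi> ` BP_grading W J Gp Gm L (bp_wt i)"
    unfolding bp_gen_def bp_wt_def using assms(1) by (subst nth_map) auto
qed

abbreviation (input) "bpX \<equiv> 3 *\<^sub>C normal_ordered Wk (\<pi> J) (\<pi> J) + (3 * (k + 1) / 2) *\<^sub>C deriv_field Wk (\<pi> J)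
          - (if k = -3 then \<pi> L else (k + 3) *\<^sub>C \<pi> L)"

lemma bp_ope:
  "ope Wk (\<pi> J) (\<pi> J) [0, ((2 * k + 3) / 3) *\<^sub>C vac Wk]"
  "ope Wk (\<pi> J) (\<pi> Gp) [\<pi> Gp]" "ope Wk (\<pi> J) (\<pi> Gm) [- \<pi> Gm]"
  "ope Wk (\<pi> Gp) (\<pi> Gp) []" "ope Wk (\<pi> Gm) (\<pi> Gm) []"
  "ope Wk (\<pi> Gp) (\<pi> Gm) [bpX, (3 * (k + 1)) *\<^sub>C \<pi> J, ((k + 1) * (2 * k + 3)) *\<^sub>C vac Wk]"
proof -
  note * = linear_map_simps[OF va_hom_linear[OF bp_hom]] va_hom_vac[OF bp_hom] va_hom_normal_ordered[OF bp_hom]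
    va_hom_deriv_field[OF bp_hom]
  note BP' = BP[unfolded universal_BP_def]
  have o: "ope W J J [0, ((2 * k + 3) / 3) *\<^sub>C vac W]" "ope W J Gp [Gp]" "ope W J Gm [- Gm]"
    "ope W Gp Gp []" "ope W Gm Gm []"
    using BP' by blast+
  show "ope Wk (\<pi> J) (\<pi> J) [0, ((2 * k + 3) / 3) *\<^sub>C vac Wk]"
    "ope Wk (\<pi> J) (\<pi> Gp) [\<pi> Gp]" "ope Wk (\<pi> J) (\<pi> Gm) [- \<pi> Gm]"
    "ope Wk (\<pi> Gp) (\<pi> Gp) []" "ope Wk (\<pi> Gm) (\<pi> Gm) []"
    using o[THEN va_hom_ope[OF bp_hom]] by (simp_all add: *)
  have "ope W Gp Gm
       [3 *\<^sub>C normal_ordered W J J + (3 * (k + 1) / 2) *\<^sub>C deriv_field W J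
          - (if k = -3 then L else (k + 3) *\<^sub>C L),
        (3 * (k + 1)) *\<^sub>C J, ((k + 1) * (2 * k + 3)) *\<^sub>C vac W]"
    using BP' by blast
  note GG = va_hom_ope[OF bp_hom this]
  have X: "\<pi> (3 *\<^sub>C normal_ordered W J J + (3 * (k + 1) / 2) *\<^sub>C deriv_field W J
          - (if k = -3 then L else (k + 3) *\<^sub>C L)) = bpX"
    by (cases "k = -3") (simp_all add: *)
  show "ope Wk (\<pi> Gp) (\<pi> Gm) [bpX, (3 * (k + 1)) *\<^sub>C \<pi> J, ((k + 1) * (2 * k + 3)) *\<^sub>C vac Wk]"
    using GG unfolding list.map X by (simp only: *)
qed

text \<open>A common shape for the central field at \<open>k = -3\<close>, with empty expansions,
  and the Virasoro field otherwise. The values of \<open>x\<close> and \<open>y\<close> do not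
  affect the length bounds and are left open.\<close>

lemma bp_ope_L:
  obtains cLL cLJ cGp cGm x y where
  "ope Wk (\<pi> L) (\<pi> L) cLL" "cLL = [] \<or> cLL = [deriv_field Wk (\<pi> L), 2 *\<^sub>C \<pi> L, 0, x *\<^sub>C vac Wk]"
  "ope Wk (\<pi> L) (\<pi> J) cLJ" "cLJ = [] \<or> cLJ = [deriv_field Wk (\<pi> J), \<pi> J]"
  "ope Wk (\<pi> L) (\<pi> Gp) cGp" "cGp = [] \<or> cGp = [deriv_field Wk (\<pi> Gp), y *\<^sub>C \<pi> Gp]"
  "ope Wk (\<pi> L) (\<pi> Gm) cGm" "cGm = [] \<or> cGm = [deriv_field Wk (\<pi> Gm), y *\<^sub>C \<pi> Gm]"
proof -
  note * = linear_map_simps[OF va_hom_linear[OF bp_hom]] va_hom_vac[OF bp_hom] va_hom_normal_ordered[OF bp_hom]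
    va_hom_deriv_field[OF bp_hom]
  note BP' = BP[unfolded universal_BP_def]
  show thesis
  proof (cases "k = -3")
    case True
    then have "ope W L L []" "ope W L J []" "ope W L Gp []" "ope W L Gm []" using BP' by simp_all
    from this[THEN va_hom_ope[OF bp_hom]] show thesis
      by (intro that[where x = 0 and y = 0 and cLL = "[]" and cLJ = "[]" and cGp = "[]" and cGm = "[]"]) simp_all
  next
    case False
    then have "ope W L L [deriv_field W L, 2 *\<^sub>C L, 0, (- ((2 * k + 3) * (3 * k + 1) / (k + 3)) / 2) *\<^sub>C vac W]"
      "ope W L J [deriv_field W J, J]" "ope W L Gp [deriv_field W Gp, (3/2) *\<^sub>C Gp]"
      "ope W L Gm [deriv_field W Gm, (3/2) *\<^sub>C Gm]"
      using BP' by simp_all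
    from this[THEN va_hom_ope[OF bp_hom]]
    have o: "ope Wk (\<pi> L) (\<pi> L) [deriv_field Wk (\<pi> L), 2 *\<^sub>C \<pi> L, 0,
          (- ((2 * k + 3) * (3 * k + 1) / (k + 3)) / 2) *\<^sub>C vac Wk]"
      "ope Wk (\<pi> L) (\<pi> J) [deriv_field Wk (\<pi> J), \<pi> J]"
      "ope Wk (\<pi> L) (\<pi> Gp) [deriv_field Wk (\<pi> Gp), (3/2) *\<^sub>C \<pi> Gp]"
      "ope Wk (\<pi> L) (\<pi> Gm) [deriv_field Wk (\<pi> Gm), (3/2) *\<^sub>C \<pi> Gm]"
      by (simp_all add: *)
    show thesis
      by (rule that[OF o(1) disjI2[OF refl] o(2) disjI2[OF refl] o(3) disjI2[OF refl] o(4) disjI2[OF refl]])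
  qed
qed

context
  fixes p :: 'r
begin

interpretation mode_words Wk A 4 bp_gen bp_len "\<lambda>i. int (bp_wt i)" p
  by standard (use bp_module in \<open>auto simp: less_4_cases\<close>)

lemma good_gens: "good (\<pi> J) 1 1" "good (\<pi> Gp) 2 1" "good (\<pi> Gm) 2 2" "good (\<pi> L) 2 2"
  using good_gen[of 0] good_gen[of "Suc 0"] good_gen[of 2] good_gen[of 3] by simp_all

lemma good_deriv: "good a la da \<Longrightarrow> good (deriv_field Wk a) la (da + 1)"
  unfolding deriv_field_def using good_nprod[OF _ good_vac[of 0] refl, of a la da "-2"] by (simp add: add.commute)

lemma good_normal_ordered: "good a la da \<Longrightarrow> good b lb db \<Longrightarrow> good (normal_ordered Wk a b) (la + lb) (da + db)"
  unfolding normal_ordered_def using good_nprod[OF _ _ refl, of a la da b lb db "-1"] by simp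

lemma comm_boundI:
  assumes "ope Wk (bp_gen i) (bp_gen i') cs"
    and "\<forall>n<length cs. good (cs ! n) (bp_len i + bp_len i' - 1) (int (bp_wt i) + int (bp_wt i') - 1 - int n)"
  shows "comm_bound i i'"
  unfolding comm_bound_def using good_ope[OF assms(1), of "bp_len i + bp_len i' - 1"
      "int (bp_wt i) + int (bp_wt i') - 1"] assms(2) by simp

lemma good_nth_Cons:
  "(\<forall>n<length (x # xs). good ((x # xs) ! n) l (d - int n)) \<longleftrightarrow>
    good x l d \<and> (\<forall>n<length xs. good (xs ! n) l (d - 1 - int n))"
  by (simp add: All_less_Suc2 algebra_simps)

lemma bp_comm_bounds: "comm_bound 0 0" "comm_bound 0 (Suc 0)" "comm_bound 0 2"
    "comm_bound (Suc 0) (Suc 0)" "comm_bound 2 2" "comm_bound (Suc 0) 2"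
proof -
  note g = good_gens
  have X: "good bpX 3 2"
  proof -
    have "good (normal_ordered Wk (\<pi> J) (\<pi> J)) 3 2"
      by (rule good_mono[OF good_normal_ordered[OF g(1) g(1)]]) simp_all
    moreover have "good (deriv_field Wk (\<pi> J)) 3 2"
      by (rule good_mono[OF good_deriv[OF g(1)]]) simp_all
    moreover have "good (if k = -3 then \<pi> L else (k + 3) *\<^sub>C \<pi> L) 3 2"
      using good_mono[OF g(4), of 3 2] by (auto intro: good_scale)
    ultimately show ?thesis by (intro good_add good_diff good_scale)
  qed
  have v: "good (c *\<^sub>C vac Wk) l 0" for c l by (rule good_scale[OF good_vac])
  show "comm_bound 0 0"
    by (rule comm_boundI, unfold bp_simps, rule bp_ope(1)) (unfold good_nth_Cons, simp add: v good_zero)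
  show "comm_bound 0 (Suc 0)"
    by (rule comm_boundI, unfold bp_simps, rule bp_ope(2)) (unfold good_nth_Cons, simp add: g g(2)[unfolded numeral_2_eq_2])
  show "comm_bound 0 2"
    by (rule comm_boundI, unfold bp_simps, rule bp_ope(3)) (unfold good_nth_Cons, simp add: good_minus g g(3)[unfolded numeral_2_eq_2, simplified])
  show "comm_bound (Suc 0) (Suc 0)"
    by (rule comm_boundI, unfold bp_simps, rule bp_ope(4)) simp
  show "comm_bound 2 2"
    by (rule comm_boundI, unfold bp_simps, rule bp_ope(5)) simp
  have J3: "good ((3 * (k + 1)) *\<^sub>C \<pi> J) 3 1"
    by (rule good_scale, rule good_mono[OF g(1)]) simp_all
  show "comm_bound (Suc 0) 2"
    by (rule comm_boundI, unfold bp_simps, rule bp_ope(6)) (unfold good_nth_Cons, use X J3 v in simp)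
qed

lemma bp_comm_bounds_L: "comm_bound 3 3" "comm_bound 3 0" "comm_bound 3 (Suc 0)" "comm_bound 3 2"
proof -
  note g = good_gens
  have v: "good (c *\<^sub>C vac Wk) l 0" for c l by (rule good_scale[OF good_vac])
  have J: "good (\<pi> J) 2 1" "good (deriv_field Wk (\<pi> J)) 2 2"
    using good_mono[OF g(1), of 2 1] good_mono[OF good_deriv[OF g(1)], of 2 2] by simp_all
  have h: "good (deriv_field Wk a) 3 (d + 1)" "good (c *\<^sub>C a) 3 d" if "good a 2 d" for a d c
    using good_mono[OF good_deriv[OF that], of 3 "d + 1"] good_scale[OF good_mono[OF that, of 3 d], of c] by simp_all
  note h1 = h[OF g(2), simplified] and h2 = h[OF g(3), simplified] and h3 = h[OF g(4), simplified]
  obtain cLL cLJ cGp cGm x y where o: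
    "ope Wk (\<pi> L) (\<pi> L) cLL" "cLL = [] \<or> cLL = [deriv_field Wk (\<pi> L), 2 *\<^sub>C \<pi> L, 0, x *\<^sub>C vac Wk]"
    "ope Wk (\<pi> L) (\<pi> J) cLJ" "cLJ = [] \<or> cLJ = [deriv_field Wk (\<pi> J), \<pi> J]"
    "ope Wk (\<pi> L) (\<pi> Gp) cGp" "cGp = [] \<or> cGp = [deriv_field Wk (\<pi> Gp), y *\<^sub>C \<pi> Gp]"
    "ope Wk (\<pi> L) (\<pi> Gm) cGm" "cGm = [] \<or> cGm = [deriv_field Wk (\<pi> Gm), y *\<^sub>C \<pi> Gm]"
    by (rule bp_ope_L)
  have "\<forall>n<length cLL. good (cLL ! n) 3 (3 - int n)"
    using o(2) by (elim disjE) (simp, hypsubst, unfold good_nth_Cons, simp add: h3 v good_zero)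
  then show "comm_bound 3 3" by (intro comm_boundI[of _ _ cLL]) (simp_all add: o(1))
  have "\<forall>n<length cLJ. good (cLJ ! n) 2 (2 - int n)"
    using o(4) by (elim disjE) (simp, hypsubst, unfold good_nth_Cons, simp add: J)
  then show "comm_bound 3 0" by (intro comm_boundI[of _ _ cLJ]) (simp_all add: o(3))
  have "\<forall>n<length cGp. good (cGp ! n) 3 (2 - int n)"
    using o(6) by (elim disjE) (simp, hypsubst, unfold good_nth_Cons, simp add: h1)
  then show "comm_bound 3 (Suc 0)" by (intro comm_boundI[of _ _ cGp]) (simp_all add: o(5))
  have "\<forall>n<length cGm. good (cGm ! n) 3 (3 - int n)"
    using o(8) by (elim disjE) (simp, hypsubst, unfold good_nth_Cons, simp add: h2)
  then show "comm_bound 3 2" by (intro comm_boundI[of _ _ cGm]) (simp_all add: o(7))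
qed

lemma good_monomials: "\<exists>la da. good (va_monomial Wk (map \<pi> [J, Gp, Gm, L]) ps) la da"
  if "ps \<in> pbw_words 4"
  using that
proof (induction ps)
  case Nil
  then show ?case using good_vac by auto
next
  case (Cons x ps)
  obtain i n where x: "x = (i, n)" by (cases x)
  have i: "i < 4" "ps \<in> pbw_words 4" using Cons.prems by (auto simp: x pbw_words_def)
  from Cons.IH[OF i(2)] obtain la da where "good (va_monomial Wk (map \<pi> [J, Gp, Gm, L]) ps) la da" by blast
  from good_nprod[OF good_gen[OF i(1)] this refl, of "- int n - 1"]
  show ?case unfolding x va_monomial.simps bp_gen_def[symmetric] by blast
qed

text \<open>The PBW monomials of \<open>W\<close> map to those of \<open>Wk\<close>, which span
  because the quotient map is surjective. Each is an iterated product of generators and hence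
  \<open>good\<close>.\<close>

lemma submodule_words: "submodule A all_words"
proof (rule submodule_all_words)
  let ?gs = "[J, Gp, Gm, L]"
  let ?B = "va_monomial Wk (map \<pi> ?gs) ` pbw_words 4"
  have l: "length ?gs = 4" by simp
  have "cvec.span (va_monomial W ?gs ` pbw_words 4) = UNIV"
    using BP unfolding universal_BP_def freely_strongly_generated_def l by blast
  then have b: "b \<in> cvec.span (va_monomial W ?gs ` pbw_words 4)" for b by simp
  have "\<pi> b \<in> cvec.span ?B" for b
  proof (rule linear_map_span[OF va_hom_linear[OF bp_hom] cvec.subspace_span _ b])
    fix x assume "x \<in> va_monomial W ?gs ` pbw_words 4"
    then obtain ps where ps: "ps \<in> pbw_words (length ?gs)" "x = va_monomial W ?gs ps" unfolding l by blast
    have "\<pi> x = va_monomial Wk (map \<pi> ?gs) ps"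
      unfolding ps(2) by (rule va_hom_monomial[OF bp_hom ps(1)])
    then show "\<pi> x \<in> cvec.span ?B"
      using ps(1) unfolding l by (intro cvec.span_base) blast
  qed
  then show "cvec.span ?B = UNIV" using bp_surj by (metis UNIV_eq_I surjD)
  show "\<exists>la da. good b la da" if "b \<in> ?B" for b using that good_monomials by blast
qed

text \<open>Words applied to \<open>p\<close> span a graded submodule, which is everything if
  \<open>p\<close> is non-zero. Words of positive drop vanish and all others stay in degree at least
  \<open>N > 0\<close>, so nothing would be left in degree 0, although \<open>R 0\<close> is
  non-zero.\<close>

lemma lowest_homogeneous_eq_0:
  assumes p: "p \<in> R N" "N > 0"
    and kill: "\<And>i n. i < 4 \<Longrightarrow> n - int (bp_wt i) + 1 > 0 \<Longrightarrow> A (bp_gen i) n p = 0"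
  shows "p = 0"
proof (rule ccontr)
  assume "p \<noteq> 0"
  have comm: "comm_bound i i' \<or> comm_bound i' i" if "i < 4" "i' < 4" for i i'
    using that bp_comm_bounds bp_comm_bounds_L by (auto simp: less_4_cases)
  have word: "apply_word ws p \<in> Rg R (int N - wdrop ws)" if "valid_word ws" for ws
    using that
  proof (induction ws)
    case Nil
    then show ?case using p by (simp add: Rg_def)
  next
    case (Cons x ws)
    obtain i n where x: "x = (i, n)" by (cases x)
    have "apply_word ws p \<in> Rg R (int N - wdrop ws)" using Cons by simp
    moreover have "A (bp_gen i) n 0 = 0" by (rule linear_map_zero[OF linear_A])
    ultimately show ?case
      using bp_gen_shift[of i "apply_word ws p" "nat (int N - wdrop ws)" n] Cons.prems
      by (auto simp: x Rg_def algebra_simps split: if_splits intro: cvec.subspace_0 subspace_R[OF bp_decomp])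
  qed
  have words: "u \<in> Rg R (int N - t)" if "u \<in> words l t" for l t u
    by (rule linear_words[OF linear_map_id subspace_Rg[OF bp_decomp] _ that]) (use word in auto)
  have graded_words: "graded_subspace R all_words"
    unfolding graded_subspace_def
  proof
    show "cvec.subspace all_words" by (simp add: all_words_def)
    have "u \<in> cvec.span (\<Union>n. R n \<inter> all_words)" if u: "u \<in> words l t" for u l t
    proof (cases "int N - t \<ge> 0")
      case True
      then have "u \<in> R (nat (int N - t)) \<inter> all_words"
        using words[OF u] words_subset_all_words u by (auto simp: Rg_def)
      then show ?thesis by (intro cvec.span_base) blast
    next
      case False
      then have "u = 0" using words[OF u] by (simp add: Rg_def)
      then show ?thesis by (simp add: cvec.span_zero)
    qed
    then show "all_words \<subseteq> cvec.span (\<Union>n. R n \<inter> all_words)"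
      unfolding all_words_def[of] by (intro cvec.span_minimal) auto
  qed
  have "all_words = UNIV"
    using irr submodule_words graded_words p_in_all_words \<open>p \<noteq> 0\<close>
    unfolding irreducible_graded_module_def by blast
  moreover have "lookup (decomp R u) 0 = 0" if "u \<in> all_words" for u
  proof -
    have "lookup (decomp R u) 0 = 0" if u: "u \<in> words l t" for u l t
    proof (cases "t > 0")
      case True
      then have "u = 0" using words_positive[OF comm kill True u] by blast
      then show ?thesis by (simp add: linear_map_zero[OF linear_map_cmp[OF bp_decomp]])
    next
      case False
      then show ?thesis using cmp_Rg[OF bp_decomp words[OF u], of 0] p(2) by auto
    qed
    then have "lookup (decomp R u) 0 \<in> {0}"
      by (intro linear_map_span[OF linear_map_cmp[OF bp_decomp] cvec.subspace_single_0 _ that[unfolded all_words_def]]) auto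
    then show ?thesis by simp
  qed
  ultimately have "R 0 \<subseteq> {0}" using cmp_R[OF bp_decomp, of _ 0 0] by auto
  then show False using bp_graded subspace_R[OF bp_decomp, of 0] by (auto simp: graded_module_def dest: cvec.subspace_0)
qed

end

text \<open>The positive modes of L are obtained from commutators of G+ with G-, after removing the
  contributions of J. The module index \<open>n\<close> of L corresponds to L(n-1), so
  \<open>n = 2\<close> is the mode L(1).\<close>

lemma bp_lowest_vectors:
  assumes J: "\<And>n. n \<ge> 1 \<Longrightarrow> A (\<pi> J) n w = 0" and Gp: "\<And>n. n \<ge> 1 \<Longrightarrow> A (\<pi> Gp) n w = 0"
    and Gm: "\<And>n. n \<ge> 2 \<Longrightarrow> A (\<pi> Gm) n w = 0" and GpGm: "A (\<pi> Gp) 1 (A (\<pi> Gm) 1 w) = 0"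
  shows "w \<in> R 0"
proof -
  note linA = va_module_linear[OF bp_module] and linAl = va_module_linear_left[OF bp_module]
  have vac: "A (c *\<^sub>C vac Wk) n u = (if n = -1 then c *\<^sub>C u else 0)" for c n u
    by (simp add: linear_map_scale[OF linAl] va_module_vac[OF bp_module])
  have GG: "nprod Wk (\<pi> Gp) (int j) (\<pi> Gm) = (if j = 0 then bpX else if j = 1 then (3 * (k + 1)) *\<^sub>C \<pi> J
      else if j = 2 then ((k + 1) * (2 * k + 3)) *\<^sub>C vac Wk else 0)" for j
    using bp_ope(6) by (auto simp: ope_def nth_Cons' less_Suc_eq numeral_2_eq_2)
  have JJ: "nprod Wk (\<pi> J) (int j) (\<pi> J) = (if j = 1 then ((2 * k + 3) / 3) *\<^sub>C vac Wk else 0)" for j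
    using bp_ope(1) by (auto simp: ope_def nth_Cons' less_Suc_eq)
  have L: "A (\<pi> L) n w = 0" if n: "n \<ge> 2" for n
  proof -
    \<comment> \<open>For \<open>n > 2\<close> the mode of G- already kills \<open>w\<close>; only
      \<open>n = 2\<close> needs \<open>GpGm\<close>.\<close>
    have "A (\<pi> Gm) (n - 1) w = 0 \<or> n = 2" using Gm[of "n - 1"] n by fastforce
    then have "A (\<pi> Gp) 1 (A (\<pi> Gm) (n - 1) w) = 0"
      using GpGm by (auto simp: linear_map_zero[OF linA])
    then have "0 = A (\<pi> Gp) 1 (A (\<pi> Gm) (n - 1) w) - A (\<pi> Gm) (n - 1) (A (\<pi> Gp) 1 w)"
      by (simp add: Gp linear_map_zero[OF linA])
    also have "\<dots> = Sum_any (\<lambda>j. (of_int 1 gchoose j) *\<^sub>C A (nprod Wk (\<pi> Gp) (int j) (\<pi> Gm)) (1 + (n - 1) - int j) w)"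
      by (rule borcherds(2)[OF bp_module])
    also have "\<dots> = A bpX n w"
    proof (subst Sum_any_single[of 0])
      \<comment> \<open>The term \<open>j = 1\<close> is J in mode \<open>n - 1 \<ge> 1\<close>, and
        \<open>j = 2\<close> is the vacuum in mode \<open>n - 2 \<ge> 0\<close>; both vanish on
        \<open>w\<close>.\<close>
      fix j :: nat assume j: "j \<noteq> 0"
      show "(of_int 1 gchoose j) *\<^sub>C A (nprod Wk (\<pi> Gp) (int j) (\<pi> Gm)) (1 + (n - 1) - int j) w = 0"
        using j n by (auto simp: GG va_module_vac[OF bp_module] J linear_map_scale[OF linAl] linear_map_zero[OF linAl])
    qed (simp add: GG[of 0, simplified] scaleC_one)
    finally have X: "A bpX n w = 0" ..
    have D: "A (deriv_field Wk (\<pi> J)) n w = 0"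
    proof -
      have "A (nprod Wk (\<pi> J) (-2) (vac Wk)) n w = 0"
        unfolding borcherds(1)[OF bp_module]
        by (rule Sum_any_zero) (use n in \<open>auto simp: va_module_vac[OF bp_module] J linear_map_zero[OF linA]\<close>)
      then show ?thesis by (simp add: deriv_field_def)
    qed
    have N: "A (normal_ordered Wk (\<pi> J) (\<pi> J)) n w = 0"
    proof -
      \<comment> \<open>The only term of mode \<open>n\<close> of :JJ: that does not vanish at once.
        The two modes of J commute because n - 1 is not 0.\<close>
      have "A (\<pi> J) (n - 1) (A (\<pi> J) 0 w) = A (\<pi> J) (n - 1) (A (\<pi> J) 0 w) - A (\<pi> J) 0 (A (\<pi> J) (n - 1) w)"
        using n by (simp add: J linear_map_zero[OF linA])
      also have "\<dots> = 0"
        unfolding borcherds(2)[OF bp_module]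
        by (rule Sum_any_zero) (use n in \<open>auto simp: JJ vac linear_map_zero[OF linAl]\<close>)
      finally have J0: "A (\<pi> J) (n - 1) (A (\<pi> J) 0 w) = 0" .
      have "A (\<pi> J) (n + -1 - int j) (A (\<pi> J) (int j) w) = 0" for j
        using J0 by (cases "j = 0") (simp_all add: J linear_map_zero[OF linA])
      moreover have "A (\<pi> J) (n + int j) w = 0" for j using n by (simp add: J)
      ultimately have "A (nprod Wk (\<pi> J) (-1) (\<pi> J)) n w = 0"
        unfolding borcherds(1)[OF bp_module] by (simp add: linear_map_zero[OF linA])
      then show ?thesis by (simp add: normal_ordered_def)
    qed
    have "A (if k = -3 then \<pi> L else (k + 3) *\<^sub>C \<pi> L) n w = 0"
      using X by (simp only: linear_map_diff[OF linAl] linear_map_add[OF linAl] linear_map_scale[OF linAl] D N) simp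
    \<comment> \<open>If k is not -3, the factor k + 3 can be cancelled.\<close>
    then show ?thesis
      by (auto simp: linear_map_scale[OF linAl] cvec.scale_eq_0_iff add_eq_0_iff2 split: if_splits)
  qed
  have kill: "A (bp_gen i) n w = 0" if "i < 4" "n - int (bp_wt i) + 1 > 0" for i n
    using that J Gp Gm L by (auto simp: less_4_cases)
  \<comment> \<open>The vector \<open>w\<close> may be inhomogeneous, but its components inherit all
    annihilation conditions.\<close>
  have "lookup (decomp R w) m = 0" if m: "m > 0" for m
  proof (rule lowest_homogeneous_eq_0[OF decomp(1)[OF bp_decomp] m])
    fix i n assume "i < 4" "n - int (bp_wt i) + 1 > 0"
    then show "A (bp_gen i) n (lookup (decomp R w) m) = 0"
      using kernel_cmp[OF bp_decomp linA bp_gen_shift kill] by blast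
  qed
  then have "(\<Sum>n\<in>keys (decomp R w). lookup (decomp R w) n) \<in> R 0"
    using decomp(1)[OF bp_decomp] by (intro cvec.subspace_sum subspace_R[OF bp_decomp]) (metis cvec.subspace_0 gr0I subspace_R[OF bp_decomp])
  then show ?thesis by (simp only: decomp(2)[OF bp_decomp])
qed

lemma bp_Rle_shift:
  assumes "w \<in> Rle R t"
  shows "A (\<pi> J) i w \<in> Rle R (t - (i - 1 + 1))"
    and "A (\<pi> Gp) i w \<in> Rle R (t - (i - 1 + 1))"
    and "A (\<pi> Gm) i w \<in> Rle R (t - (i - 2 + 1))"
  using Rle_shift[OF bp_decomp va_module_linear[OF bp_module] bp_gen_shift[of 0] assms]
    Rle_shift[OF bp_decomp va_module_linear[OF bp_module] bp_gen_shift[of "Suc 0"] assms]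
    Rle_shift[OF bp_decomp va_module_linear[OF bp_module] bp_gen_shift[of 2] assms] by simp_all

text \<open>The commutator of J(0) with a mode of G+ is that same mode of G+. This disposes of the
  J-term in f2 when mode 0 of f2 is used.\<close>

lemma Gp_J_zero:
  assumes "A (\<pi> Gp) 1 w = 0"
  shows "A (\<pi> Gp) 1 (A (\<pi> J) 0 w) = 0"
proof -
  have z: "((0::complex) gchoose j) = 0" if "j \<noteq> 0" for j
    using that by (cases j) simp_all
  have "A (\<pi> J) 0 (A (\<pi> Gp) 1 w) - A (\<pi> Gp) 1 (A (\<pi> J) 0 w)
    = A (nprod Wk (\<pi> J) (int 0) (\<pi> Gp)) (0 + 1 - int 0) w"
    unfolding borcherds(2)[OF bp_module]
    by (subst Sum_any_single[of 0]) (simp_all add: z scaleC_one)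
  also have "nprod Wk (\<pi> J) (int 0) (\<pi> Gp) = \<pi> Gp"
    using bp_ope(2) unfolding ope_def by (metis length_Cons nth_Cons_0 zero_less_Suc)
  finally show ?thesis
    using assms by (simp add: linear_map_zero[OF va_module_linear[OF bp_module]])
qed

end

section \<open>Vectors of minimal total degree in a submodule\<close>

section \<open>Almost irreducibility\<close>

lemma filt_exists:
  assumes dec: "direct_sum_decomp R"
  shows "\<exists>N. v \<in> filt (Rle R) (int N)"
proof -
  have "\<forall>x. \<exists>N. lookup v x \<in> Rle R (int N)" using Rle_exists[OF dec] by blast
  from choice[OF this] obtain N where N: "lookup v x \<in> Rle R (int (N x))" for x by blast
  have "v \<in> filt (Rle R) (int (\<Sum>x\<in>keys v. N x + fdeg (fst x)))"
    unfolding filt_def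
  proof (intro CollectI allI)
    fix x
    show "lookup v x \<in> Rle R (int (\<Sum>x\<in>keys v. N x + fdeg (fst x)) - int (fdeg (fst x)))"
    proof (cases "x \<in> keys v")
      case True
      then have "N x + fdeg (fst x) \<le> (\<Sum>x\<in>keys v. N x + fdeg (fst x))"
        using member_le_sum[of x "keys v" "\<lambda>x. N x + fdeg (fst x)"] by simp
      then have "int (N x) \<le> int (\<Sum>x\<in>keys v. N x + fdeg (fst x)) - int (fdeg (fst x))" by linarith
      then show ?thesis using N[of x] Rle_mono[OF dec] by blast
    next
      case False
      then show ?thesis using subspace_Rle[OF dec] by (simp only: in_keys_iff not_not cvec.subspace_0)
    qed
  qed
  then show ?thesis by blast
qed

lemma filt_neg: "direct_sum_decomp R \<Longrightarrow> v \<in> filt (Rle R) t \<Longrightarrow> t < 0 \<Longrightarrow> v = 0"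
proof (rule poly_mapping_eqI)
  fix x assume dec: "direct_sum_decomp R" and "v \<in> filt (Rle R) t" "t < 0"
  then have "lookup v x \<in> Rle R (t - int (fdeg (fst x)))" "t - int (fdeg (fst x)) < 0"
    unfolding filt_def by (blast, linarith)
  then have "lookup v x = 0" by (rule Rle_neg[OF dec])
  then show "lookup v x = lookup 0 x" by simp
qed

lemma lookup_lat_lat:
  "lookup (Pi_act s (lat p) (- rpair s p - 1) (lat (q - p))) ({#}, q) = 1"
proof -
  have "Pi_act s (lat p) (- rpair s p - 1) (lat (q - p)) = lat q"
    by (simp add: Pi_act_lat lat_vop_cfree[OF cfree_lat] lat_mult_lat)
  then show ?thesis by (simp add: lat_def)
qed

theorem theorem7p1:
  fixes k l1 l2 :: complex
    and V :: "'v::complex_vector vertex_alg" and X :: "complex^3^3 \<Rightarrow> 'v"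
    and Lk :: "'l::complex_vector vertex_alg" and \<pi>L :: "'v \<Rightarrow> 'l"
    and W :: "'u::complex_vector vertex_alg" and J Gp Gm L :: 'u
    and Wk :: "'w::complex_vector vertex_alg" and \<pi>W :: "'u \<Rightarrow> 'w"
    and \<iota> :: "'l \<Rightarrow> (fock_index \<Rightarrow>\<^sub>0 'w)"
    and A :: "'w \<Rightarrow> int \<Rightarrow> 'r::complex_vector \<Rightarrow> 'r" and R :: "nat \<Rightarrow> 'r set"
  assumes k: "k \<notin> \<nat>"
    and affine: "universal_affine_sl3 k V X"
    and Lk: "simple_graded_quotient V (affine_grading V X) \<pi>L Lk"
    and BP: "universal_BP k W J Gp Gm L"
    and Wk: "simple_graded_quotient W (BP_grading W J Gp Gm L) \<pi>W Wk"
    and realisation: "sl3_realisation k X \<pi>L Lk Wk (\<pi>W J) (\<pi>W Gp) (\<pi>W Gm) \<iota>"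
    and R: "irreducible_graded_module Wk (\<lambda>n. \<pi>W ` BP_grading W J Gp Gm L n) A R"
  shows "almost_irreducible (\<lambda>a. tens_act A (Pi_minus_act l1 l2) (\<iota> a)) (tens_space (R 0) Pi_top)"
  unfolding almost_irreducible_def
proof (intro allI impI, elim conjE)
  fix U assume U: "submodule (\<lambda>a. tens_act A (Pi_minus_act l1 l2) (\<iota> a)) U" "U \<noteq> {0}"
  define s :: shift where "s = ((-1, -1), (l1, l2))"
  have Pi_minus: "Pi_minus_act l1 l2 = Pi_act s"
    by (rule ext) (simp add: Pi_minus_act_def s_def)
  have rp: "rpair s q = - fst q - snd q" for q by (simp add: rpair_def s_def)
  note bp = BP Wk R
  note mod = bp_module[OF bp] and dec = bp_decomp[OF bp] and va = bp_quotient_va[OF bp]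
  note im = sl3_images[OF va realisation]
  let ?act = "tens_act A (Pi_act s)"
  let ?in = "tens (vac Wk)"
  let ?F = "\<lambda>t. filt (Rle R) t"
  note lin = linear_map_simps[OF tens_act_linear_left[OF mod]]
  note linA = va_module_linear[OF mod]

  have U_act: "?act (\<iota> a) n u \<in> U" if "u \<in> U" for a n u
    using U(1) that by (simp add: submodule_def Pi_minus)
  have U_0: "0 \<in> U" using U(1) by (simp add: submodule_def cvec.subspace_0)

  have subF: "cvec.subspace (?F t)" for t
    by (rule subspace_filt[OF subspace_Rle[OF dec]])
  \<comment> \<open>Fields of total weight one: mode \<open>n\<close> lowers the filtration degree
    by \<open>n\<close>. On this module \<open>lat q\<close> has weight q1 + q2, which explains the
    side conditions below.\<close>
  define wt1 where "wt1 t \<longleftrightarrow> (\<forall>N n u. u \<in> ?F N \<longrightarrow> ?act t n u \<in> ?F (N - n))" for t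
  have wt1_add: "wt1 (t + t')" if "wt1 t" "wt1 t'" for t t'
    unfolding wt1_def lin
    by (intro allI impI cvec.subspace_add subF) (use that in \<open>auto simp: wt1_def\<close>)
  have wt1_scale: "wt1 (c *\<^sub>C t)" if "wt1 t" for c t
    unfolding wt1_def lin
    by (intro allI impI cvec.subspace_scale subF) (use that in \<open>auto simp: wt1_def\<close>)
  have wt1_tens: "wt1 (tens a u)"
    if "\<And>i t w. w \<in> Rle R t \<Longrightarrow> A a i w \<in> Rle R (t - (i - \<Delta> + 1))" "u \<in> homog d q" "\<Delta> + d + fst q + snd q = 1"
    for a u \<Delta> d q
    unfolding wt1_def
    using tens_act_filt[OF mod subspace_Rle[OF dec] that(1,2)] that(3) by (simp add: rp)
  have vac_shift: "A (vac Wk) i w \<in> Rle R (t - (i - 0 + 1))" if "w \<in> Rle R t" for i t w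
    using that by (simp add: va_module_vac[OF mod] cvec.subspace_0 subspace_Rle[OF dec])
  have wt1_in: "wt1 (?in u)" if "u \<in> homog d q" "0 + d + fst q + snd q = 1" for u d q
    by (rule wt1_tens[OF _ that]) (rule vac_shift)
  have wt1_J: "wt1 (tens (\<pi>W J) u)" if "u \<in> homog d q" "1 + d + fst q + snd q = 1" for u d q
    by (rule wt1_tens[OF _ that]) (rule bp_Rle_shift[OF bp])
  have wt1_Gp: "wt1 (tens (\<pi>W Gp) u)" if "u \<in> homog d q" "1 + d + fst q + snd q = 1" for u d q
    by (rule wt1_tens[OF _ that]) (rule bp_Rle_shift[OF bp])
  have wt1_Gm: "wt1 (tens (\<pi>W Gm) u)" if "u \<in> homog d q" "2 + d + fst q + snd q = 1" for u d q
    by (rule wt1_tens[OF _ that]) (rule bp_Rle_shift[OF bp])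
  note hom = cvec.subspace_add[OF subspace_homog] cvec.subspace_diff[OF subspace_homog]
    cvec.subspace_scale[OF subspace_homog]
  have oscH: "osc a 0 \<in> homog 1 (0, 0)" for a by (rule osc_in_homog) (simp_all add: zero_prod_def)
  define e1 where "e1 = (1/2) *\<^sub>C (osc C1 0 * lat (-1, 1) + osc D1 0 * lat (-1, 1))"
  define H1 where "H1 = (1/2) *\<^sub>C osc C1 0 - (1/2) *\<^sub>C osc D1 0
           - ((2 * k + 9) / 6) *\<^sub>C osc C2 0 + (1/2) *\<^sub>C osc D2 0"
  define H2 where "H2 = osc D1 0 - osc C1 0 + ((4 * k + 9) / 6) *\<^sub>C osc C2 0 + (1/2) *\<^sub>C osc D2 0"
  obtain F1 where F1: "F1 \<in> homog 1 (1, -1)"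
    and f1: "\<iota> (\<pi>L (X sl3_f1)) = tens (\<pi>W Gp) (lat (0, 0)) + (-2) *\<^sub>C tens (\<pi>W J) (lat (1, -1)) + ?in F1"
    using im(6) by blast
  obtain F2 g0 where F2: "F2 \<in> homog 2 (-1, 0)" "g0 \<in> homog 1 (-1, 0)"
    and f2: "\<iota> (\<pi>L (X sl3_f2)) = tens (\<pi>W Gm) (lat (0, -1)) + tens (\<pi>W J) g0 + ?in F2"
    using im(7) by blast
  have e1H: "e1 \<in> homog 1 (-1, 1)" unfolding e1_def by (intro hom osc_lat_homog)
  have H1H: "H1 \<in> homog 1 (0, 0)" and H2H: "H2 \<in> homog 1 (0, 0)"
    unfolding H1_def H2_def by (intro hom oscH)+
  note latH = lat_in_homog[OF refl refl]

  have wt1_images: "wt1 (\<iota> (\<pi>L (X x)))" if "x \<in> {sl3_e1, sl3_e2, sl3_e3, sl3_h1, sl3_h2, sl3_f1, sl3_f2}" for x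
  proof -
    have "wt1 (\<iota> (\<pi>L (X sl3_e1)))" unfolding im e1_def[symmetric] by (rule wt1_in[OF e1H]) simp
    moreover have "wt1 (\<iota> (\<pi>L (X sl3_e2)))" unfolding im by (rule wt1_in[OF latH]) simp
    moreover have "wt1 (\<iota> (\<pi>L (X sl3_e3)))" unfolding im by (rule wt1_in[OF latH]) simp
    moreover have "wt1 (\<iota> (\<pi>L (X sl3_h1)))" unfolding im H1_def[symmetric]
      by (intro wt1_add wt1_scale wt1_J[OF latH] wt1_in[OF H1H]) simp_all
    moreover have "wt1 (\<iota> (\<pi>L (X sl3_h2)))" unfolding im H2_def[symmetric]
      by (intro wt1_add wt1_scale wt1_J[OF latH] wt1_in[OF H2H]) simp_all
    moreover have "wt1 (\<iota> (\<pi>L (X sl3_f1)))" unfolding f1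
      by (intro wt1_add wt1_scale wt1_Gp[OF latH] wt1_J[OF latH] wt1_in[OF F1]) simp_all
    moreover have "wt1 (\<iota> (\<pi>L (X sl3_f2)))" unfolding f2
      by (intro wt1_add wt1_scale wt1_Gm[OF latH] wt1_J[OF F2(2)] wt1_in[OF F2(1)]) simp_all
    ultimately show ?thesis using that by blast
  qed

  \<comment> \<open>The least filtration degree of a non-zero vector of the submodule; it exists
    because every vector has some filtration degree.\<close>
  define N where "N = (LEAST N. \<exists>v\<in>U. v \<noteq> 0 \<and> v \<in> ?F (int N))"
  have "\<exists>N. \<exists>v\<in>U. v \<noteq> 0 \<and> v \<in> ?F (int N)"
    using U(2) U_0 filt_exists[OF dec] by blast
  then have "\<exists>v\<in>U. v \<noteq> 0 \<and> v \<in> ?F (int N)"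
    unfolding N_def by (rule LeastI_ex)
  then obtain v where v: "v \<in> U" "v \<noteq> 0" "v \<in> ?F (int N)" by blast
  \<comment> \<open>The degree \<open>t\<close> is an integer, since lowering by a positive mode may
    lead below 0, where the filtration is zero.\<close>
  have minimal: "u = 0" if "u \<in> U" "u \<in> ?F t" "t < int N" for u t
  proof (cases "t < 0")
    case True
    then show ?thesis using filt_neg[OF dec that(2)] by blast
  next
    case False
    then have t: "t = int (nat t)" "nat t < N" using that(3) by auto
    have "\<not> (\<exists>v\<in>U. v \<noteq> 0 \<and> v \<in> ?F (int (nat t)))"
      using not_less_Least[OF t(2)[unfolded N_def]] .
    then show ?thesis using that t(1) by metis
  qed
  \<comment> \<open>Stated for every vector of degree at most \<open>N\<close> in \<open>U\<close>,
    so that it applies to \<open>v\<close> and also to its image under mode 0 of f2.\<close>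
  have kill: "?act (\<iota> (\<pi>L (X x))) n u = 0"
    if "x \<in> {sl3_e1, sl3_e2, sl3_e3, sl3_h1, sl3_h2, sl3_f1, sl3_f2}" "n \<ge> 1" "u \<in> U" "u \<in> ?F (int N)" for x n u
    by (rule minimal[OF U_act[OF that(3)]]) (use wt1_images[OF that(1)] that(2,4) in \<open>auto simp: wt1_def\<close>)

  have top: "lookup u (M, q) = 0" if u: "u \<in> U" "u \<in> ?F (int N)" and M: "M \<noteq> {#}" for u M q
  proof (rule ccontr)
    assume "lookup u (M, q) \<noteq> 0"
    \<comment> \<open>A functional that detects the unwanted coefficient turns \<open>u\<close> into
      a Fock vector to which \<open>fock_top\<close> applies.\<close>
    then obtain \<phi> :: "'r \<Rightarrow> complex" where \<phi>: "linear_map \<phi>" "\<phi> (lookup u (M, q)) \<noteq> 0"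
      by (rule separating_functional)
    let ?p = "Poly_Mapping.map \<phi> u"
    have map0: "Poly_Mapping.map \<phi> (0 :: fock_index \<Rightarrow>\<^sub>0 'r) = 0"
      by (rule poly_mapping_eqI) (simp add: map.rep_eq)
    have \<phi>0: "Pi_act s w n ?p = 0" if "?act (?in w) n u = 0" for w n
      using map_functional_tens_act_vac[OF mod \<phi>(1), of s w n u] that
      by (simp add: map0)
    have lk: "lookup ?p x = \<phi> (lookup u x)" for x
      by (simp add: map.rep_eq when_def linear_map_zero[OF \<phi>(1)])
    have "lookup ?p (M, q) = 0"
    proof (rule fock_top[where s = s])
      show "fst s = (-1, -1)" by (simp add: s_def)
      fix n :: int assume n: "n \<ge> 1"
      show "lat_vop s (1, 0) n ?p = 0" "lat_vop s (0, 1) n ?p = 0"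
        using \<phi>0 kill[OF _ n u, of sl3_e2] kill[OF _ n u, of sl3_e3] by (simp_all add: im flip: Pi_act_lat)
      have "Pi_act s e1 n ?p = 0"
        using \<phi>0 kill[OF _ n u, of sl3_e1] by (simp add: im e1_def)
      then show "Pi_act s (osc C1 0 * lat (-1, 1)) n ?p + Pi_act s (osc D1 0 * lat (-1, 1)) n ?p = 0"
        by (simp add: e1_def linear_map_simps[OF Pi_act_linear_left] flip: cvec.scale_right_distrib)
      \<comment> \<open>In h1 + 2 h2 the field J cancels, so only Heisenberg fields remain; the
        coefficient 3/2 of d2 is non-zero, as \<open>fock_top\<close> requires.\<close>
      let ?h = "\<iota> (\<pi>L (X sl3_h1)) + 2 *\<^sub>C \<iota> (\<pi>L (X sl3_h2))"
      let ?H = "(- 3/2) *\<^sub>C osc C1 0 + (3/2) *\<^sub>C osc D1 0 + ((6 * k + 9) / 6) *\<^sub>C osc C2 0 + (3/2) *\<^sub>C osc D2 0"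
      have H: "H1 + 2 *\<^sub>C H2 = ?H"
        unfolding H1_def H2_def by (rule poly_mapping_eqI) (simp add: lookup_add lookup_minus field_simps)
      have h: "?h = ?in (H1 + 2 *\<^sub>C H2)"
        unfolding im H1_def[symmetric] H2_def[symmetric]
        by (simp add: scaleC_add_right cvec.scale_minus_left linear_map_add[OF linear_map_tens_right]
            linear_map_scale[OF linear_map_tens_right])
      have "?act ?h n u = 0"
        using kill[OF _ n u, of sl3_h1] kill[OF _ n u, of sl3_h2] by (simp add: lin)
      then have "Pi_act s ?H n ?p = 0" unfolding h H by (rule \<phi>0)
      then show "(- 3/2) *\<^sub>C heis_mode s C1 n ?p + (3/2) *\<^sub>C heis_mode s D1 n ?p
          + ((6 * k + 9) / 6) *\<^sub>C heis_mode s C2 n ?p + (3/2) *\<^sub>C heis_mode s D2 n ?p = 0"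
        by (simp only: linear_map_simps[OF Pi_act_linear_left] Pi_act_osc)
    qed (use M in simp_all)
    then show False using \<phi>(2) by (simp add: lk)
  qed

  \<comment> \<open>By \<open>top\<close> all coefficients of \<open>u\<close> sit at empty
    monomials. Total weight one turns mode \<open>n\<close> of the tensor field into mode n +
    \<Delta> - 1 of \<open>a\<close>.\<close>
  have coeff: "lookup (?act (tens a w) n u) ({#}, q) =
      lookup (Pi_act s w (d - rpair s p - 1) (lat (q - p))) ({#}, q) *\<^sub>C A a (n + \<Delta> - 1) (lookup u ({#}, q - p))"
    if u: "u \<in> U" "u \<in> ?F (int N)" and w: "w \<in> homog d p" "\<Delta> + d + fst p + snd p = 1"
    for a w n u q d p \<Delta>
  proof -
    have "fst x = {#}" if "x \<in> keys u" for x
      using top[OF u, of "fst x" "snd x"] that by (auto simp: in_keys_iff)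
    from tens_act_lookup_top[OF mod this w(1) refl, where s = s and a = a and n = n and q = q]
    have "lookup (?act (tens a w) n u) ({#}, q) = lookup (Pi_act s w (d - rpair s p - 1) (lat (q - p))) ({#}, q)
        *\<^sub>C A a (n - 1 - (d - rpair s p - 1)) (lookup u ({#}, q - p))" .
    moreover have "n - 1 - (d - rpair s p - 1) = n + \<Delta> - 1" using w(2) by (simp add: rp)
    ultimately show ?thesis by (simp only:)
  qed
  have coeff_lat: "lookup (?act (tens a (lat p)) n u) ({#}, q) = A a (n + \<Delta> - 1) (lookup u ({#}, q - p))"
    if u: "u \<in> U" "u \<in> ?F (int N)" and w: "\<Delta> + fst p + snd p = 1" for a p n u q \<Delta>
    using coeff[OF u latH, of \<Delta> p a n q] w lookup_lat_lat[of s p q] by (simp add: scaleC_one)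
  \<comment> \<open>The vacuum would have to act by its mode \<open>n - 1 \<ge> 0\<close>, which is
    zero.\<close>
  have coeff_in: "lookup (?act (?in w) n u) ({#}, q) = 0"
    if u: "u \<in> U" "u \<in> ?F (int N)" and w: "w \<in> homog d p" "d + fst p + snd p = 1" and n: "n \<ge> 1"
    for w n u q d p
    using coeff[OF u w(1), of 0 "vac Wk" n q] w(2) n by (simp add: va_module_vac[OF mod])

  have J: "A (\<pi>W J) n (lookup u ({#}, q)) = 0"
    if u: "u \<in> U" "u \<in> ?F (int N)" and n: "n \<ge> 1" for u n q
  proof -
    have "lookup (?act (\<iota> (\<pi>L (X sl3_h2))) n u) ({#}, q) = 0"
      using kill[OF _ n u] by simp
    then show ?thesis
      unfolding im H2_def[symmetric]
      by (simp add: lin lookup_add coeff_in[OF u H2H _ n] coeff_lat[OF u, of 1])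
        (simp flip: zero_prod_def)
  qed
  have Gp: "A (\<pi>W Gp) n (lookup u ({#}, q)) = 0"
    if u: "u \<in> U" "u \<in> ?F (int N)" and n: "n \<ge> 1" for u n q
  proof -
    have "lookup (?act (\<iota> (\<pi>L (X sl3_f1))) n u) ({#}, q) = 0"
      using kill[OF _ n u] by simp
    \<comment> \<open>The J-term of f1 sits at a shifted momentum and vanishes by the conditions
      just obtained for J at every momentum.\<close>
    then show ?thesis
      unfolding f1
      by (simp add: lin lookup_add lookup_minus coeff_in[OF u F1 _ n] coeff_lat[OF u, of 1] J[OF u n])
        (simp flip: zero_prod_def)
  qed
  have f2_coeff: "lookup (?act (\<iota> (\<pi>L (X sl3_f2))) n u) ({#}, q) =
       A (\<pi>W Gm) (n + 1) (lookup u ({#}, q - (0, -1)))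
       + lookup (Pi_act s g0 (1 - rpair s (-1, 0) - 1) (lat (q - (-1, 0)))) ({#}, q)
           *\<^sub>C A (\<pi>W J) n (lookup u ({#}, q - (-1, 0)))
       + lookup (Pi_act s F2 (2 - rpair s (-1, 0) - 1) (lat (q - (-1, 0)))) ({#}, q)
           *\<^sub>C A (vac Wk) (n - 1) (lookup u ({#}, q - (-1, 0)))"
    if u: "u \<in> U" "u \<in> ?F (int N)" for u n q
    using coeff_lat[OF u, of 2 "(0, -1)" "\<pi>W Gm" n q] coeff[OF u F2(2), of 1 "\<pi>W J" n q]
      coeff[OF u F2(1), of 0 "vac Wk" n q]
    unfolding f2 by (simp add: lin lookup_add add.commute[of 1 n])
  have Gm: "A (\<pi>W Gm) n (lookup u ({#}, q)) = 0"
    if u: "u \<in> U" "u \<in> ?F (int N)" and n: "n \<ge> 2" for u n q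
  proof -
    have n': "n - 1 \<ge> 1" using n by simp
    \<comment> \<open>Mode n - 1 of f2 contains mode \<open>n\<close> of G-, as G- has weight 2.
      Adding (0, -1) to the momentum compensates the factor e^(-c2).\<close>
    have "lookup (?act (\<iota> (\<pi>L (X sl3_f2))) (n - 1) u) ({#}, q + (0, -1)) = 0"
      using kill[OF _ n' u] by simp
    then show ?thesis
      unfolding f2_coeff[OF u] using n by (simp add: J[OF u n'] va_module_vac[OF mod])
  qed
  \<comment> \<open>Mode 0 preserves the filtration degree, so this image of \<open>v\<close>
    satisfies the same annihilation conditions as \<open>v\<close>, even if it is zero.\<close>
  have "?act (\<iota> (\<pi>L (X sl3_f2))) 0 v \<in> ?F (int N - 0)"
    using wt1_images[of sl3_f2] v(3) unfolding wt1_def by blast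
  then have v': "?act (\<iota> (\<pi>L (X sl3_f2))) 0 v \<in> U" "?act (\<iota> (\<pi>L (X sl3_f2))) 0 v \<in> ?F (int N)"
    using U_act[OF v(1)] by simp_all
  have GpGm: "A (\<pi>W Gp) 1 (A (\<pi>W Gm) 1 (lookup v ({#}, q))) = 0" for q
  proof -
    \<comment> \<open>For n = 0 the vacuum term has mode -1, the identity. The coefficient is thus
      G- in mode 1 on the wanted vector, plus multiples of w' and J(0) w' for another coefficient w'
      of \<open>v\<close>; mode 1 of G+ kills the last two.\<close>
    have "A (\<pi>W Gp) 1 (lookup (?act (\<iota> (\<pi>L (X sl3_f2))) 0 v) ({#}, q + (0, -1))) = 0"
      by (rule Gp[OF v']) simp
    then show ?thesis
      unfolding f2_coeff[OF v(1,3)]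
      by (simp add: linear_map_simps[OF linA] Gp_J_zero[OF bp Gp[OF v(1,3)]] Gp[OF v(1,3)] va_module_vac[OF mod])
  qed
  have R0: "lookup v ({#}, q) \<in> R 0" for q
    by (rule bp_lowest_vectors[OF bp]) (simp_all add: J[OF v(1,3)] Gp[OF v(1,3)] Gm[OF v(1,3)] GpGm)
  have "tens (lookup v y) (single y 1) \<in> tens_space (R 0) Pi_top" if y: "y \<in> keys v" for y
  proof -
    have "fst y = {#}"
      using top[OF v(1,3), of "fst y" "snd y"] y by (auto simp: in_keys_iff)
    then have "single y 1 = lat (snd y)" "lookup v y \<in> R 0"
      using R0[of "snd y"] by (cases y; simp add: lat_def)+
    then show ?thesis
      unfolding tens_space_def Pi_top_def
      by (intro cvec.span_base) (use cvec.span_base[of "lat (snd y)" "range lat"] in auto)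
  qed
  then have "(\<Sum>y\<in>keys v. tens (lookup v y) (single y 1)) \<in> tens_space (R 0) Pi_top"
    unfolding tens_space_def by (intro cvec.span_sum)
  then have "v \<in> tens_space (R 0) Pi_top"
    by (simp only: tens_decomp)
  then show "U \<inter> tens_space (R 0) Pi_top \<noteq> {0}" using v by blast
qed

end
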